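(* Let $(P,d)$ be a finite metric space with $n=|P|$ and pairwise distinct pairwise distances, and let $k\in\mathbb{N}$, $\alpha,\varepsilon\in\mathbb{R}_{>0}$ and $\delta\in(0,1)$. If there exists a feasible solution for the $\alpha$-fair $k$-center problem on $P$, then Algorithm $(10,2+\varepsilon)$-ApproxFairCenter$(k,\alpha,\delta)$ (with precision parameter $\varepsilon$) computes with probability at least $1-\delta$ a $(10,2+\varepsilon)$-approximation for the $\alpha$-fair $k$-center problem. Its running time is $O(kn\log(n/\delta)+k^2/\varepsilon)$.
   Context: Distances can be computed in constant time. For $C\subseteq P$, $d(p,C):=\min_{c\in C}d(p,c)$ ($=\infty$ if $C=\emptyset$), $\mathrm{cost}(P,C):=\max_{p\in P}d(p,C)$, $B(p,r):=\{q\in P:d(p,q)\le r\}$, and $r_m(p):=\inf\{r\ge0:|B(p,r)|\ge n/m\}$ for $m\in\mathbb{N}$. $C\subseteq P$ is $(\alpha,k)$-fair if $d(p,C)\le\alpha r_k(p)$ for all $p$; a feasible solution for the $\alpha$-fair $k$-center problem is an $(\alpha,k)$-fair $C$ with $|C|\le k$; the problem minimizes $\mathrm{cost}(P,C)$ over feasible solutions, with optimal cost $\Delta^*$. A set $C\subseteq P$ of size $k$ is a $(\beta,\gamma)$-approximation if $\mathrm{cost}(P,C)\le\beta\Delta^*$ and $C$ is $(\gamma\alpha,k)$-fair. $\mathrm{FairCenter}(k,\alpha,\Delta,r)$: order $P=\{p_1,\dots,p_n\}$ with $r(p_1)\le\dots\le r(p_n)$; $C:=\emptyset$; for $i=1..n$,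 if $d(p_i,C)>2\min\{\alpha r(p_i),\Delta\}$ add $p_i$ to $C$; return $C$. $(2,2)$-ApproxFairCenter$(k,\alpha)$: binary search over the set of pairwise distances of $P$ for the smallest $\Delta$ with $|\mathrm{FairCenter}(k,\alpha,\Delta,r_k)|\le k$; if none, report no feasible solution, else return $\mathrm{FairCenter}(k,\alpha,\Delta,r_k)$. $\mathrm{FairSampling}(k,\delta)$: $s:=36k\lceil\ln(2n/\delta)\rceil$, $t:=27\lceil\ln(2n/\delta)\rceil$; sample $S$ of size $s$ uniformly with replacement from $P$; $r'(p):=$ distance from $p$ to its $t$-nearest neighbor in $S$. $\mathrm{ApproxFairRadii}(k,\delta)$: take $r'$ from FairSampling; process points in non-decreasing order of $r'$ (via a min-heap); for the first point $p$ set $\tilde r(p):=r_k(p)$ (computed exactly) and $C:=\{p\}$; for each subsequent $p$: if some $q\in C$ has $r'(p)+r'(q)\ge d(p,q)$, set $\tilde r(p):=d(p,q)+\tilde r(q)$; else set $\tilde r(p):=r_k(p)$ (exactly), add $p$ to $C$, and return Fail if $|C|>3k$; return $\tilde r$. $\mathrm{CostCandidates}(k,\varepsilon')$: let $C_G$ be the output of Gonzalez's algorithm (arbitrary first center, then repeatedly add a point furthest from current centers until $k$ centers), $\Delta_G:=\max_p d(p,C_G)$; return $L:=\{\tfrac12(1+\varepsilon')^j\Delta_G: 1\le j\le\lceil\log_{1+\varepsilon'}16\rceil\}\cup\{\tfrac12(1+\varepsilon')^jd(g_1,g_2): g_1\ne g_2\in C_G,\ 1\le j\le\lceil\log_{1+\varepsilon'}4\rceil\}$.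 Algorithm $(10,2+\varepsilon)$-ApproxFairCenter$(k,\alpha,\delta)$: if $k>n/6$ or $k^2/\varepsilon>n^2\log n$, return $(2,2)$-ApproxFairCenter$(k,\alpha)$. Otherwise let $\tilde r:=\mathrm{ApproxFairRadii}(k,\delta)$; if this is Fail, return Fail. Let $L:=\mathrm{CostCandidates}(k,\varepsilon/2)$; binary search over $L$ for the smallest $\Delta$ with $|\mathrm{FairCenter}(k,\alpha,\Delta,\tilde r)|\le k$; if none exists report that no feasible solution exists, otherwise return $\mathrm{FairCenter}(k,\alpha,\Delta,\tilde r)$.
   Formalization: The approximation has cost at most (2+ε)Δ* and is (10α,k)-fair: the two factors are swapped relative to the stated definition, since the literal order fails for large ε. "Size k" is read as size at most k, and the running time is claimed for n ≥ 2. *)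

theory Defs
  imports "HOL-Probability.Probability"
begin

section \<open>Fair \<open>k\<close>-center\<close>

text \<open>A finite metric space is given by \<open>Metric_space P d\<close> and \<open>finite P\<close>, so that
  \<open>Metric_space.mcball P d p r\<close> is the ball of radius \<open>r\<close> around \<open>p\<close> within \<open>P\<close>.\<close>

definition distinct_distances :: "'a set \<Rightarrow> ('a \<Rightarrow> 'a \<Rightarrow> real) \<Rightarrow> bool" where
  "distinct_distances P d \<longleftrightarrow>
     (\<forall>p\<in>P. \<forall>q\<in>P. \<forall>p'\<in>P. \<forall>q'\<in>P. p \<noteq> q \<and> p' \<noteq> q' \<and> d p q = d p' q' \<longrightarrow> {p, q} = {p', q'})"

definition dist_to :: "('a \<Rightarrow> 'a \<Rightarrow> real) \<Rightarrow> 'a \<Rightarrow> 'a set \<Rightarrow> ereal" where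
  "dist_to d p C = (if C = {} then \<infinity> else ereal (Min (d p ` C)))"

definition cost :: "'a set \<Rightarrow> ('a \<Rightarrow> 'a \<Rightarrow> real) \<Rightarrow> 'a set \<Rightarrow> ereal" where
  "cost P d C = Max ((\<lambda>p. dist_to d p C) ` P)"

definition fair_radius :: "'a set \<Rightarrow> ('a \<Rightarrow> 'a \<Rightarrow> real) \<Rightarrow> nat \<Rightarrow> 'a \<Rightarrow> real" where
  "fair_radius P d m p =
     Inf {r. 0 \<le> r \<and> real (card (Metric_space.mcball P d p r)) \<ge> real (card P) / real m}"

definition fair :: "'a set \<Rightarrow> ('a \<Rightarrow> 'a \<Rightarrow> real) \<Rightarrow> real \<Rightarrow> nat \<Rightarrow> 'a set \<Rightarrow> bool" where
  "fair P d \<alpha> k C \<longleftrightarrow>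
     C \<subseteq> P \<and> (\<forall>p\<in>P. dist_to d p C \<le> ereal (\<alpha> * fair_radius P d k p))"

definition feasible :: "'a set \<Rightarrow> ('a \<Rightarrow> 'a \<Rightarrow> real) \<Rightarrow> real \<Rightarrow> nat \<Rightarrow> 'a set \<Rightarrow> bool" where
  "feasible P d \<alpha> k C \<longleftrightarrow> fair P d \<alpha> k C \<and> card C \<le> k"

definition opt_cost :: "'a set \<Rightarrow> ('a \<Rightarrow> 'a \<Rightarrow> real) \<Rightarrow> real \<Rightarrow> nat \<Rightarrow> ereal" where
  "opt_cost P d \<alpha> k = (INF C\<in>{C. feasible P d \<alpha> k C}. cost P d C)"

text \<open>The factor \<open>\<beta>\<close> bounds the cost and \<open>\<gamma>\<close> the fairness. As for feasible solutions, \<open>k\<close> is an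
  upper bound on the number of centers.\<close>

definition approximation ::
  "'a set \<Rightarrow> ('a \<Rightarrow> 'a \<Rightarrow> real) \<Rightarrow> real \<Rightarrow> nat \<Rightarrow> real \<Rightarrow> real \<Rightarrow> 'a set \<Rightarrow> bool" where
  "approximation P d \<alpha> k \<beta> \<gamma> C \<longleftrightarrow>
     card C \<le> k \<and> cost P d C \<le> ereal \<beta> * opt_cost P d \<alpha> k \<and> fair P d (\<gamma> * \<alpha>) k C"

section \<open>Computations with step counts\<close>

text \<open>
  The cost model is a RAM with exact real arithmetic in which evaluating the distance of two
  points, comparing two points, drawing a uniformly distributed point, and each elementary
  operation on numbers (including logarithm and rounding) takes constant time. A step is counted
  for every call of a recursive function below, for every distance evaluation in a list traversal,
  and for every sampled point. Between two counted steps only a constant number of elementary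
  operations takes place. In particular, all list operations whose running time is not constant
  (length, indexing, append, map, filter, ...) are recursive functions that count their own steps.
\<close>

datatype 'a timed = Timed (result: 'a) (steps: nat)

definition ret :: "'a \<Rightarrow> 'a timed" where
  "ret x = Timed x 0"

definition tick :: "unit timed" where
  "tick = Timed () 1"

definition bind_timed :: "'a timed \<Rightarrow> ('a \<Rightarrow> 'b timed) \<Rightarrow> 'b timed" where
  "bind_timed m f = Timed (result (f (result m))) (steps m + steps (f (result m)))"

adhoc_overloading Monad_Syntax.bind \<rightleftharpoons> bind_timed

lemma result_bind [simp]: "result (bind_timed m f) = result (f (result m))"
  and steps_bind [simp]: "steps (bind_timed m f) = steps m + steps (f (result m))"
  by (simp_all add: bind_timed_def)

lemma ret_simps [simp]: "result (ret x) = x" "steps (ret x) = 0"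
  by (simp_all add: ret_def)

lemma tick_simps [simp]: "steps tick = 1"
  by (simp add: tick_def)

lemma bind_timed_cong [fundef_cong]:
  "m = m' \<Longrightarrow> (\<And>x. x = result m' \<Longrightarrow> f x = f' x) \<Longrightarrow> bind_timed m f = bind_timed m' f'"
  by (simp add: bind_timed_def)

section \<open>Lists\<close>

fun tlength :: "'a list \<Rightarrow> nat timed" where
  "tlength [] = do {tick; ret 0}"
| "tlength (x # xs) = do {tick; n \<leftarrow> tlength xs; ret (Suc n)}"

text \<open>The index is always smaller than the length of the list.\<close>

fun tnth :: "'a list \<Rightarrow> nat \<Rightarrow> 'a timed" where
  "tnth [] i = do {tick; ret undefined}"
| "tnth (x # xs) 0 = do {tick; ret x}"
| "tnth (x # xs) (Suc i) = do {tick; tnth xs i}"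

fun tmap :: "('a \<Rightarrow> 'b timed) \<Rightarrow> 'a list \<Rightarrow> 'b list timed" where
  "tmap f [] = do {tick; ret []}"
| "tmap f (x # xs) = do {tick; y \<leftarrow> f x; ys \<leftarrow> tmap f xs; ret (y # ys)}"

fun tfilter :: "('a \<Rightarrow> bool) \<Rightarrow> 'a list \<Rightarrow> 'a list timed" where
  "tfilter A [] = do {tick; ret []}"
| "tfilter A (x # xs) = do {tick; ys \<leftarrow> tfilter A xs; ret (if A x then x # ys else ys)}"

fun tappend :: "'a list \<Rightarrow> 'a list \<Rightarrow> 'a list timed" where
  "tappend [] ys = do {tick; ret ys}"
| "tappend (x # xs) ys = do {tick; zs \<leftarrow> tappend xs ys; ret (x # zs)}"

fun tconcat :: "'a list list \<Rightarrow> 'a list timed" where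
  "tconcat [] = do {tick; ret []}"
| "tconcat (xs # xss) = do {tick; ys \<leftarrow> tconcat xss; tappend xs ys}"

lemma result_tlength [simp]: "result (tlength xs) = length xs"
  by (induction xs) auto

lemma result_tnth [simp]: "i < length xs \<Longrightarrow> result (tnth xs i) = xs ! i"
  by (induction xs i rule: tnth.induct) auto

lemma result_tmap [simp]: "result (tmap f xs) = map (\<lambda>x. result (f x)) xs"
  by (induction xs) auto

lemma result_tfilter [simp]: "result (tfilter A xs) = filter A xs"
  by (induction xs) auto

section \<open>Selection in linear time\<close>

fun tinsert :: "real \<Rightarrow> real list \<Rightarrow> real list timed" where
  "tinsert x [] = do {tick; ret [x]}"
| "tinsert x (y # ys) =
     do {tick; if x \<le> y then ret (x # y # ys) else do {zs \<leftarrow> tinsert x ys; ret (y # zs)}}"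

fun insertion_sort :: "real list \<Rightarrow> real list timed" where
  "insertion_sort [] = do {tick; ret []}"
| "insertion_sort (x # xs) = do {tick; ys \<leftarrow> insertion_sort xs; tinsert x ys}"

definition median :: "real list \<Rightarrow> real timed" where
  "median xs = do {ys \<leftarrow> insertion_sort xs; n \<leftarrow> tlength ys; tnth ys (n div 2)}"

fun fives :: "'a list \<Rightarrow> 'a list list timed" where
  "fives (a # b # c # d # e # xs) = do {tick; xss \<leftarrow> fives xs; ret ([a, b, c, d, e] # xss)}"
| "fives [] = do {tick; ret []}"
| "fives xs = do {tick; ret [xs]}"

lemma set_tinsert: "set (result (tinsert x xs)) = insert x (set xs)"
  by (induction x xs rule: tinsert.induct) auto

lemma length_tinsert: "length (result (tinsert x xs)) = Suc (length xs)"
  by (induction x xs rule: tinsert.induct) auto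

lemma set_insertion_sort: "set (result (insertion_sort xs)) = set xs"
  by (induction xs) (auto simp: set_tinsert)

lemma length_insertion_sort: "length (result (insertion_sort xs)) = length xs"
  by (induction xs) (auto simp: length_tinsert)

lemma median_in_set: "xs \<noteq> [] \<Longrightarrow> result (median xs) \<in> set xs"
  using nth_mem[of "length xs div 2" "result (insertion_sort xs)"]
  by (simp add: median_def set_insertion_sort length_insertion_sort)

lemma fives_props:
  "(\<forall>ys\<in>set (result (fives xs)). ys \<noteq> [] \<and> set ys \<subseteq> set xs) \<and>
   5 * length (result (fives xs)) \<le> length xs + 4 \<and> (xs \<noteq> [] \<longrightarrow> result (fives xs) \<noteq> [])"
  by (induction xs rule: fives.induct) auto

text \<open>\<open>select i xs\<close> is the element at index \<open>i\<close> of the sorted list \<open>xs\<close>, found by the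
  median-of-medians algorithm.\<close>

function select :: "nat \<Rightarrow> real list \<Rightarrow> real timed" where
  "select i xs = do {
     tick;
     n \<leftarrow> tlength xs;
     if n \<le> 100 then do {
       ys \<leftarrow> insertion_sort xs;
       tnth ys i
     } else do {
       xss \<leftarrow> fives xs;
       ms \<leftarrow> tmap median xss;
       m \<leftarrow> tlength ms;
       x \<leftarrow> select (m div 2) ms;
       ls \<leftarrow> tfilter (\<lambda>y. y < x) xs;
       es \<leftarrow> tfilter (\<lambda>y. y = x) xs;
       gs \<leftarrow> tfilter (\<lambda>y. y > x) xs;
       l \<leftarrow> tlength ls;
       e \<leftarrow> tlength es;
       if i < l then select i ls
       else if i < l + e then ret x
       else select (i - (l + e)) gs
     }
   }"
  by pat_completeness auto


lemma medians_subset: "set (map (\<lambda>ys. result (median ys)) (result (fives xs))) \<subseteq> set xs"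
  using fives_props[of xs] median_in_set by fastforce

lemma length_partition3:
  "length (filter (\<lambda>y. y < x) xs) + length (filter (\<lambda>y. y = x) xs) + length (filter (\<lambda>y. y > x) xs)
   = length (xs :: real list)"
  by (induction xs) auto

lemma select_in_set_dom:
  "select_dom (i, xs) \<Longrightarrow> i < length xs \<Longrightarrow> result (select i xs) \<in> set xs"
proof (induction i xs rule: select.pinduct)
  case (1 i xs)
  show ?case
  proof (cases "length xs \<le> 100")
    case True
    then show ?thesis
      using "1.prems" nth_mem[of i "result (insertion_sort xs)"]
      by (simp add: select.psimps[OF "1.hyps"] set_insertion_sort length_insertion_sort)
  next
    case False
    define ms where "ms = map (\<lambda>ys. result (median ys)) (result (fives xs))"
    define x where "x = result (select (length ms div 2) ms)"
    have "ms \<noteq> []"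
      using False fives_props[of xs] by (auto simp: ms_def)
    then have "x \<in> set ms"
      unfolding x_def using False by (intro "1.IH"(1)) (simp_all add: ms_def)
    then have x: "x \<in> set xs"
      using medians_subset[of xs] by (auto simp: ms_def)
    let ?ls = "filter (\<lambda>y. y < x) xs"
    let ?es = "filter (\<lambda>y. y = x) xs"
    let ?gs = "filter (\<lambda>y. y > x) xs"
    have eq: "result (select i xs) =
      (if i < length ?ls then result (select i ?ls)
       else if i < length ?ls + length ?es then x
       else result (select (i - (length ?ls + length ?es)) ?gs))"
      using False by (simp add: select.psimps[OF "1.hyps"] x_def ms_def comp_def)
    consider "i < length ?ls" | "\<not> i < length ?ls" "i < length ?ls + length ?es"
      | "\<not> i < length ?ls" "\<not> i < length ?ls + length ?es"
      by blast
    then show ?thesis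
    proof cases
      case 1
      have "result (select i ?ls) \<in> set ?ls"
        using False 1 by (intro "1.IH"(2)) (simp_all add: x_def ms_def comp_def)
      then show ?thesis using 1 eq by auto
    next
      case 2
      then show ?thesis using eq x by auto
    next
      case 3
      have "result (select (i - (length ?ls + length ?es)) ?gs) \<in> set ?gs"
        using False 3 "1.prems" length_partition3[of x xs]
        by (intro "1.IH"(3)) (simp_all add: x_def ms_def comp_def)
      then show ?thesis using 3 eq by auto
    qed
  qed
qed

lemma pivot_in_set:
  assumes "select_dom (length ms div 2, ms)"
    and "ms = map (\<lambda>ys. result (median ys)) (result (fives xs))" and "\<not> length xs \<le> 100"
  shows "result (select (length ms div 2) ms) \<in> set xs"
proof -
  have "ms \<noteq> []"
    using assms(2,3) fives_props[of xs] by auto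
  then show ?thesis
    using select_in_set_dom[OF assms(1)] medians_subset[of xs] assms(2) by auto
qed

lemma select_terminates: "All select_dom"
proof (relation "Wellfounded.measure (\<lambda>(i, xs). length xs)", goal_cases)
  case 1
  then show ?case by simp
next
  case (2 i xs)
  then show ?case using fives_props[of xs] by simp
next
  case (3 i xs _ _ _ ms _ x)
  then have "x \<in> set xs"
    using pivot_in_set[of ms xs] by simp
  then have "length (filter (\<lambda>y. y < x) xs) < length xs"
    by (intro length_filter_less[of x]) auto
  then show ?case using 3 by simp
next
  case (4 i xs _ _ _ ms _ x)
  then have "x \<in> set xs"
    using pivot_in_set[of ms xs] by simp
  then have "length (filter (\<lambda>y. y > x) xs) < length xs"
    by (intro length_filter_less[of x]) auto
  then show ?case using 4 by simp
qed

termination select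
  by (rule select_terminates)

declare select.simps [simp del]

lemma select_in_set: "i < length xs \<Longrightarrow> result (select i xs) \<in> set xs"
  using select_in_set_dom select_terminates by blast

section \<open>Sorting with a leftist heap\<close>

datatype 'a heap = Empty | Heap nat "'a heap" real 'a "'a heap"

fun rank :: "'a heap \<Rightarrow> nat" where
  "rank Empty = 0"
| "rank (Heap n l x v r) = n"

definition heap_node :: "'a heap \<Rightarrow> real \<Rightarrow> 'a \<Rightarrow> 'a heap \<Rightarrow> 'a heap" where
  "heap_node l x v r =
     (if rank r \<le> rank l then Heap (Suc (rank r)) l x v r else Heap (Suc (rank l)) r x v l)"

fun heap_merge :: "'a heap \<Rightarrow> 'a heap \<Rightarrow> 'a heap timed" where
  "heap_merge Empty h = do {tick; ret h}"
| "heap_merge h Empty = do {tick; ret h}"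
| "heap_merge (Heap n1 l1 x1 v1 r1) (Heap n2 l2 x2 v2 r2) = do {
     tick;
     if x1 \<le> x2 then do {
       h \<leftarrow> heap_merge r1 (Heap n2 l2 x2 v2 r2);
       ret (heap_node l1 x1 v1 h)
     } else do {
       h \<leftarrow> heap_merge (Heap n1 l1 x1 v1 r1) r2;
       ret (heap_node l2 x2 v2 h)
     }
   }"

fun heap_of :: "(real \<times> 'a) list \<Rightarrow> 'a heap timed" where
  "heap_of [] = do {tick; ret Empty}"
| "heap_of ((x, v) # ps) = do {tick; h \<leftarrow> heap_of ps; heap_merge (Heap 1 Empty x v Empty) h}"

fun pop_all :: "nat \<Rightarrow> 'a heap \<Rightarrow> (real \<times> 'a) list timed" where
  "pop_all (Suc n) (Heap _ l x v r) =
     do {tick; h \<leftarrow> heap_merge l r; ps \<leftarrow> pop_all n h; ret ((x, v) # ps)}"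
| "pop_all _ _ = do {tick; ret []}"

definition heap_sort :: "(real \<times> 'a) list \<Rightarrow> (real \<times> 'a) list timed" where
  "heap_sort ps = do {n \<leftarrow> tlength ps; h \<leftarrow> heap_of ps; pop_all n h}"

section \<open>The algorithms\<close>

text \<open>The input is a list \<open>xs\<close> that enumerates \<open>P\<close>, together with the distance function.\<close>

definition distances :: "('a \<Rightarrow> 'a \<Rightarrow> real) \<Rightarrow> 'a \<Rightarrow> 'a list \<Rightarrow> real list timed" where
  "distances d p qs = tmap (\<lambda>q. do {tick; ret (d p q)}) qs"

fun tdist_to :: "('a \<Rightarrow> 'a \<Rightarrow> real) \<Rightarrow> 'a \<Rightarrow> 'a list \<Rightarrow> ereal timed" where
  "tdist_to d p [] = do {tick; ret \<infinity>}"
| "tdist_to d p (c # C) = do {tick; D \<leftarrow> tdist_to d p C; ret (min (ereal (d p c)) D)}"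

text \<open>The smallest radius whose ball contains \<open>n / k\<close> points is the distance to the
  \<open>\<lceil>n / k\<rceil>\<close>-nearest point.\<close>

definition exact_radius :: "('a \<Rightarrow> 'a \<Rightarrow> real) \<Rightarrow> 'a list \<Rightarrow> nat \<Rightarrow> 'a \<Rightarrow> real timed" where
  "exact_radius d xs k p = do {
     n \<leftarrow> tlength xs;
     ds \<leftarrow> distances d p xs;
     select (nat \<lceil>real n / real k\<rceil> - 1) ds
   }"

subsection \<open>FairCenter and the search for \<open>\<Delta>\<close>\<close>

text \<open>The third list holds the points still to be processed, in non-decreasing order of their
  radii \<open>r\<close>. The order does not depend on \<open>\<Delta>\<close>, so the callers of \<open>search_center\<close> sort only once.
  Processing stops as soon as there are more than \<open>k\<close> centers: only outputs with at most \<open>k\<close>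
  centers are used, and those are unaffected.\<close>

fun fair_center_loop ::
  "('a \<Rightarrow> 'a \<Rightarrow> real) \<Rightarrow> nat \<Rightarrow> real \<Rightarrow> real \<Rightarrow> (real \<times> 'a) list \<Rightarrow> 'a list \<Rightarrow> 'a list timed" where
  "fair_center_loop d k \<alpha> \<Delta> [] C = do {tick; ret C}"
| "fair_center_loop d k \<alpha> \<Delta> ((r, p) # ps) C = do {
     tick;
     c \<leftarrow> tlength C;
     if c > k then ret C
     else do {
       D \<leftarrow> tdist_to d p C;
       fair_center_loop d k \<alpha> \<Delta> ps (if D > ereal (2 * min (\<alpha> * r) \<Delta>) then p # C else C)
     }
   }"

definition fair_center ::
  "('a \<Rightarrow> 'a \<Rightarrow> real) \<Rightarrow> nat \<Rightarrow> real \<Rightarrow> real \<Rightarrow> (real \<times> 'a) list \<Rightarrow> 'a list timed" where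
  "fair_center d k \<alpha> \<Delta> ps = fair_center_loop d k \<alpha> \<Delta> ps []"

text \<open>Binary search over an unsorted list \<open>L\<close> of candidates, halving it at its median. The last
  argument is the smallest candidate accepted so far, if any.\<close>

function binary_search ::
  "(real \<Rightarrow> bool timed) \<Rightarrow> real list \<Rightarrow> real option \<Rightarrow> real option timed" where
  "binary_search accept L best = do {
     tick;
     l \<leftarrow> tlength L;
     if l = 0 then ret best
     else do {
       m \<leftarrow> select (l div 2) L;
       b \<leftarrow> accept m;
       if b then do {
         L' \<leftarrow> tfilter (\<lambda>x. x < m) L;
         binary_search accept L' (Some m)
       } else do {
         L' \<leftarrow> tfilter (\<lambda>x. x > m) L;
         binary_search accept L' best
       }
     }
   }"
  by pat_completeness auto

termination
proof (relation "Wellfounded.measure (\<lambda>(_, L, _). length L)", goal_cases)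
  case 1
  then show ?case by simp
next
  case (2 accept L best _ _ m)
  then have "m \<in> set L"
    using select_in_set[of "length L div 2" L] by simp
  then have "length (filter (\<lambda>x. x < m) L) < length L"
    by (intro length_filter_less[of m]) auto
  then show ?case using 2 by simp
next
  case (3 accept L best _ _ m)
  then have "m \<in> set L"
    using select_in_set[of "length L div 2" L] by simp
  then have "length (filter (\<lambda>x. x > m) L) < length L"
    by (intro length_filter_less[of m]) auto
  then show ?case using 3 by simp
qed

declare binary_search.simps [simp del]

datatype 'a outcome = Fail | No_Solution | Centers "'a list"

definition search_center ::
  "('a \<Rightarrow> 'a \<Rightarrow> real) \<Rightarrow> nat \<Rightarrow> real \<Rightarrow> (real \<times> 'a) list \<Rightarrow> real list \<Rightarrow> 'a outcome timed" where
  "search_center d k \<alpha> ps L = do {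
     best \<leftarrow> binary_search
       (\<lambda>\<Delta>. do {C \<leftarrow> fair_center d k \<alpha> \<Delta> ps; c \<leftarrow> tlength C; ret (c \<le> k)}) L None;
     case best of
       None \<Rightarrow> ret No_Solution
     | Some \<Delta> \<Rightarrow> do {C \<leftarrow> fair_center d k \<alpha> \<Delta> ps; ret (Centers C)}
   }"

text \<open>The pairwise distances include the distance \<open>0\<close> of a point to itself, which is needed
  if \<open>P\<close> has just one point.\<close>

definition approx_fair_center_2_2 ::
  "('a \<Rightarrow> 'a \<Rightarrow> real) \<Rightarrow> 'a list \<Rightarrow> nat \<Rightarrow> real \<Rightarrow> 'a outcome timed" where
  "approx_fair_center_2_2 d xs k \<alpha> = do {
     rs \<leftarrow> tmap (\<lambda>p. do {r \<leftarrow> exact_radius d xs k p; ret (r, p)}) xs;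
     ps \<leftarrow> heap_sort rs;
     dss \<leftarrow> tmap (\<lambda>p. distances d p xs) xs;
     L \<leftarrow> tconcat dss;
     search_center d k \<alpha> ps L
   }"

subsection \<open>Approximate fair radii\<close>

definition log_factor :: "nat \<Rightarrow> real \<Rightarrow> nat" where
  "log_factor n \<delta> = nat \<lceil>ln (2 * real n / \<delta>)\<rceil>"

definition sample_points :: "'a list \<Rightarrow> nat \<Rightarrow> 'a list timed pmf" where
  "sample_points xs s = map_pmf (\<lambda>S. Timed S s) (replicate_pmf s (pmf_of_set (set xs)))"

text \<open>The result lists every point with its distance \<open>r'\<close> to its \<open>t\<close>-nearest neighbor in the
  sample, counted with multiplicity.\<close>

definition fair_sampling ::
  "('a \<Rightarrow> 'a \<Rightarrow> real) \<Rightarrow> 'a list \<Rightarrow> nat \<Rightarrow> real \<Rightarrow> (real \<times> 'a) list timed pmf" where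
  "fair_sampling d xs k \<delta> =
     (let N = tlength xs;
          s = 36 * k * log_factor (result N) \<delta>;
          t = 27 * log_factor (result N) \<delta>
      in map_pmf
           (\<lambda>sampled. do {
              N;
              S \<leftarrow> sampled;
              tmap (\<lambda>p. do {ds \<leftarrow> distances d p S; r \<leftarrow> select (t - 1) ds; ret (r, p)}) xs
            })
           (sample_points xs s))"

text \<open>The entries of the list are \<open>(q, r' q, r q)\<close> for the points \<open>q\<close> with exact radius \<open>r q\<close>.\<close>

fun close_radius ::
  "('a \<Rightarrow> 'a \<Rightarrow> real) \<Rightarrow> 'a \<Rightarrow> real \<Rightarrow> ('a \<times> real \<times> real) list \<Rightarrow> real option timed" where
  "close_radius d p r' [] = do {tick; ret None}"
| "close_radius d p r' ((q, s', s) # C) =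
     do {tick; if r' + s' \<ge> d p q then ret (Some (d p q + s)) else close_radius d p r' C}"

fun radii_loop ::
  "('a \<Rightarrow> 'a \<Rightarrow> real) \<Rightarrow> 'a list \<Rightarrow> nat \<Rightarrow> (real \<times> 'a) list \<Rightarrow> ('a \<times> real \<times> real) list \<Rightarrow>
   (real \<times> 'a) list \<Rightarrow> (real \<times> 'a) list option timed" where
  "radii_loop d xs k [] C rs = do {tick; ret (Some rs)}"
| "radii_loop d xs k ((r', p) # ps) C rs = do {
     tick;
     close \<leftarrow> close_radius d p r' C;
     case close of
       Some r \<Rightarrow> radii_loop d xs k ps C ((r, p) # rs)
     | None \<Rightarrow> do {
         r \<leftarrow> exact_radius d xs k p;
         c \<leftarrow> tlength ((p, r', r) # C);
         if c > 3 * k then ret None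
         else radii_loop d xs k ps ((p, r', r) # C) ((r, p) # rs)
       }
   }"

definition approx_fair_radii ::
  "('a \<Rightarrow> 'a \<Rightarrow> real) \<Rightarrow> 'a list \<Rightarrow> nat \<Rightarrow> real \<Rightarrow> (real \<times> 'a) list option timed pmf" where
  "approx_fair_radii d xs k \<delta> =
     map_pmf (\<lambda>sampling. do {rs' \<leftarrow> sampling; ps \<leftarrow> heap_sort rs'; radii_loop d xs k ps [] []})
       (fair_sampling d xs k \<delta>)"

subsection \<open>Candidates for the cost\<close>

fun furthest :: "real \<times> 'a \<Rightarrow> (real \<times> 'a) list \<Rightarrow> (real \<times> 'a) timed" where
  "furthest (x, p) [] = do {tick; ret (x, p)}"
| "furthest (x, p) ((y, q) # ps) = do {tick; furthest (if y > x then (y, q) else (x, p)) ps}"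

text \<open>\<open>gonzalez_loop d j ps C\<close> adds \<open>j\<close> further centers to \<open>C\<close>, where \<open>ps\<close> lists all points with
  their distances to \<open>C\<close>. The result also contains the largest of the final distances.\<close>

fun gonzalez_loop ::
  "('a \<Rightarrow> 'a \<Rightarrow> real) \<Rightarrow> nat \<Rightarrow> (real \<times> 'a) list \<Rightarrow> 'a list \<Rightarrow> ('a list \<times> real) timed" where
  "gonzalez_loop d 0 ps C = do {tick; (D, g) \<leftarrow> furthest (hd ps) (tl ps); ret (C, D)}"
| "gonzalez_loop d (Suc j) ps C = do {
     tick;
     (D, g) \<leftarrow> furthest (hd ps) (tl ps);
     ps' \<leftarrow> tmap (\<lambda>(x, p). do {tick; ret (min x (d p g), p)}) ps;
     gonzalez_loop d j ps' (g # C)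
   }"

definition gonzalez :: "('a \<Rightarrow> 'a \<Rightarrow> real) \<Rightarrow> 'a list \<Rightarrow> nat \<Rightarrow> ('a list \<times> real) timed" where
  "gonzalez d xs k = do {
     ps \<leftarrow> tmap (\<lambda>p. do {tick; ret (d p (hd xs), p)}) xs;
     gonzalez_loop d (k - 1) ps [hd xs]
   }"

text \<open>\<open>[q * x, q\<^sup>2 * x, ..., q\<^sup>m * x]\<close>\<close>

fun geometric :: "real \<Rightarrow> nat \<Rightarrow> real \<Rightarrow> real list timed" where
  "geometric q 0 x = do {tick; ret []}"
| "geometric q (Suc m) x = do {tick; ys \<leftarrow> geometric q m (q * x); ret (q * x # ys)}"

definition cost_candidates ::
  "('a \<Rightarrow> 'a \<Rightarrow> real) \<Rightarrow> 'a list \<Rightarrow> nat \<Rightarrow> real \<Rightarrow> real list timed" where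
  "cost_candidates d xs k \<epsilon>' = do {
     (C, D) \<leftarrow> gonzalez d xs k;
     L \<leftarrow> geometric (1 + \<epsilon>') (nat \<lceil>log (1 + \<epsilon>') 16\<rceil>) (D / 2);
     Ls \<leftarrow> tmap (\<lambda>g1. do {
         ls \<leftarrow> tmap (\<lambda>g2. do {
             tick;
             if g1 = g2 then ret []
             else geometric (1 + \<epsilon>') (nat \<lceil>log (1 + \<epsilon>') 4\<rceil>) (d g1 g2 / 2)
           }) C;
         tconcat ls
       }) C;
     L' \<leftarrow> tconcat Ls;
     tappend L L'
   }"

subsection \<open>The main algorithm\<close>

text \<open>The usual name \<open>(10, 2 + \<epsilon>)\<close>-ApproxFairCenter puts the fairness factor first: the radii
  exceed the exact ones by a factor of at most \<open>5\<close>, so that \<open>FairCenter\<close> loses a factor \<open>10\<close> in the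
  fairness, whereas the candidates approximate the optimal cost up to a factor \<open>1 + \<epsilon> / 2\<close>, so that
  it loses a factor \<open>2 + \<epsilon>\<close> in the cost. In terms of \<open>approximation\<close>, this is \<open>\<beta> = 2 + \<epsilon>\<close> and
  \<open>\<gamma> = 10\<close>. The converse assignment fails: for large \<open>\<epsilon>\<close> all candidates are far above the optimal
  cost.\<close>

definition approx_fair_center ::
  "('a \<Rightarrow> 'a \<Rightarrow> real) \<Rightarrow> 'a list \<Rightarrow> nat \<Rightarrow> real \<Rightarrow> real \<Rightarrow> real \<Rightarrow> 'a outcome timed pmf" where
  "approx_fair_center d xs k \<alpha> \<epsilon> \<delta> =
     (let N = tlength xs; n = real (result N)
      in if real k > n / 6 \<or> (real k)\<^sup>2 / \<epsilon> > n\<^sup>2 * ln n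
         then return_pmf (do {N; approx_fair_center_2_2 d xs k \<alpha>})
         else map_pmf
           (\<lambda>radii. do {
              N;
              res \<leftarrow> radii;
              case res of
                None \<Rightarrow> ret Fail
              | Some rs \<Rightarrow> do {
                  L \<leftarrow> cost_candidates d xs k (\<epsilon> / 2);
                  ps \<leftarrow> heap_sort rs;
                  search_center d k \<alpha> ps L
                }
            })
           (approx_fair_radii d xs k \<delta>))"

end

theory Submission
  imports Defs
begin

text \<open>
  Whenever all radii are at least the exact ones and \<open>\<Delta>\<close> is at least the optimal cost, two centers
  chosen by FairCenter cannot share the nearest center of an optimal solution, so at most \<open>k\<close> are
  chosen; conversely, every output with at most \<open>k\<close> centers has cost at most \<open>2 * \<Delta>\<close> and respects
  twice the scaled radii. Hence a binary search over candidates among which one exceeds the optimal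
  cost by a factor of at most \<open>1 + \<epsilon> / 2\<close> succeeds.

  By Chernoff bounds, with probability at least \<open>1 - \<delta>\<close> the sample radii lie between the fair radii
  for \<open>2 * k\<close> and for \<open>k\<close>. The balls around the points of \<open>C\<close> in ApproxFairRadii are then disjoint
  and contain \<open>n / (2 * k)\<close> points each, so the algorithm does not fail, and by the triangle
  inequality the approximate radii exceed the exact ones by a factor of at most \<open>5\<close>. The candidates
  come from the 2-approximation of Gonzalez: if the optimal cost is much larger than its cost, then
  it is close to the distance of two of its centers.

  For the running time, the first branch costs \<open>O(n\<^sup>2 log n)\<close>, and the condition under which it is
  taken bounds this by the claimed time. In the second branch the number of candidates is at most
  \<open>n\<^sup>5\<close>, so the binary search takes \<open>O(log n)\<close> rounds.
\<close>

section \<open>Lists and selection\<close>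

text \<open>The sampling constants come from separating two means. With
  \<open>l = log_factor n \<delta>\<close> and \<open>36 * k * l\<close> draws, a ball holding at
  least \<open>n / k\<close> points is hit at least \<open>36 * l\<close> times on average, and one
  holding at most \<open>n / (2 * k)\<close> points at most \<open>18 * l\<close> times. The rank
  \<open>27 * l\<close> lies between the two, and \<open>l\<close> makes each of the
  \<open>2 * n\<close> bad events, two per point, have probability at most
  \<open>\<delta> / (2 * n)\<close>. Approximate radii must never fall below the exact ones: the
  bound on the number of centers uses them from below, the fairness from above. The obstacle for the
  running time is that it is claimed for every run, hence also for bad samples, where none of the
  estimates above is available. There the early exits do the counting: ApproxFairRadii stops after
  \<open>3 * k + 1\<close> exact radii, and FairCenter after \<open>k + 1\<close> centers.
  Logarithms are kept out of the step counts by bounding sizes by \<open>2 ^ j\<close>.\<close>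

lemma steps_tlength [simp]: "steps (tlength xs) = length xs + 1"
  by (induction xs) auto

lemma steps_tnth: "steps (tnth xs i) \<le> length xs + 1"
  by (induction xs i rule: tnth.induct) auto

lemma steps_tmap [simp]: "steps (tmap f xs) = (\<Sum>x\<leftarrow>xs. steps (f x)) + length xs + 1"
  by (induction xs) auto

lemma steps_tfilter [simp]: "steps (tfilter A xs) = length xs + 1"
  by (induction xs) auto

lemma tappend_simps [simp]:
  "result (tappend xs ys) = xs @ ys" "steps (tappend xs ys) = length xs + 1"
  by (induction xs) auto

lemma result_tconcat [simp]: "result (tconcat xss) = concat xss"
  by (induction xss) auto

lemma steps_tconcat [simp]: "steps (tconcat xss) = (\<Sum>xs\<leftarrow>xss. length xs + 2) + 1"
  by (induction xss) auto

lemma sum_list_le_const: "(\<And>x. x \<in> set xs \<Longrightarrow> f x \<le> c) \<Longrightarrow> (\<Sum>x\<leftarrow>xs. f x) \<le> length xs * (c :: nat)"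
  by (induction xs) (auto intro: add_mono)

lemma steps_tmap_le:
  "(\<And>x. x \<in> set xs \<Longrightarrow> steps (f x) \<le> c) \<Longrightarrow> steps (tmap f xs) \<le> length xs * (c + 1) + 1"
  using sum_list_le_const[of xs "\<lambda>x. steps (f x)" c] by simp

lemma result_tinsert [simp]: "result (tinsert x xs) = insort x xs"
  by (induction x xs rule: tinsert.induct) auto

lemma steps_tinsert: "steps (tinsert x xs) \<le> length xs + 1"
  by (induction x xs rule: tinsert.induct) auto

lemma result_insertion_sort [simp]: "result (insertion_sort xs) = sort xs"
  by (induction xs) auto

lemma steps_insertion_sort: "steps (insertion_sort xs) \<le> (length xs + 1)\<^sup>2"
proof (induction xs)
  case (Cons x xs)
  then show ?case
    using steps_tinsert[of x "sort xs"] by (simp add: power2_eq_square)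
qed simp

lemma result_median: "xs \<noteq> [] \<Longrightarrow> result (median xs) = sort xs ! (length xs div 2)"
  by (simp add: median_def)

lemma steps_median:
  assumes "length xs \<le> 5"
  shows "steps (median xs) \<le> 48"
proof -
  have "(length xs + 1)\<^sup>2 \<le> 6\<^sup>2"
    using assms by (intro power_mono) auto
  then show ?thesis
    using assms steps_insertion_sort[of xs] steps_tnth[of "sort xs" "length xs div 2"]
    by (simp add: median_def)
qed

section \<open>Order statistics as counting\<close>

text \<open>The elements with a down-closed property form a prefix of the sorted list. This is the
  bridge between ranks and cardinalities: medians, exact radii and sample radii are all compared
  with a bound by counting the elements below it.\<close>

lemma nth_sorted_iff_filter:
  assumes "sorted xs" "i < length xs" "\<And>x y. x \<le> y \<Longrightarrow> Q y \<Longrightarrow> Q x"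
  shows "Q (xs ! i) \<longleftrightarrow> i < length (filter Q xs)"
  using assms
proof (induction xs arbitrary: i)
  case (Cons a xs)
  show ?case
  proof (cases "Q a")
    case True
    then show ?thesis using Cons by (cases i) auto
  next
    case False
    have "a \<le> (a # xs) ! i"
      using Cons.prems by (cases i) auto
    moreover have "\<not> Q y" if "y \<in> set (a # xs)" for y
      using Cons.prems False that by auto
    ultimately show ?thesis using Cons.prems(3) False by auto
  qed
qed simp

lemma length_filter_sort [simp]: "length (filter Q (sort xs)) = length (filter Q xs)"
  by (metis mset_filter mset_sort size_mset)

lemma nth_sort_iff_filter:
  "i < length xs \<Longrightarrow> (\<And>x y. x \<le> y \<Longrightarrow> Q y \<Longrightarrow> Q x) \<Longrightarrow>
     Q (sort xs ! i) \<longleftrightarrow> i < length (filter Q xs)"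
  using nth_sorted_iff_filter[of "sort xs" i Q] by simp

lemma nth_sort_le_iff:
  "i < length xs \<Longrightarrow> sort xs ! i \<le> (x :: real) \<longleftrightarrow> i < length (filter (\<lambda>y. y \<le> x) xs)"
  by (rule nth_sort_iff_filter) auto

lemma nth_sort_less_iff:
  "i < length xs \<Longrightarrow> sort xs ! i < (x :: real) \<longleftrightarrow> i < length (filter (\<lambda>y. y < x) xs)"
  by (rule nth_sort_iff_filter) auto

text \<open>Both parts compare the element of rank \<open>i\<close> with itself, once with the
  strict and once with the weak order. This is why a median pivot halves the list even in the
  presence of duplicates.\<close>

lemma length_filter_less_nth_sort:
  fixes xs :: "real list"
  assumes "i < length xs"
  shows "length (filter (\<lambda>y. y < sort xs ! i) xs) \<le> i"
    and "length (filter (\<lambda>y. y > sort xs ! i) xs) < length xs - i"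
proof -
  show "length (filter (\<lambda>y. y < sort xs ! i) xs) \<le> i"
    using nth_sort_less_iff[OF assms, of "sort xs ! i"] by simp
  have "i < length (filter (\<lambda>y. y \<le> sort xs ! i) xs)"
    using nth_sort_le_iff[OF assms, of "sort xs ! i"] by simp
  then show "length (filter (\<lambda>y. y > sort xs ! i) xs) < length xs - i"
    using sum_length_filter_compl[of "\<lambda>y. y \<le> sort xs ! i" xs] by (simp add: not_le)
qed

lemma sort_partition3:
  fixes x :: real
  shows "sort xs = sort (filter (\<lambda>y. y < x) xs) @ filter (\<lambda>y. y = x) xs @ sort (filter (\<lambda>y. y > x) xs)"
proof (rule properties_for_sort)
  show "mset (sort (filter (\<lambda>y. y < x) xs) @ filter (\<lambda>y. y = x) xs @ sort (filter (\<lambda>y. y > x) xs)) = mset xs"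
    by (induction xs) auto
  have "sorted (filter (\<lambda>y. y = x) xs)"
    by (induction xs) auto
  then show "sorted (sort (filter (\<lambda>y. y < x) xs) @ filter (\<lambda>y. y = x) xs @ sort (filter (\<lambda>y. y > x) xs))"
    by (auto simp: sorted_append)
qed

section \<open>Correctness and linear time of the median-of-medians selection\<close>

text \<open>One round beyond the base case. The last line of the step bound pays for the tick, four
  length computations and three filters; \<open>ls\<close> and \<open>es\<close> together are no
  longer than \<open>xs\<close>, which makes it an inequality.\<close>

lemma select_unfold:
  fixes xs :: "real list"
  assumes "\<not> length xs \<le> 100"
  defines "ms \<equiv> map (\<lambda>ys. result (median ys)) (result (fives xs))"
  defines "x \<equiv> result (select (length ms div 2) ms)"
  defines "ls \<equiv> filter (\<lambda>y. y < x) xs" and "es \<equiv> filter (\<lambda>y. y = x) xs"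
    and "gs \<equiv> filter (\<lambda>y. y > x) xs"
  shows "result (select i xs) =
           (if i < length ls then result (select i ls) else if i < length ls + length es then x
            else result (select (i - (length ls + length es)) gs))"
    and "steps (select i xs) \<le>
           steps (fives xs) + steps (tmap median (result (fives xs)))
           + steps (select (length ms div 2) ms)
           + (if i < length ls then steps (select i ls) else if i < length ls + length es then 0
              else steps (select (i - (length ls + length es)) gs))
           + 6 * length xs + length ms + 8"
proof -
  show "result (select i xs) =
      (if i < length ls then result (select i ls) else if i < length ls + length es then x
       else result (select (i - (length ls + length es)) gs))"
    unfolding gs_def es_def ls_def x_def ms_def
    using assms(1) by (subst select.simps[of i xs]) (simp add: comp_def)
  have "length ls + length es \<le> length xs"
    using length_partition3[of x xs] by (simp add: ls_def es_def)
  then show "steps (select i xs) \<le>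
      steps (fives xs) + steps (tmap median (result (fives xs))) + steps (select (length ms div 2) ms)
      + (if i < length ls then steps (select i ls) else if i < length ls + length es then 0
         else steps (select (i - (length ls + length es)) gs))
      + 6 * length xs + length ms + 8"
    unfolding gs_def es_def ls_def x_def ms_def
    using assms(1) by (subst select.simps[of i xs]) (simp add: comp_def del: steps_tmap)
qed

lemma pivot_in_medians:
  fixes xs :: "real list"
  assumes "\<not> length xs \<le> 100"
  shows "map (\<lambda>ys. result (median ys)) (result (fives xs)) \<noteq> []"
  using assms fives_props[of xs] by auto

text \<open>The pivot belongs to the list, so both outer parts are strictly shorter. Since the
  sorted parts around the copies of the pivot concatenate to the sorted list, the index only has to
  be shifted by the lengths of the parts skipped.\<close>

lemma result_select: "i < length xs \<Longrightarrow> result (select i xs) = sort xs ! i"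
proof (induction "length xs" arbitrary: i xs rule: less_induct)
  case less
  show ?case
  proof (cases "length xs \<le> 100")
    case True
    then show ?thesis
      using less.prems by (subst select.simps) simp
  next
    case False
    define ms where "ms = map (\<lambda>ys. result (median ys)) (result (fives xs))"
    define x where "x = result (select (length ms div 2) ms)"
    let ?ls = "filter (\<lambda>y. y < x) xs"
    let ?es = "filter (\<lambda>y. y = x) xs"
    let ?gs = "filter (\<lambda>y. y > x) xs"
    have "x \<in> set ms"
      unfolding x_def using pivot_in_medians[OF False] by (intro select_in_set) (simp add: ms_def)
    then have x: "x \<in> set xs"
      using medians_subset[of xs] by (auto simp: ms_def)
    have small: "length ?ls < length xs" "length ?gs < length xs"
      using x by (auto intro: length_filter_less)
    have "result (select i xs) =
           (if i < length ?ls then result (select i ?ls) else if i < length ?ls + length ?es then x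
            else result (select (i - (length ?ls + length ?es)) ?gs))"
      using select_unfold(1)[OF False, of i] by (simp add: x_def ms_def)
    also have "\<dots> = (if i < length ?ls then sort ?ls ! i
        else if i < length ?ls + length ?es then x else sort ?gs ! (i - (length ?ls + length ?es)))"
      using less.prems length_partition3[of x xs]
      by (auto intro!: less.hyps small)
    also have "\<dots> = (sort ?ls @ ?es @ sort ?gs) ! i"
      using nth_mem[of "i - length ?ls" ?es] by (auto simp: nth_append)
    finally show ?thesis
      using sort_partition3[of xs x] by simp
  qed
qed

lemma fives_groups:
  "(\<forall>ys\<in>set (result (fives xs)). length ys \<le> 5) \<and> length xs \<le> 5 * length (result (fives xs)) \<and>
   steps (fives xs) \<le> length xs + 1"
  by (induction xs rule: fives.induct) auto

text \<open>The median has index \<open>length ys div 2\<close> in the sorted group. If it satisfies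
  \<open>Q\<close>, so does everything before it; if it does not, nothing from it onwards
  does.\<close>

lemma length_filter_median:
  fixes ys :: "real list"
  assumes "ys \<noteq> []" "\<And>x y. x \<le> y \<Longrightarrow> Q y \<Longrightarrow> Q x"
  shows "Q (result (median ys)) \<Longrightarrow> length ys div 2 < length (filter Q ys)"
    and "\<not> Q (result (median ys)) \<Longrightarrow> length ys - length ys div 2 \<le> length (filter (\<lambda>y. \<not> Q y) ys)"
  using nth_sort_iff_filter[of "length ys div 2" ys Q, OF _ assms(2)] assms(1)
    sum_length_filter_compl[of Q ys]
  by (simp_all add: result_median)

text \<open>Every group of five whose median satisfies a down-closed property contributes three elements
  with this property; only the last group may be smaller.\<close>

lemma filter_medians:
  fixes xs :: "real list"
  assumes "\<And>x y. x \<le> y \<Longrightarrow> Q y \<Longrightarrow> Q x"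
  shows "3 * length (filter (\<lambda>ys. Q (result (median ys))) (result (fives xs)))
           \<le> length (filter Q xs) + 2" (is "?A xs")
    and "3 * length (filter (\<lambda>ys. \<not> Q (result (median ys))) (result (fives xs)))
           \<le> length (filter (\<lambda>y. \<not> Q y) xs) + 2" (is "?B xs")
proof -
  have med: "Q (result (median ys)) \<Longrightarrow> length ys div 2 < length (filter Q ys)"
    "\<not> Q (result (median ys)) \<Longrightarrow> length ys - length ys div 2 \<le> length (filter (\<lambda>y. \<not> Q y) ys)"
    if "ys \<noteq> []" for ys
    using length_filter_median[of ys Q] that assms by blast+
  have "?A xs \<and> ?B xs"
  proof (induction xs rule: fives.induct)
    case (1 a b c d e xs)
    let ?ys = "[a, b, c, d, e]"
    have 3: "Q (result (median ?ys)) \<Longrightarrow> 3 \<le> length (filter Q ?ys)"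
      "\<not> Q (result (median ?ys)) \<Longrightarrow> 3 \<le> length (filter (\<lambda>y. \<not> Q y) ?ys)"
      using med(1)[of ?ys] med(2)[of ?ys] by simp_all
    have split: "filter R (a # b # c # d # e # xs) = filter R ?ys @ filter R xs" for R
      by simp
    show ?case
      unfolding split length_append using 1 3 by (cases "Q (result (median ?ys))") simp_all
  next
    case 2
    then show ?case by simp
  next
    \<comment> \<open>A short last group contributes at least its median, and the slack of 2 lifts
      this single element to the required three.\<close>
    case ("3_1" v)
    then show ?case using med[of "[v]"] by auto
  next
    case ("3_2" v w)
    have "filter (\<lambda>ys. R (result (median ys))) [[v, w]] = (if R (result (median [v, w])) then [[v, w]] else [])" for R
      by simp
    then show ?case using med[of "[v, w]"] by (cases "Q (result (median [v, w]))") (simp_all del: filter.simps)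
  next
    case ("3_3" v w y)
    have "filter (\<lambda>ys. R (result (median ys))) [[v, w, y]] = (if R (result (median [v, w, y])) then [[v, w, y]] else [])" for R
      by simp
    then show ?case using med[of "[v, w, y]"] by (cases "Q (result (median [v, w, y]))") (simp_all del: filter.simps)
  next
    case ("3_4" v w y z)
    have "filter (\<lambda>ys. R (result (median ys))) [[v, w, y, z]] = (if R (result (median [v, w, y, z])) then [[v, w, y, z]] else [])" for R
      by simp
    then show ?case using med[of "[v, w, y, z]"] by (cases "Q (result (median [v, w, y, z]))") (simp_all del: filter.simps)
  qed
  then show "?A xs" "?B xs" by auto
qed

text \<open>There are at least \<open>n / 5\<close> groups, and at least half of their medians lie
  on either side of the pivot, the pivot included. Each such group gives three elements, so about
  \<open>3 * n / 10\<close> elements are missing from each strict part.\<close>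

lemma median_of_medians_balanced:
  fixes xs :: "real list"
  assumes "\<not> length xs \<le> 100"
  defines "ms \<equiv> map (\<lambda>ys. result (median ys)) (result (fives xs))"
  defines "x \<equiv> result (select (length ms div 2) ms)"
  shows "10 * length (filter (\<lambda>y. y < x) xs) \<le> 7 * length xs + 20"
    and "10 * length (filter (\<lambda>y. y > x) xs) \<le> 7 * length xs + 20"
proof -
  define m where "m = length ms"
  have m: "m div 2 < length ms"
    using pivot_in_medians[OF assms(1)] by (simp add: m_def ms_def)
  have xm: "x = sort ms ! (m div 2)"
    using result_select[OF m] by (simp add: x_def m_def)
  have "length xs \<le> 5 * m"
    using fives_groups[of xs] by (simp add: m_def ms_def)
  moreover have "3 * (m - m div 2) \<le> length (filter (\<lambda>y. \<not> y < x) xs) + 2"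
  proof -
    have "length (filter (\<lambda>y. y < x) ms) \<le> m div 2"
      using length_filter_less_nth_sort(1)[OF m] by (simp add: xm)
    then have "m - m div 2 \<le> length (filter (\<lambda>y. \<not> y < x) ms)"
      using sum_length_filter_compl[of "\<lambda>y. y < x" ms] m_def by linarith
    then show ?thesis
      using filter_medians(2)[of "\<lambda>y. y < x" xs]
      by (simp add: ms_def comp_def filter_map not_less)
  qed
  moreover have "3 * (m div 2 + 1) \<le> length (filter (\<lambda>y. y \<le> x) xs) + 2"
  proof -
    have "m div 2 < length (filter (\<lambda>y. y \<le> x) ms)"
      using nth_sort_le_iff[OF m, of x] by (simp add: xm)
    then show ?thesis
      using filter_medians(1)[of "\<lambda>y. y \<le> x" xs] by (simp add: ms_def comp_def filter_map)
  qed
  ultimately show "10 * length (filter (\<lambda>y. y < x) xs) \<le> 7 * length xs + 20"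
    and "10 * length (filter (\<lambda>y. y > x) xs) \<le> 7 * length xs + 20"
    using sum_length_filter_compl[of "\<lambda>y. y < x" xs] sum_length_filter_compl[of "\<lambda>y. y \<le> x" xs]
    by (simp_all add: not_le)
qed

text \<open>The recursive calls receive about 1/5 and 7/10 of the list, together 9/10. The remaining
  tenth of 400 steps per element exceeds the linear work of a round, and for more than 100 elements
  the excess also covers the additive constants. Up to 100 elements, quadratic sorting costs at most
  101 steps per element.\<close>

lemma steps_select: "steps (select i xs) \<le> 400 * (length xs + 1)"
proof (induction "length xs" arbitrary: i xs rule: less_induct)
  case less
  let ?n = "length xs"
  show ?case
  proof (cases "?n \<le> 100")
    case True
    have "(?n + 1)\<^sup>2 \<le> 101 * (?n + 1)"
      unfolding power2_eq_square using True by (intro mult_le_mono1) simp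
    moreover have "steps (select i xs) = 1 + (?n + 1) + steps (insertion_sort xs) + steps (tnth (sort xs) i)"
      using True by (subst select.simps) simp
    ultimately show ?thesis
      using steps_insertion_sort[of xs] steps_tnth[of "sort xs" i] by simp
  next
    case False
    define ms where "ms = map (\<lambda>ys. result (median ys)) (result (fives xs))"
    define x where "x = result (select (length ms div 2) ms)"
    let ?ls = "filter (\<lambda>y. y < x) xs"
    let ?es = "filter (\<lambda>y. y = x) xs"
    let ?gs = "filter (\<lambda>y. y > x) xs"
    define R where "R = (if i < length ?ls then steps (select i ?ls)
      else if i < length ?ls + length ?es then 0
      else steps (select (i - (length ?ls + length ?es)) ?gs))"
    have ms: "5 * length ms \<le> ?n + 4"
      using fives_props[of xs] by (simp add: ms_def)
    have balanced: "10 * length ?ls \<le> 7 * ?n + 20" "10 * length ?gs \<le> 7 * ?n + 20"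
      using median_of_medians_balanced[OF False] by (simp_all add: x_def ms_def)
    have "steps (select (length ms div 2) ms) \<le> 400 * (length ms + 1)"
      using ms False by (intro less.hyps) auto
    \<comment> \<open>Scaling by ten keeps the fraction 7/10 within the natural numbers.\<close>
    moreover have "10 * steps (select j ?ls) \<le> 400 * (7 * ?n + 30)" for j
    proof -
      have *: "steps (select j ?ls) \<le> 400 * (length ?ls + 1)"
        using balanced False by (intro less.hyps) auto
      have "10 * steps (select j ?ls) \<le> 400 * (10 * length ?ls + 10)"
        using * by simp
      also have "\<dots> \<le> 400 * (7 * ?n + 30)"
        using balanced(1) by (intro mult_le_mono2) simp
      finally show ?thesis .
    qed
    moreover have "10 * steps (select j ?gs) \<le> 400 * (7 * ?n + 30)" for j
    proof -
      have *: "steps (select j ?gs) \<le> 400 * (length ?gs + 1)"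
        using balanced False by (intro less.hyps) auto
      have "10 * steps (select j ?gs) \<le> 400 * (10 * length ?gs + 10)"
        using * by simp
      also have "\<dots> \<le> 400 * (7 * ?n + 30)"
        using balanced(2) by (intro mult_le_mono2) simp
      finally show ?thesis .
    qed
    ultimately have R: "10 * R \<le> 400 * (7 * ?n + 30)"
      by (simp add: R_def)
    have "steps (tmap median (result (fives xs))) \<le> length ms * (48 + 1) + 1"
      using steps_tmap_le[of "result (fives xs)" median 48] steps_median fives_groups[of xs]
      by (auto simp: ms_def)
    moreover have "steps (select i xs) \<le> steps (fives xs) + steps (tmap median (result (fives xs)))
        + steps (select (length ms div 2) ms) + R + 6 * ?n + length ms + 8"
      using select_unfold(2)[OF False, of i] unfolding R_def x_def ms_def .
    moreover note \<open>steps (select (length ms div 2) ms) \<le> 400 * (length ms + 1)\<close>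
    ultimately show ?thesis
      using R ms fives_groups[of xs] False by (simp add: algebra_simps)
  qed
qed

section \<open>Heap sort\<close>

fun heap_mset :: "'a heap \<Rightarrow> (real \<times> 'a) multiset" where
  "heap_mset Empty = {#}"
| "heap_mset (Heap n l x v r) = add_mset (x, v) (heap_mset l + heap_mset r)"

text \<open>Besides the leftist shape this includes the heap order. The stored number is the length
  of the right spine.\<close>

fun leftist :: "'a heap \<Rightarrow> bool" where
  "leftist Empty \<longleftrightarrow> True"
| "leftist (Heap n l x v r) \<longleftrightarrow>
     leftist l \<and> leftist r \<and> rank r \<le> rank l \<and> n = Suc (rank r) \<and>
     (\<forall>y u. (y, u) \<in># heap_mset l + heap_mset r \<longrightarrow> x \<le> y)"

lemma heap_mset_merge [simp]: "heap_mset (result (heap_merge h1 h2)) = heap_mset h1 + heap_mset h2"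
  by (induction h1 h2 rule: heap_merge.induct) (auto simp: heap_node_def)

lemma leftist_merge: "leftist h1 \<Longrightarrow> leftist h2 \<Longrightarrow> leftist (result (heap_merge h1 h2))"
  by (induction h1 h2 rule: heap_merge.induct) (auto simp: heap_node_def, (meson linear order_trans)+)

text \<open>Every call descends one of the two right spines by one node, and \<open>rank\<close> is
  the length of such a spine.\<close>

lemma steps_merge: "leftist h1 \<Longrightarrow> leftist h2 \<Longrightarrow> steps (heap_merge h1 h2) \<le> rank h1 + rank h2 + 1"
  by (induction h1 h2 rule: heap_merge.induct) auto

text \<open>The left subtree has at least the rank of the right one, so every node on the right
  spine doubles the lower bound on the size.\<close>

lemma pow_rank_le: "leftist h \<Longrightarrow> 2 ^ rank h \<le> size (heap_mset h) + 1"
proof (induction h)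
  case (Heap n l x v r)
  then have "2 ^ rank r \<le> (2 :: nat) ^ rank l"
    by (intro power_increasing) auto
  with Heap have "2 ^ rank (Heap n l x v r) = 2 * (2 :: nat) ^ rank r" "2 ^ rank r \<le> (2 :: nat) ^ rank l"
    "2 ^ rank l \<le> size (heap_mset l) + 1" "2 ^ rank r \<le> size (heap_mset r) + 1"
    by simp_all
  then have "2 ^ rank (Heap n l x v r) \<le> size (heap_mset l) + size (heap_mset r) + 2"
    by linarith
  then show ?case by simp
qed simp

text \<open>Replaces the logarithm of the size by any exponent \<open>j\<close> with size below
  \<open>2 ^ j\<close>; \<open>ex_power2_gt\<close> finally supplies such exponents.\<close>

lemma rank_le:
  assumes "leftist h" "size (heap_mset h) < 2 ^ j"
  shows "rank h \<le> j"
proof -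
  have "(2 :: nat) ^ rank h \<le> 2 ^ j"
    using pow_rank_le[OF assms(1)] assms(2) by linarith
  then show ?thesis by simp
qed

lemma heap_of_props:
  "leftist (result (heap_of ps)) \<and> heap_mset (result (heap_of ps)) = mset ps"
  by (induction ps rule: heap_of.induct) (auto intro: leftist_merge)

lemma steps_heap_of: "length ps < 2 ^ j \<Longrightarrow> steps (heap_of ps) \<le> length ps * (j + 3) + 1"
proof (induction ps rule: heap_of.induct)
  case (2 x v ps)
  let ?h = "result (heap_of ps)"
  have "rank ?h \<le> j"
    using 2 heap_of_props[of ps] by (intro rank_le) auto
  then have "steps (heap_merge (Heap 1 Empty x v Empty) ?h) \<le> j + 2"
    using steps_merge[of "Heap 1 Empty x v Empty" ?h] heap_of_props[of ps] by simp
  then show ?case using 2 by simp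
qed simp

lemma pop_all_props:
  assumes "leftist h" "size (heap_mset h) = n"
  shows "mset (result (pop_all n h)) = heap_mset h \<and> sorted (map fst (result (pop_all n h)))"
  using assms
proof (induction n h rule: pop_all.induct)
  case (1 n m l x v r)
  define ps where "ps = result (pop_all n (result (heap_merge l r)))"
  have ps: "mset ps = heap_mset l + heap_mset r \<and> sorted (map fst ps)"
    using 1 by (simp add: ps_def leftist_merge)
  then have "set ps = set_mset (heap_mset l + heap_mset r)"
    by (metis set_mset_mset)
  then show ?case
    using 1 ps by (auto simp: ps_def[symmetric])
next
  case ("2_2" n)
  then show ?case by (cases n) auto
qed auto

lemma steps_pop_all:
  assumes "leftist h" "size (heap_mset h) < 2 ^ j"
  shows "steps (pop_all n h) \<le> n * (2 * j + 2) + 1"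
  using assms
proof (induction n h rule: pop_all.induct)
  case (1 n m l x v r)
  have "rank l \<le> j" "rank r \<le> j"
    using 1 by (auto intro: rank_le)
  then have "steps (heap_merge l r) \<le> 2 * j + 1"
    using steps_merge[of l r] 1 by simp
  moreover have "steps (pop_all n (result (heap_merge l r))) \<le> n * (2 * j + 2) + 1"
    using 1 by (intro 1) (auto intro: leftist_merge)
  ultimately show ?case by simp
qed auto

lemma mset_heap_sort [simp]: "mset (result (heap_sort ps)) = mset ps"
  using pop_all_props[of "result (heap_of ps)" "length ps"] heap_of_props[of ps]
  by (simp add: heap_sort_def)

lemma set_heap_sort [simp]: "set (result (heap_sort ps)) = set ps"
  by (metis mset_heap_sort set_mset_mset)

lemma length_heap_sort [simp]: "length (result (heap_sort ps)) = length ps"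
  by (metis mset_heap_sort size_mset)

lemma sorted_heap_sort: "sorted (map fst (result (heap_sort ps)))"
  using pop_all_props[of "result (heap_of ps)" "length ps"] heap_of_props[of ps]
  by (simp add: heap_sort_def)

text \<open>Per element, building the heap costs \<open>j + 3\<close>, popping
  \<open>2 * j + 2\<close> and computing the length 1.\<close>

lemma steps_heap_sort:
  assumes "length ps < 2 ^ j"
  shows "steps (heap_sort ps) \<le> length ps * (3 * j + 6) + 3"
  using steps_heap_of[OF assms] steps_pop_all[of "result (heap_of ps)" j "length ps"]
    heap_of_props[of ps] assms
  by (simp add: heap_sort_def algebra_simps)

section \<open>Binary search\<close>

text \<open>The pivot is the exact median, so at most half of the candidates remain in either case.
  Finding it takes \<open>400 * (length L + 1)\<close> of the stated steps.\<close>

lemma binary_search_step: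
  assumes "L \<noteq> []"
  defines "m \<equiv> sort L ! (length L div 2)"
  defines "L1 \<equiv> filter (\<lambda>x. x < m) L" and "L2 \<equiv> filter (\<lambda>x. x > m) L"
  shows "result (binary_search accept L best) =
           (if result (accept m) then result (binary_search accept L1 (Some m))
            else result (binary_search accept L2 best))"
    and "steps (binary_search accept L best) \<le> 402 * length L + 403 + steps (accept m) +
           (if result (accept m) then steps (binary_search accept L1 (Some m))
            else steps (binary_search accept L2 best))"
    and "m \<in> set L" "length L1 \<le> length L div 2" "length L2 \<le> length L div 2"
proof -
  have l: "length L div 2 < length L"
    using assms(1) by simp
  have m: "result (select (length L div 2) L) = m"
    using result_select[OF l] by (simp add: m_def)
  show "result (binary_search accept L best) =
           (if result (accept m) then result (binary_search accept L1 (Some m))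
            else result (binary_search accept L2 best))"
    using assms(1) by (subst binary_search.simps) (simp add: m L1_def L2_def)
  have "steps (binary_search accept L best) =
      1 + (length L + 1) + steps (select (length L div 2) L) + steps (accept m) + (length L + 1) +
        (if result (accept m) then steps (binary_search accept L1 (Some m))
         else steps (binary_search accept L2 best))"
    using assms(1) by (subst binary_search.simps) (simp add: m L1_def L2_def)
  then show "steps (binary_search accept L best) \<le> 402 * length L + 403 + steps (accept m) +
           (if result (accept m) then steps (binary_search accept L1 (Some m))
            else steps (binary_search accept L2 best))"
    using steps_select[of "length L div 2" L] by simp
  show "m \<in> set L"
    using select_in_set[OF l] m by simp
  show "length L1 \<le> length L div 2"
    using length_filter_less_nth_sort(1)[OF l] by (simp add: L1_def m_def)
  show "length L2 \<le> length L div 2"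
    using length_filter_less_nth_sort(2)[OF l] by (simp add: L2_def m_def)
qed

text \<open>A round on \<open>l \<ge> 1\<close> candidates costs at most \<open>805 * l\<close>
  apart from the acceptance test, and halving makes these costs a geometric series. The tests
  themselves do not become cheaper, so there is one full \<open>A\<close> for each of at most
  \<open>j\<close> rounds.\<close>

lemma steps_binary_search:
  assumes "\<And>x. steps (accept x) \<le> A" "length L < 2 ^ j"
  shows "steps (binary_search accept L best) \<le> 1612 * length L + j * A + 2"
  using assms(2)
proof (induction j arbitrary: L best)
  case 0
  then show ?case by (subst binary_search.simps) simp
next
  case (Suc j)
  show ?case
  proof (cases "L = []")
    case True
    then show ?thesis by (subst binary_search.simps) simp
  next
    case False
    define m where "m = sort L ! (length L div 2)"
    have "steps (binary_search accept (filter R L) b) \<le> 1612 * (length L div 2) + j * A + 2"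
      if "length (filter R L) \<le> length L div 2" for R b
    proof -
      have "length (filter R L) < 2 ^ j"
        using that Suc.prems by simp
      from Suc.IH[OF this, of b] that show ?thesis by linarith
    qed
    note rec = this[OF binary_search_step(4)[OF False]] this[OF binary_search_step(5)[OF False]]
    have "length L \<ge> 1"
      using False by (simp add: Suc_le_eq)
    moreover have "steps (binary_search accept L best)
        \<le> 402 * length L + 403 + A + (1612 * (length L div 2) + j * A + 2)"
      using binary_search_step(2)[OF False, of accept best] rec(1)[of "Some m"] rec(2)[of best]
        assms(1)[of m]
      unfolding m_def by (simp split: if_splits)
    moreover have "Suc j * A = j * A + A"
      by simp
    ultimately show ?thesis by linarith
  qed
qed

text \<open>Serves the case in \<open>binary_search_correct\<close> where the reference candidate
  \<open>y\<close> has been discarded: an accepted pivot is then already stored, and only smaller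
  candidates are left.\<close>

lemma binary_search_Some:
  "\<exists>x. result (binary_search accept L (Some b)) = Some x \<and> (x = b \<or> x \<in> set L \<and> result (accept x))"
proof (induction "length L" arbitrary: L b rule: less_induct)
  case less
  show ?case
  proof (cases "L = []")
    case True
    then show ?thesis by (subst binary_search.simps) simp
  next
    case False
    note step = binary_search_step[OF False]
    have less_len: "length L div 2 < length L"
      using False by simp
    show ?thesis
      using step(1)[of accept "Some b"] step(3)
        less.hyps[OF le_less_trans[OF step(4) less_len]]
        less.hyps[OF le_less_trans[OF step(5) less_len]]
      by (smt (verit, ccfv_threshold) mem_Collect_eq set_filter)
  qed
qed

text \<open>Acceptance need not be monotone: it suffices that all candidates above some threshold are
  accepted.\<close>

lemma binary_search_correct:
  assumes "\<And>x. x \<in> set L \<Longrightarrow> x\<^sub>0 \<le> x \<Longrightarrow> result (accept x)" and "y \<in> set L" "x\<^sub>0 \<le> y"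
  shows "\<exists>x\<in>set L. result (binary_search accept L best) = Some x \<and> result (accept x) \<and> x \<le> y"
  using assms
proof (induction "length L" arbitrary: L best rule: less_induct)
  case less
  have ne: "L \<noteq> []"
    using less.prems by auto
  then have half: "length L div 2 < length L"
    by simp
  define m where "m = sort L ! (length L div 2)"
  note step = binary_search_step[OF ne, folded m_def]
  show ?case
  proof (cases "result (accept m)")
    case True
    let ?L = "filter (\<lambda>x. x < m) L"
    have res: "result (binary_search accept L best) = result (binary_search accept ?L (Some m))"
      using step(1) True by simp
    show ?thesis
    proof (cases "y < m")
      case y: True
      then show ?thesis
        using less.hyps[OF le_less_trans[OF step(4) half], of "Some m"] less.prems res by auto
    next
      \<comment> \<open>Now \<open>m\<close> is at most \<open>y\<close>, and all remaining
        candidates are below \<open>m\<close>, so any accepted one that ends up as the result is at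
        most \<open>y\<close>.\<close>
      case False
      then show ?thesis
        using binary_search_Some[of accept ?L m] step(3) True res by fastforce
    qed
  next
    case False
    let ?L = "filter (\<lambda>x. x > m) L"
    \<comment> \<open>A rejected pivot is below the threshold, hence below \<open>y\<close>, and
      \<open>y\<close> survives in the upper part.\<close>
    have "m < x\<^sub>0"
      using less.prems(1)[of m] step(3) False by force
    then show ?thesis
      using less.hyps[OF le_less_trans[OF step(5) half], of best] less.prems step(1) False by auto
  qed
qed

section \<open>FairCenter\<close>

lemma result_tdist_to [simp]: "result (tdist_to d p C) = dist_to d p (set C)"
proof (induction C)
  case (Cons c C)
  then show ?case by (cases "C = []") (auto simp: dist_to_def ereal_min)
qed (simp add: dist_to_def)

lemma steps_tdist_to [simp]: "steps (tdist_to d p C) = length C + 1"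
  by (induction C) auto

lemma dist_to_le_iff: "finite C \<Longrightarrow> dist_to d p C \<le> ereal x \<longleftrightarrow> (\<exists>c\<in>C. d p c \<le> x)"
  by (auto simp: dist_to_def Min_le_iff)

lemma distances_simps [simp]:
  "result (distances d p qs) = map (d p) qs" "steps (distances d p qs) = 2 * length qs + 1"
  by (simp_all add: distances_def sum_list_triv)

text \<open>The early exit limits the centers to \<open>Suc k\<close>, the number of points limits
  them to \<open>N\<close>. The second limit matters for the quadratic algorithm, which is also run
  when \<open>k\<close> is much larger than the number of points.\<close>

lemma steps_fair_center_loop:
  assumes "length C \<le> Suc k" "length C + length ps \<le> N"
  shows "steps (fair_center_loop d k \<alpha> \<Delta> ps C) \<le> (length ps + 1) * (2 * min (Suc k) N + 3) \<and>
         length (result (fair_center_loop d k \<alpha> \<Delta> ps C)) \<le> min (Suc k) N"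
  using assms
proof (induction d k \<alpha> \<Delta> ps C rule: fair_center_loop.induct)
  case (2 d k \<alpha> \<Delta> r p ps C)
  let ?C = "if dist_to d p (set C) > ereal (2 * min (\<alpha> * r) \<Delta>) then p # C else C"
  have len: "length C \<le> min (Suc k) N"
    using "2.prems" by simp
  show ?case
  proof (cases "length C > k")
    case True
    then show ?thesis using len by simp
  next
    case False
    then have "steps (fair_center_loop d k \<alpha> \<Delta> ps ?C) \<le> (length ps + 1) * (2 * min (Suc k) N + 3) \<and>
        length (result (fair_center_loop d k \<alpha> \<Delta> ps ?C)) \<le> min (Suc k) N"
      using "2.prems" by (intro "2.IH") auto
    moreover have "steps (fair_center_loop d k \<alpha> \<Delta> ((r, p) # ps) C)
        = 2 * length C + 3 + steps (fair_center_loop d k \<alpha> \<Delta> ps ?C)"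
      and "length (result (fair_center_loop d k \<alpha> \<Delta> ((r, p) # ps) C))
        = length (result (fair_center_loop d k \<alpha> \<Delta> ps ?C))"
      using False by simp_all
    moreover have "(length ((r, p) # ps) + 1) * (2 * min (Suc k) N + 3)
        = 2 * min (Suc k) N + 3 + (length ps + 1) * (2 * min (Suc k) N + 3)"
      by simp
    ultimately show ?thesis using len by (elim conjE, intro conjI; linarith)
  qed
qed auto

text \<open>The factor \<open>j + 1\<close> stands for at most \<open>j\<close> tests and the final
  run. A test is a run of the loop, \<open>2 * min (Suc k) N + 3\<close> per point, followed by
  counting the centers.\<close>

lemma steps_search_center:
  assumes "length L < 2 ^ j" "length ps \<le> N"
  shows "steps (search_center d k \<alpha> ps L) \<le>
           1612 * length L + (j + 1) * ((N + 1) * (3 * min (Suc k) N + 4)) + 2"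
proof -
  define A where "A = (N + 1) * (3 * min (Suc k) N + 4)"
  note fc = steps_fair_center_loop[of "[]" k ps N d \<alpha>]
  have "steps (fair_center d k \<alpha> \<Delta> ps) \<le> (N + 1) * (2 * min (Suc k) N + 3)" for \<Delta>
    using fc[of \<Delta>] assms(2) unfolding fair_center_def
    by (auto intro: order_trans mult_le_mono1)
  moreover have "length (result (fair_center d k \<alpha> \<Delta> ps)) + 1 \<le> (N + 1) * (min (Suc k) N + 1)" for \<Delta>
  proof -
    have "length (result (fair_center d k \<alpha> \<Delta> ps)) + 1 \<le> 1 * (min (Suc k) N + 1)"
      using fc[of \<Delta>] assms(2) by (simp add: fair_center_def)
    also have "\<dots> \<le> (N + 1) * (min (Suc k) N + 1)"
      by (intro mult_le_mono1) simp
    finally show ?thesis .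
  qed
  ultimately have A: "steps (fair_center d k \<alpha> \<Delta> ps) + (length (result (fair_center d k \<alpha> \<Delta> ps)) + 1) \<le> A"
    for \<Delta>
    using add_mono[of "steps (fair_center d k \<alpha> \<Delta> ps)" "(N + 1) * (2 * min (Suc k) N + 3)"
        "length (result (fair_center d k \<alpha> \<Delta> ps)) + 1" "(N + 1) * (min (Suc k) N + 1)"]
    by (simp add: A_def algebra_simps)
  let ?accept = "\<lambda>\<Delta>. do {C \<leftarrow> fair_center d k \<alpha> \<Delta> ps; c \<leftarrow> tlength C; ret (c \<le> k)}"
  have "steps (binary_search ?accept L None) \<le> 1612 * length L + j * A + 2"
    using A assms(1) by (intro steps_binary_search) simp_all
  moreover have "steps (fair_center d k \<alpha> \<Delta> ps) \<le> A" for \<Delta>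
    using A[of \<Delta>] by simp
  ultimately have "steps (search_center d k \<alpha> ps L) \<le> 1612 * length L + j * A + 2 + A"
    unfolding search_center_def
    by (cases "result (binary_search ?accept L None)") (simp, simp only: steps_bind option.case ret_simps, metis add_mono add_0_right)
  then show ?thesis by (simp add: A_def)
qed

section \<open>Fair radii and optimal solutions in an enumerated finite metric space\<close>

locale enumerated_metric = Metric_space P d for P :: "'a set" and d :: "'a \<Rightarrow> 'a \<Rightarrow> real" +
  fixes xs :: "'a list"
  assumes distinct_xs: "distinct xs" and set_xs: "set xs = P" and nonempty: "P \<noteq> {}"
begin

lemma finite_P: "finite P"
  using set_xs by auto

lemma card_P: "card P = length xs"
  using distinct_xs set_xs distinct_card by fastforce

lemma card_P_pos: "card P > 0"
  using finite_P nonempty by (simp add: card_gt_0_iff)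

lemma length_filter_xs: "length (filter Q xs) = card {q \<in> P. Q q}"
  using distinct_xs set_xs distinct_card[of "filter Q xs"] by simp

lemma card_mcball:
  "p \<in> P \<Longrightarrow> card (mcball p r) = length (filter (\<lambda>x. x \<le> r) (map (d p) xs))"
  by (simp add: filter_map comp_def length_filter_xs mcball_def)

lemma radius_index:
  assumes "1 \<le> m"
  shows "nat \<lceil>real (card P) / real m\<rceil> \<ge> 1" "nat \<lceil>real (card P) / real m\<rceil> \<le> length xs"
proof -
  have pos: "real (card P) / real m > 0"
    using assms card_P_pos by simp
  then have "\<lceil>real (card P) / real m\<rceil> > 0"
    by simp
  then show "nat \<lceil>real (card P) / real m\<rceil> \<ge> 1" by linarith
  have "real (card P) / real m \<le> real (length xs)"
    using assms by (simp add: card_P divide_le_eq mult_le_cancel_left1)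
  then show "nat \<lceil>real (card P) / real m\<rceil> \<le> length xs"
    by (simp add: ceiling_le_iff nat_le_iff)
qed

text \<open>A ball reaches \<open>n / m\<close> points exactly when its radius is at least the
  distance of rank \<open>nat \<lceil>n / m\<rceil>\<close>, which is index minus one in the sorted
  list. The radii in question thus form a closed half-line, and the infimum is attained. Later
  arguments mostly use the equivalence.\<close>

lemma fair_radius_eq_nth:
  assumes "p \<in> P" "1 \<le> m"
  shows "fair_radius P d m p = sort (map (d p) xs) ! (nat \<lceil>real (card P) / real m\<rceil> - 1)"
    and "real (card P) / real m \<le> real (card (mcball p r)) \<longleftrightarrow> fair_radius P d m p \<le> r"
    and "0 \<le> fair_radius P d m p"
proof -
  define i where "i = nat \<lceil>real (card P) / real m\<rceil>"
  define x where "x = sort (map (d p) xs) ! (i - 1)"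
  have i: "1 \<le> i" "i \<le> length xs"
    using radius_index[OF assms(2)] by (simp_all add: i_def)
  have *: "real (card P) / real m \<le> real (card (mcball p r)) \<longleftrightarrow> x \<le> r" for r
  proof -
    have "real (card P) / real m \<le> real (card (mcball p r)) \<longleftrightarrow> i \<le> card (mcball p r)"
      by (simp add: i_def nat_le_iff ceiling_le_iff)
    also have "\<dots> \<longleftrightarrow> i - 1 < length (filter (\<lambda>x. x \<le> r) (map (d p) xs))"
      using i assms(1) by (auto simp: card_mcball)
    also have "\<dots> \<longleftrightarrow> x \<le> r"
      unfolding x_def using i by (intro nth_sort_le_iff[symmetric]) simp
    finally show ?thesis .
  qed
  have "x \<in> set (sort (map (d p) xs))"
    unfolding x_def using i by (intro nth_mem) simp
  then have x: "0 \<le> x"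
    by auto
  then have "{r. 0 \<le> r \<and> x \<le> r} = {x..}"
    by auto
  then have eq: "fair_radius P d m p = x"
    by (simp add: fair_radius_def *)
  then show "fair_radius P d m p = sort (map (d p) xs) ! (nat \<lceil>real (card P) / real m\<rceil> - 1)"
    and "real (card P) / real m \<le> real (card (mcball p r)) \<longleftrightarrow> fair_radius P d m p \<le> r"
    and "0 \<le> fair_radius P d m p"
    using x * by (simp_all add: x_def i_def)
qed

text \<open>By the triangle inequality, enlarging the radius by \<open>d p q\<close> makes a ball
  around \<open>p\<close> contain the ball around \<open>q\<close>.\<close>

lemma fair_radius_lipschitz:
  assumes "p \<in> P" "q \<in> P" "1 \<le> m"
  shows "fair_radius P d m p \<le> d p q + fair_radius P d m q"
proof -
  let ?r = "fair_radius P d m q"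
  have "mcball q ?r \<subseteq> mcball p (d p q + ?r)"
    using triangle[OF assms(1,2)] assms(1) by fastforce
  then have "card (mcball q ?r) \<le> card (mcball p (d p q + ?r))"
    using finite_P by (intro card_mono) (auto intro: finite_subset[OF mcball_subset_mspace])
  then show ?thesis
    using fair_radius_eq_nth(2)[OF assms(2,3), of ?r]
      fair_radius_eq_nth(2)[OF assms(1,3), of "d p q + ?r"] by simp
qed

lemma result_exact_radius:
  "p \<in> P \<Longrightarrow> 1 \<le> k \<Longrightarrow> result (exact_radius d xs k p) = fair_radius P d k p"
  using radius_index[of k] by (simp add: exact_radius_def fair_radius_eq_nth(1) card_P)
    (rule result_select, simp, linarith)

lemma cost_le: "(\<And>p. p \<in> P \<Longrightarrow> dist_to d p C \<le> x) \<Longrightarrow> cost P d C \<le> x"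
  using finite_P nonempty by (auto simp: cost_def)

text \<open>\<open>P\<close> has finitely many subsets, so the infimum is attained. The witnesses
  \<open>p\<^sub>0\<close> and \<open>c\<^sub>0\<close> record that the optimal cost is a pairwise
  distance; this is what ties it to the candidate lists.\<close>

lemma optimum:
  assumes "feasible P d \<alpha> k C\<^sub>0"
  obtains C \<Delta> p\<^sub>0 c\<^sub>0 where "C \<subseteq> P" "card C \<le> k" "opt_cost P d \<alpha> k = ereal \<Delta>"
    "\<And>p. p \<in> P \<Longrightarrow> \<exists>c\<in>C. d p c \<le> \<alpha> * fair_radius P d k p \<and> d p c \<le> \<Delta>"
    "p\<^sub>0 \<in> P" "c\<^sub>0 \<in> C" "\<Delta> = d p\<^sub>0 c\<^sub>0"
proof -
  let ?F = "{C. feasible P d \<alpha> k C}"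
  have "?F \<subseteq> Pow P"
    by (auto simp: feasible_def fair_def)
  then have fin: "finite ?F"
    using finite_P by (meson finite_Pow_iff finite_subset)
  then have "opt_cost P d \<alpha> k = Min (cost P d ` ?F)"
    using assms by (subst Min_Inf) (auto simp: opt_cost_def)
  also have "\<dots> \<in> cost P d ` ?F"
    using assms fin by (intro Min_in) auto
  finally obtain C where C: "feasible P d \<alpha> k C" "opt_cost P d \<alpha> k = cost P d C"
    by auto
  have CP: "C \<subseteq> P" "card C \<le> k" and finC: "finite C"
    using C finite_P finite_subset by (auto simp: feasible_def fair_def)
  have near: "dist_to d p C \<le> ereal (\<alpha> * fair_radius P d k p)" if "p \<in> P" for p
    using C(1) that by (auto simp: feasible_def fair_def)
  \<comment> \<open>The empty set has distance \<open>\<infinity>\<close>, whereas the fairness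
    bounds are finite.\<close>
  have "C \<noteq> {}"
    using near nonempty by (auto simp: dist_to_def)
  have "cost P d C \<in> (\<lambda>p. dist_to d p C) ` P"
    unfolding cost_def using finite_P nonempty by (intro Max_in) auto
  then obtain p\<^sub>0 where p0: "p\<^sub>0 \<in> P" "cost P d C = dist_to d p\<^sub>0 C"
    by auto
  have "Min (d p\<^sub>0 ` C) \<in> d p\<^sub>0 ` C"
    using finC \<open>C \<noteq> {}\<close> by (intro Min_in) auto
  then obtain c\<^sub>0 where c0: "c\<^sub>0 \<in> C" "cost P d C = ereal (d p\<^sub>0 c\<^sub>0)"
    using p0 \<open>C \<noteq> {}\<close> by (auto simp: dist_to_def)
  have "\<exists>c\<in>C. d p c \<le> \<alpha> * fair_radius P d k p \<and> d p c \<le> d p\<^sub>0 c\<^sub>0" if p: "p \<in> P" for p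
  proof -
    have "dist_to d p C \<le> cost P d C"
      unfolding cost_def using finite_P p by (intro Max_ge) auto
    then have "dist_to d p C \<le> ereal (min (\<alpha> * fair_radius P d k p) (d p\<^sub>0 c\<^sub>0))"
      using near[OF p] c0 by (simp add: ereal_min)
    then show ?thesis
      using finC by (simp add: dist_to_le_iff del: ereal_min)
  qed
  then show ?thesis
    using that[of C "d p\<^sub>0 c\<^sub>0" p\<^sub>0 c\<^sub>0] CP C(2) c0 p0(1) by auto
qed

section \<open>Covering and counting for the greedy choice of centers\<close>

text \<open>A point that is not added has a center within the bound already, and a point that is
  added covers itself, as the bound is nonnegative. Centers are never removed.\<close>

lemma fair_center_loop_covers:
  assumes "length (result (fair_center_loop d k \<alpha> \<Delta> ps C)) \<le> k" "0 \<le> \<Delta>" "0 \<le> \<alpha>"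
    and "\<And>r p. (r, p) \<in> set ps \<Longrightarrow> p \<in> P \<and> 0 \<le> r"
  defines "R \<equiv> set (result (fair_center_loop d k \<alpha> \<Delta> ps C))"
  shows "set C \<subseteq> R \<and> R \<subseteq> set C \<union> snd ` set ps \<and>
         (\<forall>(r, p)\<in>set ps. \<exists>c\<in>R. d p c \<le> 2 * min (\<alpha> * r) \<Delta>)"
  using assms(1-4) unfolding R_def
proof (induction ps arbitrary: C)
  case (Cons rp ps)
  obtain r p where rp [simp]: "rp = (r, p)"
    by fastforce
  have p: "p \<in> P" "0 \<le> r"
    using Cons.prems by auto
  \<comment> \<open>Otherwise the early exit would have returned \<open>C\<close>, which is too
    long.\<close>
  have k: "length C \<le> k"
    using Cons.prems(1) by (cases "length C \<le> k") auto
  define C' where "C' = (if dist_to d p (set C) > ereal (2 * min (\<alpha> * r) \<Delta>) then p # C else C)"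
  let ?R = "result (fair_center_loop d k \<alpha> \<Delta> ps C')"
  have res: "result (fair_center_loop d k \<alpha> \<Delta> (rp # ps) C) = ?R"
    using k by (simp add: C'_def)
  have len: "length ?R \<le> k"
    using Cons.prems(1) res by simp
  have IH: "set C' \<subseteq> set ?R \<and> set ?R \<subseteq> set C' \<union> snd ` set ps \<and>
         (\<forall>(r, p)\<in>set ps. \<exists>c\<in>set ?R. d p c \<le> 2 * min (\<alpha> * r) \<Delta>)"
    using Cons.prems(2-4) len by (intro Cons.IH) auto
  have "\<exists>c\<in>set C'. d p c \<le> 2 * min (\<alpha> * r) \<Delta>"
    using p Cons.prems(2,3) by (auto simp: C'_def not_less dist_to_le_iff)
  moreover have "set C \<subseteq> set C'" "set C' \<subseteq> insert p (set C)"
    by (auto simp: C'_def)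
  ultimately show ?case
    unfolding res using IH by auto
qed simp

text \<open>\<open>f\<close> assigns to each point a center of the comparison solution
  \<open>Q\<close> and stays injective on the chosen centers: a new point sharing its value with a
  chosen one would be within \<open>2 * min (\<alpha> * r) \<Delta>\<close> of it. The last
  assumption is the loop invariant behind this estimate.\<close>

lemma fair_center_loop_length:
  assumes "sorted (map fst ps)" "0 \<le> \<alpha>"
    and "\<And>p. p \<in> P \<Longrightarrow> f p \<in> Q" "Q \<subseteq> P"
    and "\<And>r p. (r, p) \<in> set ps \<Longrightarrow> p \<in> P \<and> d p (f p) \<le> min (\<alpha> * r) \<Delta>"
    and "set C \<subseteq> P" "distinct (map f C)"
    and "\<And>q r p. q \<in> set C \<Longrightarrow> (r, p) \<in> set ps \<Longrightarrow> d q (f q) \<le> min (\<alpha> * r) \<Delta>"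
  shows "length (result (fair_center_loop d k \<alpha> \<Delta> ps C)) \<le> card Q"
proof -
  have base: "length C \<le> card Q" if "set C \<subseteq> P" "distinct (map f C)" for C
  proof -
    have "card (set (map f C)) \<le> card Q"
      using assms(3,4) that(1) finite_P by (intro card_mono) (auto intro: finite_subset)
    then show ?thesis
      using distinct_card[OF that(2)] by simp
  qed
  show ?thesis
    using assms(1,5-)
  proof (induction ps arbitrary: C)
    case Nil
    then show ?case using base by simp
  next
    case (Cons rp ps)
    obtain r p where rp [simp]: "rp = (r, p)"
      by fastforce
    have p: "p \<in> P" "d p (f p) \<le> min (\<alpha> * r) \<Delta>"
      using Cons.prems(2)[of r p] by auto
    define C' where "C' = (if dist_to d p (set C) > ereal (2 * min (\<alpha> * r) \<Delta>) then p # C else C)"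
    have "f q \<noteq> f p" if far: "dist_to d p (set C) > ereal (2 * min (\<alpha> * r) \<Delta>)" and q: "q \<in> set C" for q
    proof
      assume eq: "f q = f p"
      have qP: "q \<in> P" "f q \<in> P"
        using q assms(3,4) Cons.prems(3) by auto
      have "d p q \<le> d p (f p) + d q (f q)"
        using triangle[OF p(1) qP(2,1)] eq commute[of "f q" q] by simp
      also have "\<dots> \<le> 2 * min (\<alpha> * r) \<Delta>"
        using p(2) Cons.prems(5)[OF q, of r p] by (simp add: min_def)
      finally show False
        using far q dist_to_le_iff[of "set C" d p "2 * min (\<alpha> * r) \<Delta>"] by (auto simp: not_le[symmetric])
    qed
    then have distinct: "distinct (map f C')"
      using Cons.prems(4) by (force simp: C'_def)
    \<comment> \<open>This is where the processing order enters: a bound valid for the current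
      radius remains valid for all later, larger ones.\<close>
    have later: "d q (f q) \<le> min (\<alpha> * r') \<Delta>" if q: "q \<in> set C'" and p': "(r', p') \<in> set ps" for q r' p'
    proof -
      have "d q (f q) \<le> min (\<alpha> * r) \<Delta>"
        using q p(2) Cons.prems(5)[of q r p] by (auto simp: C'_def split: if_splits)
      moreover have "r \<le> r'"
        using Cons.prems(1) p' by force
      then have "\<alpha> * r \<le> \<alpha> * r'"
        using assms(2) by (rule mult_left_mono)
      ultimately show ?thesis by simp
    qed
    show ?case
    proof (cases "length C \<le> k")
      case True
      have "length (result (fair_center_loop d k \<alpha> \<Delta> ps C')) \<le> card Q"
      proof (rule Cons.IH)
        show "set C' \<subseteq> P"
          using Cons.prems(3) p(1) by (auto simp: C'_def)
      qed (use Cons.prems(1,2) distinct later in auto)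
      then show ?thesis using True by (simp add: C'_def)
    next
      case False
      then show ?thesis using base Cons.prems(3,4) by simp
    qed
  qed
qed

text \<open>The lower bound on the radii lets every candidate from \<open>\<Delta>\<^sub>0\<close>
  on be accepted; the upper bound turns coverage at the computed radii into fairness. The accepted
  candidate is at most \<open>y\<close>, so it never has to be compared with the optimum
  itself.\<close>

lemma result_search_center:
  assumes "sorted (map fst ps)" "snd ` set ps = P" "0 < \<alpha>" "1 \<le> k"
    and radii: "\<And>r p. (r, p) \<in> set ps \<Longrightarrow> fair_radius P d k p \<le> r \<and> r \<le> \<gamma> * fair_radius P d k p"
    and Q: "Q \<subseteq> P" "card Q \<le> k"
      "\<And>p. p \<in> P \<Longrightarrow> \<exists>c\<in>Q. d p c \<le> \<alpha> * fair_radius P d k p \<and> d p c \<le> \<Delta>\<^sub>0"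
    and L: "\<And>x. x \<in> set L \<Longrightarrow> 0 \<le> x" "y \<in> set L" "\<Delta>\<^sub>0 \<le> y"
  shows "\<exists>C. result (search_center d k \<alpha> ps L) = Centers C \<and> card (set C) \<le> k \<and>
           cost P d (set C) \<le> ereal (2 * y) \<and> fair P d (2 * \<gamma> * \<alpha>) k (set C)"
proof -
  let ?accept = "\<lambda>\<Delta>. do {C \<leftarrow> fair_center d k \<alpha> \<Delta> ps; c \<leftarrow> tlength C; ret (c \<le> k)}"
  obtain f where f: "\<And>p. p \<in> P \<Longrightarrow> f p \<in> Q \<and> d p (f p) \<le> \<alpha> * fair_radius P d k p \<and> d p (f p) \<le> \<Delta>\<^sub>0"
    using Q(3) by metis
  have P: "p \<in> P" if "(r, p) \<in> set ps" for r p
    using that assms(2) by force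
  have "result (?accept x)" if "\<Delta>\<^sub>0 \<le> x" for x
  proof -
    have "d p (f p) \<le> min (\<alpha> * r) x" if rp: "(r, p) \<in> set ps" for r p
    proof -
      have "\<alpha> * fair_radius P d k p \<le> \<alpha> * r"
        using radii[OF rp] assms(3) by simp
      then show ?thesis
        using f[OF P[OF rp]] \<open>\<Delta>\<^sub>0 \<le> x\<close> by simp
    qed
    then have "length (result (fair_center d k \<alpha> x ps)) \<le> card Q"
      unfolding fair_center_def using assms(1,3) f Q(1) P
      by (intro fair_center_loop_length[of _ _ f]) auto
    then show ?thesis using Q(2) by simp
  qed
  then obtain \<Delta> where \<Delta>: "\<Delta> \<in> set L" "result (binary_search ?accept L None) = Some \<Delta>"
      "result (?accept \<Delta>)" "\<Delta> \<le> y"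
    using binary_search_correct[of L \<Delta>\<^sub>0 ?accept y None] L by blast
  define C where "C = result (fair_center d k \<alpha> \<Delta> ps)"
  have res: "result (search_center d k \<alpha> ps L) = Centers C" and len: "length C \<le> k"
    using \<Delta> by (simp_all add: search_center_def C_def)
  have "0 \<le> r" if "(r, p) \<in> set ps" for r p
    using radii[OF that] fair_radius_eq_nth(3)[OF P[OF that] assms(4)] by simp
  then have cover: "set C \<subseteq> snd ` set ps \<and> (\<forall>(r, p)\<in>set ps. \<exists>c\<in>set C. d p c \<le> 2 * min (\<alpha> * r) \<Delta>)"
    using fair_center_loop_covers[of k \<alpha> \<Delta> ps "[]"] len L(1)[OF \<Delta>(1)] assms(3) P
    by (auto simp: C_def fair_center_def)
  have near: "\<exists>c\<in>set C. d p c \<le> 2 * y \<and> d p c \<le> 2 * \<gamma> * \<alpha> * fair_radius P d k p" if "p \<in> P" for p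
  proof -
    have "p \<in> snd ` set ps"
      using that assms(2) by simp
    then obtain r where r: "(r, p) \<in> set ps"
      by auto
    then obtain c where "c \<in> set C" "d p c \<le> 2 * min (\<alpha> * r) \<Delta>"
      using cover by blast
    moreover have "\<alpha> * r \<le> \<alpha> * (\<gamma> * fair_radius P d k p)"
      using radii[OF r] assms(3) by simp
    ultimately show ?thesis
      using \<Delta>(4) by (intro bexI[of _ c]) (auto simp: mult_ac)
  qed
  have "cost P d (set C) \<le> ereal (2 * y)"
    using near by (intro cost_le) (auto simp: dist_to_le_iff)
  moreover have "fair P d (2 * \<gamma> * \<alpha>) k (set C)"
    unfolding fair_def using near cover assms(2) by (metis List.finite_set dist_to_le_iff)
  moreover have "card (set C) \<le> k"
    using card_length[of C] len by simp
  ultimately show ?thesis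
    using res by blast
qed

end

section \<open>Sampling\<close>

text \<open>The draws are independent, so the expectation of the product, with a factor
  \<open>z\<close> for each hit and 1 otherwise, factorizes.\<close>

lemma nn_integral_replicate_pmf_power:
  fixes z :: real
  assumes "0 \<le> z"
  shows "(\<integral>\<^sup>+S. ennreal (z ^ length (filter R S)) \<partial>replicate_pmf s p) =
         (\<integral>\<^sup>+x. ennreal (if R x then z else 1) \<partial>p) ^ s"
proof (induction s)
  case (Suc s)
  have *: "ennreal (z ^ length (filter R (x # S))) =
      ennreal (if R x then z else 1) * ennreal (z ^ length (filter R S))" for x S
    using assms by (simp add: ennreal_mult')
  have "(\<integral>\<^sup>+S. ennreal (z ^ length (filter R S)) \<partial>replicate_pmf (Suc s) p) =
      (\<integral>\<^sup>+x. \<integral>\<^sup>+S. ennreal (z ^ length (filter R (x # S))) \<partial>replicate_pmf s p \<partial>p)"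
    by (simp add: nn_integral_bind_pmf del: filter.simps)
  then show ?case
    by (simp only: * nn_integral_cmult nn_integral_multc Suc.IH power_Suc measurable_pmf_measure1
        borel_measurable_count_space UNIV_I) (simp add: nn_integral_cmult nn_integral_multc Suc.IH)
qed simp

text \<open>A Chernoff bound: apply Markov's inequality to \<open>z\<close> to the power of the number of hits.\<close>

lemma prob_replicate_pmf_le:
  fixes z c b :: real
  assumes "finite A" "A \<noteq> {}" "0 < z" "0 < c"
    and "real s * (real (card {x \<in> A. R x}) / real (card A)) * (z - 1) \<le> b"
  shows "measure_pmf.prob (replicate_pmf s (pmf_of_set A)) {S. c \<le> z ^ length (filter R S)} \<le> exp b / c"
proof -
  let ?p = "replicate_pmf s (pmf_of_set A)"
  let ?B = "{S. c \<le> z ^ length (filter R S)}"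
  define q where "q = real (card {x \<in> A. R x}) / real (card A)"
  have cardA: "real (card A) > 0"
    using assms(1,2) by (simp add: card_gt_0_iff)
  have "card {x \<in> A. R x} \<le> card A"
    using assms(1) by (intro card_mono) auto
  then have q: "0 \<le> q" "q \<le> 1"
    using cardA by (simp_all add: q_def)
  have "1 + q * (z - 1) = (1 - q) + q * z"
    by (simp add: algebra_simps)
  then have nonneg: "0 \<le> 1 + q * (z - 1)"
    using q mult_nonneg_nonneg[of q z] assms(3) by linarith
  have "(\<Sum>x\<in>A. if R x then z else 1) = (\<Sum>x\<in>A. 1 + (if R x then z - 1 else 0))"
    by (intro sum.cong) auto
  also have "\<dots> = real (card A) + real (card {x \<in> A. R x}) * (z - 1)"
    using assms(1) by (simp add: sum.distrib sum.inter_filter[symmetric])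
  finally have sum: "(\<Sum>x\<in>A. if R x then z else 1) = real (card A) * (1 + q * (z - 1))"
    using cardA by (simp add: q_def distrib_left)
  have "(\<integral>\<^sup>+x. ennreal (if R x then z else 1) \<partial>pmf_of_set A) =
      ennreal (\<Sum>x\<in>A. if R x then z else 1) / ennreal (real (card A))"
    using assms(1-3) by (simp add: nn_integral_pmf_of_set ennreal_of_nat_eq_real_of_nat)
  also have "\<dots> = ennreal (1 + q * (z - 1))"
    using cardA nonneg by (simp add: sum divide_ennreal)
  finally have mgf: "(\<integral>\<^sup>+S. ennreal (z ^ length (filter R S)) \<partial>?p) = ennreal ((1 + q * (z - 1)) ^ s)"
    using assms(3) nonneg by (simp add: nn_integral_replicate_pmf_power ennreal_power)
  \<comment> \<open>Estimating \<open>1 + x\<close> by \<open>exp x\<close> replaces the exact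
    moment by one that depends only on the mean number of hits.\<close>
  have "(1 + q * (z - 1)) ^ s \<le> exp (q * (z - 1)) ^ s"
    using nonneg by (intro power_mono) (auto simp: exp_ge_add_one_self)
  also have "\<dots> = exp (real s * q * (z - 1))"
    by (simp add: exp_of_nat_mult[symmetric] mult.assoc)
  also have "\<dots> \<le> exp b"
    using assms(5) by (simp add: q_def)
  finally have power: "(1 + q * (z - 1)) ^ s \<le> exp b" .
  have "ennreal c * emeasure ?p ?B = (\<integral>\<^sup>+S. ennreal c * indicator ?B S \<partial>?p)"
    by (simp add: nn_integral_cmult_indicator)
  also have "\<dots> \<le> (\<integral>\<^sup>+S. ennreal (z ^ length (filter R S)) \<partial>?p)"
    using assms(3) by (intro nn_integral_mono) (auto simp: indicator_def intro: ennreal_leI)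
  also have "\<dots> \<le> ennreal (exp b)"
    unfolding mgf using power by (rule ennreal_leI)
  finally have "ennreal (c * measure_pmf.prob ?p ?B) \<le> ennreal (exp b)"
    using assms(4) by (simp add: measure_pmf.emeasure_eq_measure ennreal_mult')
  then have "c * measure_pmf.prob ?p ?B \<le> exp b"
    by simp
  then show ?thesis
    using assms(4) by (simp add: field_simps)
qed

text \<open>The bases are the ratios of the rank to the two means, 27/36 and 27/18, which is the
  optimal choice in the Chernoff bound. What has to be checked is that \<open>(4 / 3) ^ 27\<close>
  is at most \<open>exp 8\<close> and \<open>(3 / 2) ^ 27\<close> at least
  \<open>exp 10\<close>.\<close>

lemma exp_power_bounds:
  "exp (- (9 * real l)) / (3 / 4) ^ (27 * l) \<le> exp (- real l)"
  "exp (9 * real l) / (3 / 2) ^ (27 * l) \<le> exp (- real l)"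
proof -
  have "4 / 3 \<le> exp (8 / 27 :: real)"
    using exp_lower_Taylor_quadratic[of "8 / 27"] by (simp add: power2_eq_square)
  then have "(4 / 3) ^ 27 \<le> exp (8 / 27 :: real) ^ 27"
    by (rule power_mono) simp
  then have "(4 / 3) ^ 27 \<le> exp (8 :: real)"
    by (simp add: exp_of_nat_mult[symmetric])
  then have "((4 / 3) ^ 27) ^ l \<le> exp (8 :: real) ^ l"
    by (rule power_mono) simp
  then have "(4 / 3) ^ (27 * l) \<le> exp (8 * real l)"
    unfolding power_mult by (simp add: exp_of_nat_mult[symmetric] mult.commute)
  moreover have "exp (- (9 * real l)) / (3 / 4) ^ (27 * l) = exp (- (9 * real l)) * (4 / 3) ^ (27 * l)"
    by (simp add: power_divide)
  ultimately have "exp (- (9 * real l)) / (3 / 4) ^ (27 * l) \<le> exp (- (9 * real l)) * exp (8 * real l)"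
    by simp
  also have "\<dots> = exp (- real l)"
    by (simp add: exp_add[symmetric])
  finally show "exp (- (9 * real l)) / (3 / 4) ^ (27 * l) \<le> exp (- real l)" .
  have "exp (10 :: real) = exp 1 ^ 10"
    by (simp add: exp_of_nat_mult[symmetric])
  also have "\<dots> \<le> (272 / 100) ^ 10"
    using e_less_272 by (intro power_mono) auto
  also have "\<dots> \<le> (3 / 2) ^ 27"
    by (simp add: field_simps)
  finally have "exp (10 :: real) ^ l \<le> ((3 / 2) ^ 27) ^ l"
    by (rule power_mono) simp
  then have "exp (10 * real l) \<le> (3 / 2) ^ (27 * l)"
    unfolding power_mult by (simp add: exp_of_nat_mult[symmetric] mult.commute)
  then have "exp (9 * real l) / (3 / 2) ^ (27 * l) \<le> exp (9 * real l) / exp (10 * real l)"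
    by (intro divide_left_mono) auto
  also have "\<dots> = exp (- real l)"
    by (simp add: exp_diff[symmetric])
  finally show "exp (9 * real l) / (3 / 2) ^ (27 * l) \<le> exp (- real l)" .
qed

lemma log_factor_props:
  assumes "0 < \<delta>" "\<delta> < 1" "n \<ge> 1"
  shows "exp (- real (log_factor n \<delta>)) \<le> \<delta> / (2 * real n)" "log_factor n \<delta> \<ge> 1"
    "real (log_factor n \<delta>) \<le> ln (2 * real n / \<delta>) + 1"
proof -
  have "\<delta> < 2 * real n"
    using assms by linarith
  then have "2 * real n / \<delta> > 1"
    using assms by simp
  then have pos: "ln (2 * real n / \<delta>) > 0"
    by (rule ln_gt_zero)
  then show "log_factor n \<delta> \<ge> 1" "real (log_factor n \<delta>) \<le> ln (2 * real n / \<delta>) + 1"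
    unfolding log_factor_def by linarith+
  have "exp (- real (log_factor n \<delta>)) \<le> exp (- ln (2 * real n / \<delta>))"
    unfolding log_factor_def using pos by simp
  also have "\<dots> = \<delta> / (2 * real n)"
    using assms by (simp add: exp_minus)
  finally show "exp (- real (log_factor n \<delta>)) \<le> \<delta> / (2 * real n)" .
qed

section \<open>Sample radii between two fair radii\<close>

text \<open>The value that \<open>fair_sampling\<close> computes for \<open>p\<close>, as a function
  of the sample alone and free of step counts.\<close>

definition sample_radius :: "('a \<Rightarrow> 'a \<Rightarrow> real) \<Rightarrow> nat \<Rightarrow> 'a list \<Rightarrow> 'a \<Rightarrow> real" where
  "sample_radius d t S p = sort (map (d p) S) ! (t - 1)"

context enumerated_metric
begin

text \<open>If the open ball had more points, its largest distance from the center would be a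
  smaller radius that already collects \<open>n / m\<close> points.\<close>

lemma card_open_ball:
  assumes "p \<in> P" "1 \<le> m"
  shows "real (card {q \<in> P. d p q < fair_radius P d m p}) \<le> real (card P) / real m"
proof (rule ccontr)
  let ?A = "{q \<in> P. d p q < fair_radius P d m p}"
  assume *: "\<not> ?thesis"
  then have "card ?A \<noteq> 0"
    by (metis divide_nonneg_nonneg of_nat_0 of_nat_0_le_iff)
  then have A: "finite (d p ` ?A)" "d p ` ?A \<noteq> {}"
    using finite_P by auto
  define r where "r = Max (d p ` ?A)"
  have "r < fair_radius P d m p"
    using Max_in[OF A] by (auto simp: r_def)
  moreover have "?A \<subseteq> mcball p r"
    using A assms(1) by (auto simp: r_def)
  then have "card ?A \<le> card (mcball p r)"
    using finite_P by (intro card_mono) (auto intro: finite_subset[OF mcball_subset_mspace])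
  ultimately show False
    using * fair_radius_eq_nth(2)[OF assms, of r] by simp
qed

lemma prob_sample_radius:
  assumes "1 \<le> k" "0 < \<delta>" "\<delta> < 1"
  defines "l \<equiv> log_factor (card P) \<delta>"
  shows "measure_pmf.prob (replicate_pmf (36 * k * l) (pmf_of_set P))
           {S. \<forall>p\<in>P. fair_radius P d (2 * k) p \<le> sample_radius d (27 * l) S p \<and>
                 sample_radius d (27 * l) S p \<le> fair_radius P d k p} \<ge> 1 - \<delta>"
    (is "measure_pmf.prob ?S ?good \<ge> _")
proof -
  define s where "s = 36 * k * l"
  define t where "t = 27 * l"
  \<comment> \<open>Written as powers to fit the Chernoff bound. As 3/4 is below 1 and 3/2 above,
    \<open>hi p\<close> means at most \<open>t\<close> hits in the closed ball for \<open>k\<close>,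
    and \<open>lo p\<close> at least \<open>t\<close> hits in the open ball for
    \<open>2 * k\<close>.\<close>
  define hi where "hi p = {S. (3 / 4) ^ t \<le> (3 / 4 :: real) ^ length (filter (\<lambda>q. d p q \<le> fair_radius P d k p) S)}" for p
  define lo where "lo p = {S. (3 / 2) ^ t \<le> (3 / 2 :: real) ^ length (filter (\<lambda>q. d p q < fair_radius P d (2 * k) p) S)}" for p
  have l: "l \<ge> 1" "exp (- real l) \<le> \<delta> / (2 * real (card P))"
    using log_factor_props[OF assms(2,3), of "card P"] card_P_pos by (simp_all add: l_def)
  have n: "real (card P) > 0" and k: "real k > 0"
    using card_P_pos assms(1) by auto
  \<comment> \<open>Here \<open>x\<close> is the mean number of hits; its bounds
    \<open>36 * l\<close> and \<open>18 * l\<close> give the same exponent \<open>9 * l\<close> for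
    both tails.\<close>
  have factor_hi: "x * (3 / 4 - 1) \<le> - (9 * real l)" if "36 * real l \<le> x" for x :: real
    using that by simp
  have factor_lo: "x * (3 / 2 - 1) \<le> 9 * real l" if "x \<le> 18 * real l" for x :: real
    using that by simp
  have hi: "measure_pmf.prob ?S (hi p) \<le> \<delta> / (2 * real (card P))" if p: "p \<in> P" for p
  proof -
    have "{q \<in> P. d p q \<le> fair_radius P d k p} = mcball p (fair_radius P d k p)"
      using p by (auto simp: mcball_def)
    then have "real (card P) / real k \<le> real (card {q \<in> P. d p q \<le> fair_radius P d k p})"
      using fair_radius_eq_nth(2)[OF p assms(1), of "fair_radius P d k p"] by simp
    then have "1 / real k \<le> real (card {q \<in> P. d p q \<le> fair_radius P d k p}) / real (card P)"
      using n k by (simp add: field_simps)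
    then have "real s * (1 / real k) \<le> real s * (real (card {q \<in> P. d p q \<le> fair_radius P d k p}) / real (card P))"
      by (rule mult_left_mono) simp
    moreover have "real s * (1 / real k) = 36 * real l"
      using k by (simp add: s_def)
    ultimately have "36 * real l \<le> real s * (real (card {q \<in> P. d p q \<le> fair_radius P d k p}) / real (card P))"
      by simp
    then have "real s * (real (card {q \<in> P. d p q \<le> fair_radius P d k p}) / real (card P)) * (3 / 4 - 1)
        \<le> - (9 * real l)"
      by (rule factor_hi)
    then have "measure_pmf.prob ?S (hi p) \<le> exp (- (9 * real l)) / (3 / 4) ^ t"
      unfolding hi_def s_def[symmetric] using finite_P nonempty by (intro prob_replicate_pmf_le) simp_all
    then show ?thesis
      using exp_power_bounds(1)[of l] l(2) by (simp add: t_def)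
  qed
  have lo: "measure_pmf.prob ?S (lo p) \<le> \<delta> / (2 * real (card P))" if p: "p \<in> P" for p
  proof -
    have "real (card {q \<in> P. d p q < fair_radius P d (2 * k) p}) \<le> real (card P) / real (2 * k)"
      using p assms(1) by (intro card_open_ball) auto
    then have "real (card {q \<in> P. d p q < fair_radius P d (2 * k) p}) / real (card P) \<le> 1 / real (2 * k)"
      using n k by (simp add: field_simps)
    then have "real s * (real (card {q \<in> P. d p q < fair_radius P d (2 * k) p}) / real (card P)) \<le> real s * (1 / real (2 * k))"
      by (rule mult_left_mono) simp
    moreover have "real s * (1 / real (2 * k)) = 18 * real l"
      using k by (simp add: s_def)
    ultimately have "real s * (real (card {q \<in> P. d p q < fair_radius P d (2 * k) p}) / real (card P)) \<le> 18 * real l"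
      by simp
    then have "real s * (real (card {q \<in> P. d p q < fair_radius P d (2 * k) p}) / real (card P)) * (3 / 2 - 1)
        \<le> 9 * real l"
      by (rule factor_lo)
    then have "measure_pmf.prob ?S (lo p) \<le> exp (9 * real l) / (3 / 2) ^ t"
      unfolding lo_def s_def[symmetric] using finite_P nonempty by (intro prob_replicate_pmf_le) simp_all
    then show ?thesis
      using exp_power_bounds(2)[of l] l(2) by (simp add: t_def)
  qed
  \<comment> \<open>Restricting to the support fixes the length of the sample, so that the rank
    \<open>t\<close> exists in it.\<close>
  have "- ?good \<inter> set_pmf ?S \<subseteq> (\<Union>p\<in>P. hi p \<union> lo p)"
  proof
    fix S assume S: "S \<in> - ?good \<inter> set_pmf ?S"
    then have "length S = s"
      by (auto simp: set_replicate_pmf s_def)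
    moreover have "27 * l \<le> s"
      using assms(1) by (simp add: s_def)
    ultimately have t: "t - 1 < length S" "t \<ge> 1"
      using l(1) by (simp_all add: t_def)
    from S obtain p where p: "p \<in> P" and bad: "\<not> (fair_radius P d (2 * k) p \<le> sample_radius d t S p \<and>
        sample_radius d t S p \<le> fair_radius P d k p)"
      by (auto simp: t_def)
    show "S \<in> (\<Union>p\<in>P. hi p \<union> lo p)"
    proof (cases "sample_radius d t S p \<le> fair_radius P d k p")
      case True
      then have "t - 1 < length (filter (\<lambda>q. d p q < fair_radius P d (2 * k) p) S)"
        using bad nth_sort_less_iff[of "t - 1" "map (d p) S" "fair_radius P d (2 * k) p"] t
        by (simp add: sample_radius_def filter_map comp_def not_le)
      then have "S \<in> lo p"
        using t(2) by (simp add: lo_def power_increasing)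
      then show ?thesis using p by auto
    next
      case False
      then have "length (filter (\<lambda>q. d p q \<le> fair_radius P d k p) S) \<le> t - 1"
        using nth_sort_le_iff[of "t - 1" "map (d p) S" "fair_radius P d k p"] t
        by (simp add: sample_radius_def filter_map comp_def)
      then have "S \<in> hi p"
        by (simp add: hi_def power_decreasing)
      then show ?thesis using p by auto
    qed
  qed
  then have "measure_pmf.prob ?S (- ?good \<inter> set_pmf ?S) \<le> measure_pmf.prob ?S (\<Union>p\<in>P. hi p \<union> lo p)"
    by (intro measure_pmf.finite_measure_mono) auto
  also have "\<dots> \<le> (\<Sum>p\<in>P. measure_pmf.prob ?S (hi p \<union> lo p))"
    using finite_P by (intro measure_pmf.finite_measure_subadditive_finite) auto
  also have "\<dots> \<le> (\<Sum>p\<in>P. \<delta> / real (card P))"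
  proof (rule sum_mono)
    fix p assume "p \<in> P"
    have "measure_pmf.prob ?S (hi p \<union> lo p) \<le> measure_pmf.prob ?S (hi p) + measure_pmf.prob ?S (lo p)"
      by (intro measure_Un_le) auto
    then show "measure_pmf.prob ?S (hi p \<union> lo p) \<le> \<delta> / real (card P)"
      using hi[OF \<open>p \<in> P\<close>] lo[OF \<open>p \<in> P\<close>] by (simp add: field_simps)
  qed
  also have "\<dots> = \<delta>"
    using n by simp
  finally have "measure_pmf.prob ?S (- ?good) \<le> \<delta>"
    by (simp add: measure_Int_set_pmf)
  then show ?thesis
    using measure_pmf.prob_compl[of ?good ?S] by (simp add: Compl_eq_Diff_UNIV)
qed

end

section \<open>Approximate fair radii\<close>

lemma close_radius_None:
  "result (close_radius d p x C) = None \<Longrightarrow> (q, y, r) \<in> set C \<Longrightarrow> x + y < d p q"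
  by (induction d p x C rule: close_radius.induct) (auto split: if_splits)

lemma close_radius_Some:
  "result (close_radius d p x C) = Some r' \<Longrightarrow>
     \<exists>q y r. (q, y, r) \<in> set C \<and> d p q \<le> x + y \<and> r' = d p q + r"
  by (induction d p x C rule: close_radius.induct) (auto split: if_splits)

lemma steps_close_radius: "steps (close_radius d p x C) \<le> length C + 1"
  by (induction d p x C rule: close_radius.induct) auto

context enumerated_metric
begin

text \<open>By the triangle inequality the balls of radius \<open>r q\<close> are disjoint, and each
  has at least \<open>n / m\<close> points. Separation is stated by \<open>sorted_wrt\<close>
  because it is learned for each new center against the older ones when it is put in front of the
  list.\<close>

lemma packing:
  assumes "1 \<le> m" "set qs \<subseteq> P" "\<And>p. p \<in> P \<Longrightarrow> fair_radius P d m p \<le> r p"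
    and sep: "sorted_wrt (\<lambda>q q'. r q + r q' < d q q') qs"
  shows "length qs \<le> m"
proof -
  have far: "r (qs ! i) + r (qs ! j) < d (qs ! i) (qs ! j)"
    if "i \<noteq> j" "i < length qs" "j < length qs" for i j
    using that sep[unfolded sorted_wrt_iff_nth_less] commute[of "qs ! i" "qs ! j"]
    by (metis add.commute linorder_neqE_nat)
  have nonneg: "0 \<le> r q" if "q \<in> P" for q
    using assms(3)[OF that] fair_radius_eq_nth(3)[OF that assms(1)] by simp
  \<comment> \<open>A repeated point would have distance 0 to itself, which cannot exceed the sum of
    two nonnegative radii.\<close>
  have "distinct qs"
  proof (unfold distinct_conv_nth, intro allI impI notI)
    fix i j assume ij: "i < length qs" "j < length qs" "i \<noteq> j" "qs ! i = qs ! j"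
    then have "qs ! j \<in> P"
      using assms(2) by auto
    then show False
      using far[OF ij(3,1,2)] nonneg[of "qs ! j"] ij(4) by simp
  qed
  have disjoint: "mcball q (r q) \<inter> mcball q' (r q') = {}"
    if q: "q \<in> set qs" "q' \<in> set qs" "q \<noteq> q'" for q q'
  proof -
    have "r q + r q' < d q q'"
      using q far by (metis in_set_conv_nth)
    moreover have "d q q' \<le> r q + r q'" if "x \<in> mcball q (r q) \<inter> mcball q' (r q')" for x
      using that triangle[of q x q'] commute[of q' x] by (auto simp: mcball_def)
    ultimately show ?thesis by fastforce
  qed
  have fin: "finite (mcball q x)" for q x
    using finite_P finite_subset mcball_subset_mspace by blast
  have "(\<Sum>q\<in>set qs. real (card P) / real m) \<le> (\<Sum>q\<in>set qs. real (card (mcball q (r q))))"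
    using assms(1-3) by (intro sum_mono) (auto simp: fair_radius_eq_nth(2) subset_iff)
  also have "\<dots> = real (card (\<Union>q\<in>set qs. mcball q (r q)))"
    using fin disjoint by (subst card_UN_disjoint) auto
  also have "\<dots> \<le> real (card P)"
    using finite_P mcball_subset_mspace by (intro of_nat_mono card_mono) blast+
  finally have "real (length qs) * (real (card P) / real m) \<le> real (card P)"
    using \<open>distinct qs\<close> by (simp add: distinct_card)
  then show ?thesis
    using card_P_pos assms(1) by (simp add: field_simps)
qed

text \<open>The assumptions on \<open>C\<close> and \<open>rs\<close> are the loop invariant:
  \<open>C\<close> carries sample radii and exact radii, no center comes later in the order than an
  open point, and the centers are separated as \<open>packing\<close> requires.\<close>

lemma result_radii_loop:
  assumes "1 \<le> k" "sorted (map fst ps)"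
    and good: "\<And>p. p \<in> P \<Longrightarrow> fair_radius P d (2 * k) p \<le> r' p \<and> r' p \<le> fair_radius P d k p"
    and "\<And>x p. (x, p) \<in> set ps \<Longrightarrow> p \<in> P \<and> x = r' p"
    and "\<And>q x y. (q, x, y) \<in> set C \<Longrightarrow> q \<in> P \<and> x = r' q \<and> y = fair_radius P d k q"
    and "\<And>q x y z p. (q, x, y) \<in> set C \<Longrightarrow> (z, p) \<in> set ps \<Longrightarrow> x \<le> z"
    and "sorted_wrt (\<lambda>q q'. r' q + r' q' < d q q') (map fst C)"
    and "\<And>r p. (r, p) \<in> set rs \<Longrightarrow> fair_radius P d k p \<le> r \<and> r \<le> 5 * fair_radius P d k p"
  shows "\<exists>rs'. result (radii_loop d xs k ps C rs) = Some rs' \<and>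
           snd ` set rs' = snd ` set rs \<union> snd ` set ps \<and>
           (\<forall>r p. (r, p) \<in> set rs' \<longrightarrow> fair_radius P d k p \<le> r \<and> r \<le> 5 * fair_radius P d k p)"
  using assms(2,4-)
proof (induction ps arbitrary: C rs)
  case (Cons xp ps)
  obtain x p where xp [simp]: "xp = (x, p)"
    by fastforce
  have p: "p \<in> P" "x = r' p"
    using Cons.prems(2) by auto
  show ?case
  proof (cases "result (close_radius d p x C)")
    case (Some r)
    then obtain q y s where q: "(q, y, s) \<in> set C" "d p q \<le> x + y" "r = d p q + s"
      using close_radius_Some by fast
    then have qP: "q \<in> P" "y = r' q" "s = fair_radius P d k q" "y \<le> x"
      using Cons.prems(3)[of q y s] Cons.prems(4)[of q y s x p] by auto
    have "fair_radius P d k p \<le> d p q + fair_radius P d k q"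
      "fair_radius P d k q \<le> d p q + fair_radius P d k p"
      using fair_radius_lipschitz[OF p(1) qP(1) assms(1)] fair_radius_lipschitz[OF qP(1) p(1) assms(1)]
        commute[of q p] by simp_all
    \<comment> \<open>As \<open>q\<close> was processed earlier, \<open>d p q\<close> is at most
      \<open>2 * r' p\<close>, hence at most twice the exact radius of \<open>p\<close>. The new
      value is at most \<open>2 * d p q\<close> plus that radius, in total five times the
      radius.\<close>
    then have r: "fair_radius P d k p \<le> r \<and> r \<le> 5 * fair_radius P d k p"
      using q(2,3) qP(3,4) good[OF p(1)] p(2) by linarith
    have "\<exists>rs'. result (radii_loop d xs k ps C ((r, p) # rs)) = Some rs' \<and>
           snd ` set rs' = snd ` set ((r, p) # rs) \<union> snd ` set ps \<and>
           (\<forall>r p. (r, p) \<in> set rs' \<longrightarrow> fair_radius P d k p \<le> r \<and> r \<le> 5 * fair_radius P d k p)"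
    proof (rule Cons.IH)
      show "sorted (map fst ps)"
        using Cons.prems(1) by simp
      show "z \<in> P \<and> w = r' z" if "(w, z) \<in> set ps" for w z
        using that Cons.prems(2)[of w z] by simp
      show "u \<le> z" if "(w, u, v) \<in> set C" "(z, z') \<in> set ps" for w u v z z'
        using that Cons.prems(4)[of w u v z z'] by simp
    qed (use r Cons.prems(3,5,6) in auto)
    then show ?thesis
      using Some by simp
  next
    case None
    define r where "r = fair_radius P d k p"
    define C' where "C' = (p, x, r) # C"
    have sep: "sorted_wrt (\<lambda>q q'. r' q + r' q' < d q q') (map fst C')"
      using Cons.prems(3,5) close_radius_None[OF None] p(2) by (fastforce simp: C'_def)
    moreover have "set (map fst C') \<subseteq> P"
      using p(1) Cons.prems(3) by (auto simp: C'_def)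
    ultimately have "length (map fst C') \<le> 2 * k"
      using assms(1) good by (intro packing[of "2 * k" _ r']) auto
    \<comment> \<open>Sample radii are at least the fair radii for \<open>2 * k\<close>, so the
      packing bound is \<open>2 * k\<close>, below the failure threshold.\<close>
    then have "length C' \<le> 3 * k"
      by simp
    then have res: "result (radii_loop d xs k (xp # ps) C rs) = result (radii_loop d xs k ps C' ((r, p) # rs))"
      using None p(1) assms(1) by (simp add: result_exact_radius r_def C'_def)
    have "0 \<le> r"
      using fair_radius_eq_nth(3)[OF p(1) assms(1)] by (simp add: r_def)
    have "\<exists>rs'. result (radii_loop d xs k ps C' ((r, p) # rs)) = Some rs' \<and>
           snd ` set rs' = snd ` set ((r, p) # rs) \<union> snd ` set ps \<and>
           (\<forall>r p. (r, p) \<in> set rs' \<longrightarrow> fair_radius P d k p \<le> r \<and> r \<le> 5 * fair_radius P d k p)"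
    proof (rule Cons.IH)
      show "sorted (map fst ps)"
        using Cons.prems(1) by simp
      show "z \<in> P \<and> w = r' z" if "(w, z) \<in> set ps" for w z
        using that Cons.prems(2)[of w z] by simp
      show "u \<le> z" if "(w, u, v) \<in> set C'" "(z, z') \<in> set ps" for w u v z z'
        using that Cons.prems(1) Cons.prems(4)[of w u v z z'] by (force simp: C'_def)
      show "w \<in> P \<and> u = r' w \<and> v = fair_radius P d k w" if "(w, u, v) \<in> set C'" for w u v
        using that p Cons.prems(3)[of w u v] by (auto simp: C'_def r_def)
      show "fair_radius P d k q \<le> s \<and> s \<le> 5 * fair_radius P d k q" if "(s, q) \<in> set ((r, p) # rs)" for s q
        using that \<open>0 \<le> r\<close> Cons.prems(6)[of s q] by (auto simp: r_def)
    qed (rule sep)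
    then show ?thesis
      using res by simp
  qed
qed auto

end

text \<open>Each exact radius computed adds an element to \<open>C\<close>, and more than
  \<open>3 * k\<close> elements end the loop. So \<open>3 * k + 1 - length C\<close> bounds how many
  exact radii are still to come, whatever the sample is.\<close>

lemma steps_radii_loop:
  assumes "\<And>p. steps (exact_radius d xs k p) \<le> E" "length C \<le> 3 * k"
  shows "steps (radii_loop d xs k ps C rs) \<le>
           length ps * (3 * k + 2) + (3 * k + 1 - length C) * (E + 3 * k + 2) + 1"
  using assms(2)
proof (induction ps arbitrary: C rs)
  case (Cons xp ps)
  obtain x p where xp [simp]: "xp = (x, p)"
    by fastforce
  have close: "steps (close_radius d p x C) \<le> 3 * k + 1"
    using steps_close_radius[of d p x C] Cons.prems by simp
  show ?case
  proof (cases "result (close_radius d p x C)")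
    case (Some r)
    then show ?thesis
      using close Cons.IH[of C "(r, p) # rs"] Cons.prems by simp
  next
    case None
    define r where "r = result (exact_radius d xs k p)"
    define C' where "C' = (p, x, r) # C"
    define m where "m = 3 * k - length C"
    have m: "3 * k + 1 - length C = m + 1"
      using Cons.prems by (simp add: m_def)
    have len: "length C' = length C + 1"
      by (simp add: C'_def)
    have "steps (radii_loop d xs k (xp # ps) C rs) = 1 + steps (close_radius d p x C)
        + steps (exact_radius d xs k p) + (length C' + 1)
        + (if length C' > 3 * k then 0 else steps (radii_loop d xs k ps C' ((r, p) # rs)))"
      using None by (simp add: C'_def r_def)
    moreover have "(if length C' > 3 * k then 0 else steps (radii_loop d xs k ps C' ((r, p) # rs)))
        \<le> length ps * (3 * k + 2) + m * (E + 3 * k + 2) + 1"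
      using Cons.IH[of C' "(r, p) # rs"] len by (auto simp: m_def)
    moreover have "length C' \<le> 3 * k + 1"
      using len Cons.prems by simp
    moreover have "(m + 1) * (E + 3 * k + 2) = m * (E + 3 * k + 2) + (E + 3 * k + 2)"
      by simp
    moreover have "length (xp # ps) * (3 * k + 2) = length ps * (3 * k + 2) + (3 * k + 2)"
      by simp
    ultimately show ?thesis
      unfolding m using close assms(1)[of p] by linarith
  qed
qed simp

section \<open>Candidates for the cost\<close>

lemma furthest_in_set: "result (furthest xp ps) \<in> set (xp # ps)"
  by (induction xp ps rule: furthest.induct) auto

lemma furthest_max: "(y, q) \<in> set (xp # ps) \<Longrightarrow> y \<le> fst (result (furthest xp ps))"
proof (induction xp ps arbitrary: y q rule: furthest.induct)
  case (2 x p y' q' ps)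
  then show ?case
    by (cases "y' > x") (force dest: "2.IH")+
qed auto

lemma steps_furthest [simp]: "steps (furthest xp ps) = length ps + 1"
  by (induction xp ps rule: furthest.induct) auto

lemma length_geometric [simp]: "length (result (geometric q m x)) = m"
  by (induction q m x rule: geometric.induct) auto

lemma steps_geometric [simp]: "steps (geometric q m x) = m + 1"
  by (induction q m x rule: geometric.induct) auto

lemma set_geometric: "set (result (geometric q m x)) = (\<lambda>j. q ^ j * x) ` {1..m}"
proof (induction q m x rule: geometric.induct)
  case (2 q m x)
  have "{1..Suc m} = insert 1 (Suc ` {1..m})"
    by (simp add: image_Suc_atLeastAtMost atLeastAtMost_insertL)
  then have "(\<lambda>j. q ^ j * x) ` {1..Suc m} = insert (q * x) ((\<lambda>j. q ^ Suc j * x) ` {1..m})"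
    by (simp only: image_insert image_image power_one_right)
  then show ?case
    using 2 by (simp add: mult_ac)
qed simp

lemma geometric_nonneg: "0 \<le> q \<Longrightarrow> 0 \<le> x \<Longrightarrow> y \<in> set (result (geometric q m x)) \<Longrightarrow> 0 \<le> y"
  by (auto simp: set_geometric)

text \<open>Take the least exponent whose grid point reaches \<open>y\<close>; the grid point before
  it is below \<open>y\<close>, so one factor \<open>q\<close> overshoots at most to
  \<open>q * y\<close>.\<close>

lemma geometric_cover:
  fixes q x b y :: real
  assumes "1 < q" "1 < b" "0 < x" "x \<le> y" "y \<le> b * x"
  shows "\<exists>z\<in>set (result (geometric q (nat \<lceil>log q b\<rceil>) x)). y \<le> z \<and> z \<le> q * y"
proof -
  define m where "m = nat \<lceil>log q b\<rceil>"
  have "log q b > 0"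
    using assms by simp
  then have m: "m \<ge> 1" "log q b \<le> real m"
    unfolding m_def by linarith+
  have "b = q powr log q b"
    using assms by simp
  also have "\<dots> \<le> q powr real m"
    using assms(1) m(2) by simp
  also have "\<dots> = q ^ m"
    using assms(1) by (simp add: powr_realpow)
  finally have "b * x \<le> q ^ m * x"
    using assms(3) by simp
  then have top: "y \<le> q ^ m * x"
    using assms(5) by simp
  define j where "j = (LEAST j. y \<le> q ^ j * x)"
  have j: "y \<le> q ^ j * x" "j \<le> m"
    unfolding j_def using LeastI[of "\<lambda>j. y \<le> q ^ j * x", OF top] Least_le[of "\<lambda>j. y \<le> q ^ j * x", OF top]
    by simp_all
  show ?thesis
  proof (cases j)
    \<comment> \<open>The grid starts at exponent 1. Exponent 0 would be the choice only for
      \<open>y = x\<close>, and then the first grid point \<open>q * x\<close> equals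
      \<open>q * y\<close>.\<close>
    case 0
    then have "y = x"
      using j assms(4) by simp
    then have "y \<le> q ^ 1 * x" "q ^ 1 * x \<le> q * y"
      using assms(1,3) by auto
    moreover have "q ^ 1 * x \<in> (\<lambda>j. q ^ j * x) ` {1..m}"
      using m(1) by (intro imageI) simp
    ultimately show ?thesis
      unfolding set_geometric m_def[symmetric] by blast
  next
    case (Suc i)
    then have "\<not> y \<le> q ^ i * x"
        using not_less_Least[of i "\<lambda>j. y \<le> q ^ j * x"] by (simp add: j_def)
    then have "q * (q ^ i * x) \<le> q * y"
      using assms(1) by simp
    then have "q ^ j * x \<le> q * y"
      using Suc by (simp add: mult_ac)
    then show ?thesis
      using j Suc unfolding set_geometric m_def[symmetric] by (intro bexI[of _ "q ^ j * x"] imageI) simp_all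
  qed
qed

context enumerated_metric
begin

section \<open>The farthest-point traversal and the covering property of the candidates\<close>

text \<open>The invariant says that no point is farther from \<open>C\<close> than the centers are
  from each other. It persists since the next center is a furthest point. At the end a furthest
  point \<open>g\<close> joins the centers, giving one more point at pairwise distance at least
  \<open>D\<close>.\<close>

lemma gonzalez_loop_props:
  assumes "snd ` set ps = P" "set C \<subseteq> P"
    and "\<And>x p. (x, p) \<in> set ps \<Longrightarrow> (\<exists>c\<in>set C. x = d p c) \<and> (\<forall>c\<in>set C. x \<le> d p c)"
    and "sorted_wrt (\<lambda>c c'. \<forall>(x, p)\<in>set ps. x \<le> d c c') C"
    and "result (gonzalez_loop d j ps C) = (C', D)"
  shows "length C' = length C + j \<and> set C' \<subseteq> P \<and> (\<forall>p\<in>P. \<exists>c\<in>set C'. d p c \<le> D) \<and>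
         (\<exists>g\<in>P. sorted_wrt (\<lambda>c c'. D \<le> d c c') (g # C'))"
  using assms
proof (induction j arbitrary: ps C)
  case 0
  have "ps \<noteq> []"
    using 0(1) nonempty by auto
  then have ps: "hd ps # tl ps = ps"
    by simp
  obtain g where g: "result (furthest (hd ps) (tl ps)) = (D, g)" "C' = C"
    using 0(5) by (auto split: prod.splits)
  then have Dg: "(D, g) \<in> set ps"
    using furthest_in_set[of "hd ps" "tl ps"] unfolding ps by simp
  have D: "x \<le> D" if "(x, p) \<in> set ps" for x p
    using furthest_max[of x p "hd ps" "tl ps"] that g(1) unfolding ps by simp
  have "\<exists>c\<in>set C. d p c \<le> D" if "p \<in> P" for p
  proof -
    have "p \<in> snd ` set ps"
      using that 0(1) by simp
    then obtain x where x: "(x, p) \<in> set ps"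
      by auto
    then show ?thesis
      using 0(3)[OF x] D[OF x] by auto
  qed
  moreover have "sorted_wrt (\<lambda>c c'. D \<le> d c c') C"
    using 0(4) by (rule sorted_wrt_mono_rel[rotated]) (use Dg in auto)
  moreover have "\<forall>c\<in>set C. D \<le> d g c"
    using 0(3)[OF Dg] by auto
  moreover have "g \<in> P"
    using Dg 0(1) by force
  ultimately show ?case
    using g(2) 0(2) by auto
next
  case (Suc j)
  have "ps \<noteq> []"
    using Suc(2) nonempty by auto
  then have ps: "hd ps # tl ps = ps"
    by simp
  obtain D' g where g: "result (furthest (hd ps) (tl ps)) = (D', g)"
    by fastforce
  then have Dg: "(D', g) \<in> set ps"
    using furthest_in_set[of "hd ps" "tl ps"] unfolding ps by simp
  have D': "x \<le> D'" if "(x, p) \<in> set ps" for x p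
    using furthest_max[of x p "hd ps" "tl ps"] that g unfolding ps by simp
  define ps' where "ps' = map (\<lambda>(x, p). (min x (d p g), p)) ps"
  have res: "result (gonzalez_loop d j ps' (g # C)) = (C', D)"
    using Suc(6) g by (simp add: ps'_def case_prod_unfold)
  have gP: "g \<in> P"
    using Dg Suc(2) by force
  have "length C' = length (g # C) + j \<and> set C' \<subseteq> P \<and> (\<forall>p\<in>P. \<exists>c\<in>set C'. d p c \<le> D) \<and>
         (\<exists>g\<in>P. sorted_wrt (\<lambda>c c'. D \<le> d c c') (g # C'))"
  proof (rule Suc.IH[OF _ _ _ _ res])
    show "snd ` set ps' = P"
      using Suc(2) by (simp add: ps'_def image_image case_prod_unfold)
    show "set (g # C) \<subseteq> P"
      using gP Suc(3) by simp
  next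
    fix y p assume "(y, p) \<in> set ps'"
    then obtain x where "(x, p) \<in> set ps" "y = min x (d p g)"
      by (auto simp: ps'_def)
    then show "(\<exists>c\<in>set (g # C). y = d p c) \<and> (\<forall>c\<in>set (g # C). y \<le> d p c)"
      using Suc(4)[of x p] by (auto simp: min_def)
  next
    \<comment> \<open>Adding a center can only decrease the recorded distances.\<close>
    have below: "\<exists>x. (x, p) \<in> set ps \<and> y \<le> x" if "(y, p) \<in> set ps'" for y p
      using that by (auto simp: ps'_def)
    have "sorted_wrt (\<lambda>c c'. \<forall>(x, p)\<in>set ps'. x \<le> d c c') C"
      using Suc(5) by (rule sorted_wrt_mono_rel[rotated]) (use below in \<open>fastforce dest: order_trans\<close>)
    moreover have "y \<le> d g c" if "(y, p) \<in> set ps'" "c \<in> set C" for y p c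
      using below[OF that(1)] D' Suc(4)[OF Dg] that(2) by (meson order_trans)
    ultimately show "sorted_wrt (\<lambda>c c'. \<forall>(x, p)\<in>set ps'. x \<le> d c c') (g # C)"
      by auto
  qed
  then show ?case by simp
qed

lemma gonzalez_props:
  assumes "1 \<le> k" "result (gonzalez d xs k) = (C, D)"
  shows "length C = k" "set C \<subseteq> P" "\<And>p. p \<in> P \<Longrightarrow> \<exists>c\<in>set C. d p c \<le> D"
    "\<exists>g\<in>P. sorted_wrt (\<lambda>c c'. D \<le> d c c') (g # C)"
proof -
  have "xs \<noteq> []"
    using set_xs nonempty by auto
  then have "hd xs \<in> P"
    using set_xs by auto
  moreover have "snd ` set (map (\<lambda>p. (d p (hd xs), p)) xs) = P"
    by (simp add: image_image set_xs)
  moreover have "result (gonzalez_loop d (k - 1) (map (\<lambda>p. (d p (hd xs), p)) xs) [hd xs]) = (C, D)"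
    using assms(2) by (simp add: gonzalez_def)
  ultimately have "length C = length [hd xs] + (k - 1) \<and> set C \<subseteq> P \<and> (\<forall>p\<in>P. \<exists>c\<in>set C. d p c \<le> D) \<and>
         (\<exists>g\<in>P. sorted_wrt (\<lambda>c c'. D \<le> d c c') (g # C))"
    by (intro gonzalez_loop_props) auto
  then show "length C = k" "set C \<subseteq> P" "\<And>p. p \<in> P \<Longrightarrow> \<exists>c\<in>set C. d p c \<le> D"
    "\<exists>g\<in>P. sorted_wrt (\<lambda>c c'. D \<le> d c c') (g # C)"
    using assms(1) by auto
qed

text \<open>Two of \<open>k + 1\<close> points at pairwise distance at least \<open>D\<close> share their nearest center in \<open>Q\<close>.\<close>

lemma gonzalez_2_approx:
  assumes "1 \<le> k" "result (gonzalez d xs k) = (C, D)"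
    and "Q \<subseteq> P" "card Q \<le> k" "\<And>p. p \<in> P \<Longrightarrow> \<exists>c\<in>Q. d p c \<le> \<Delta>"
  shows "D \<le> 2 * \<Delta>"
proof -
  obtain g where g: "g \<in> P" "sorted_wrt (\<lambda>c c'. D \<le> d c c') (g # C)"
    using gonzalez_props(4)[OF assms(1,2)] by auto
  define ps where "ps = g # C"
  have ps: "length ps = k + 1" "set ps \<subseteq> P"
    using gonzalez_props(1,2)[OF assms(1,2)] g(1) by (auto simp: ps_def)
  obtain f where f: "\<And>p. p \<in> P \<Longrightarrow> f p \<in> Q \<and> d p (f p) \<le> \<Delta>"
    using assms(5) by metis
  have "\<not> distinct (map f ps)"
  proof
    assume "distinct (map f ps)"
    then have "k + 1 = card (set (map f ps))"
      using ps(1) by (simp only: distinct_card length_map)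
    also have "\<dots> \<le> card Q"
      using f ps(2) assms(3) finite_P by (intro card_mono) (auto intro: finite_subset)
    finally show False
      using assms(4) by simp
  qed
  then obtain i j where ij: "i < length ps" "j < length ps" "i \<noteq> j" "f (ps ! i) = f (ps ! j)"
    by (auto simp: distinct_conv_nth)
  obtain i j where ij: "i < j" "j < length ps" "f (ps ! i) = f (ps ! j)"
    using ij by (metis linorder_neqE_nat)
  then have P: "ps ! i \<in> P" "ps ! j \<in> P" "f (ps ! j) \<in> P"
    using ps(2) f assms(3) by (force simp: subset_iff)+
  have "D \<le> d (ps ! i) (ps ! j)"
    using g(2) ij(1,2) by (simp only: ps_def sorted_wrt_iff_nth_less)
  also have "\<dots> \<le> d (ps ! i) (f (ps ! i)) + d (ps ! j) (f (ps ! j))"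
    using triangle[OF P(1,3,2)] ij(3) commute by simp
  also have "\<dots> \<le> 2 * \<Delta>"
    using f[OF P(1)] f[OF P(2)] by simp
  finally show ?thesis .
qed

lemma set_cost_candidates:
  assumes "result (gonzalez d xs k) = (C, D)"
  shows "set (result (cost_candidates d xs k \<epsilon>)) =
    set (result (geometric (1 + \<epsilon>) (nat \<lceil>log (1 + \<epsilon>) 16\<rceil>) (D / 2))) \<union>
    (\<Union>g1\<in>set C. \<Union>g2\<in>set C - {g1}. set (result (geometric (1 + \<epsilon>) (nat \<lceil>log (1 + \<epsilon>) 4\<rceil>) (d g1 g2 / 2))))"
  using assms by (auto simp: cost_candidates_def split: if_splits) metis+

text \<open>Up to \<open>8 * D\<close> the value \<open>\<Delta>\<close> lies in the range of the
  first grid, from \<open>D / 2\<close> over a factor 16. Beyond that, replacing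
  \<open>p\<^sub>0\<close> and \<open>c\<^sub>0\<close> by Gonzalez centers within \<open>D\<close>
  changes their distance by at most \<open>2 * D\<close>, less than a quarter of
  \<open>\<Delta>\<close>; so \<open>\<Delta>\<close> lies between half and twice the distance of
  two centers, a factor 4.\<close>

lemma cost_candidates_cover:
  assumes "1 \<le> k" "k < card P" "0 < \<epsilon>"
    and Q: "Q \<subseteq> P" "card Q \<le> k" "\<And>p. p \<in> P \<Longrightarrow> \<exists>c\<in>Q. d p c \<le> \<Delta>"
    and \<Delta>: "p\<^sub>0 \<in> P" "c\<^sub>0 \<in> Q" "\<Delta> = d p\<^sub>0 c\<^sub>0"
  shows "\<exists>y\<in>set (result (cost_candidates d xs k \<epsilon>)). \<Delta> \<le> y \<and> y \<le> (1 + \<epsilon>) * \<Delta>"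
    and "\<And>y. y \<in> set (result (cost_candidates d xs k \<epsilon>)) \<Longrightarrow> 0 \<le> y"
proof -
  obtain C D where CD: "result (gonzalez d xs k) = (C, D)"
    by fastforce
  note gonz = gonzalez_props[OF assms(1) CD]
  \<comment> \<open>With \<open>D = 0\<close> every point would be a center, contrary to
    \<open>k < card P\<close>; a positive start is what makes the first grid cover a range.\<close>
  have "D > 0"
  proof (rule ccontr)
    assume "\<not> D > 0"
    have "P \<subseteq> set C"
    proof
      fix p assume p: "p \<in> P"
      then obtain c where c: "c \<in> set C" "d p c \<le> D"
        using gonz(3) by blast
      then have "d p c = 0"
        using \<open>\<not> D > 0\<close> nonneg[of p c] by linarith
      then show "p \<in> set C"
        using c(1) p gonz(2) by auto
    qed
    then have "card P \<le> card (set C)"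
      by (intro card_mono) auto
    then show False
      using card_length[of C] gonz(1) assms(2) by simp
  qed
  have nn: "0 \<le> 1 + \<epsilon>" "0 \<le> D / 2"
    using \<open>D > 0\<close> assms(3) by simp_all
  show "0 \<le> y" if "y \<in> set (result (cost_candidates d xs k \<epsilon>))" for y
  proof -
    have "y \<in> set (result (geometric (1 + \<epsilon>) (nat \<lceil>log (1 + \<epsilon>) 16\<rceil>) (D / 2))) \<or>
      (\<exists>g1 g2. y \<in> set (result (geometric (1 + \<epsilon>) (nat \<lceil>log (1 + \<epsilon>) 4\<rceil>) (d g1 g2 / 2))))"
      using that by (simp only: set_cost_candidates[OF CD] Un_iff UN_iff) metis
    then show ?thesis
      using geometric_nonneg[OF nn] geometric_nonneg[OF nn(1), of "d _ _ / 2"] nonneg by auto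
  qed
  have D: "D \<le> 2 * \<Delta>"
    by (rule gonzalez_2_approx[OF assms(1) CD Q])
  show "\<exists>y\<in>set (result (cost_candidates d xs k \<epsilon>)). \<Delta> \<le> y \<and> y \<le> (1 + \<epsilon>) * \<Delta>"
  proof (cases "\<Delta> \<le> 8 * D")
    case True
    then show ?thesis
      using geometric_cover[of "1 + \<epsilon>" 16 "D / 2" \<Delta>] D \<open>D > 0\<close> assms(3)
      unfolding set_cost_candidates[OF CD] by auto
  next
    case False
    have c0: "c\<^sub>0 \<in> P"
      using \<Delta>(2) Q(1) by auto
    obtain g1 g2 where g: "g1 \<in> set C" "d p\<^sub>0 g1 \<le> D" "g2 \<in> set C" "d c\<^sub>0 g2 \<le> D"
      using gonz(3)[OF \<Delta>(1)] gonz(3)[OF c0] by blast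
    then have gP: "g1 \<in> P" "g2 \<in> P"
      using gonz(2) by auto
    have "\<Delta> \<le> d p\<^sub>0 g1 + d g1 g2 + d c\<^sub>0 g2" "d g1 g2 \<le> d p\<^sub>0 g1 + \<Delta> + d c\<^sub>0 g2"
      using triangle[OF \<Delta>(1) gP(1) c0] triangle[OF gP c0] triangle[OF gP(1) \<Delta>(1) gP(2)]
        triangle[OF \<Delta>(1) c0 gP(2)] commute[of g1 p\<^sub>0] commute[of g2 c\<^sub>0] \<Delta>(3) by linarith+
    then have close: "\<Delta> \<le> 2 * D + d g1 g2" "d g1 g2 \<le> 2 * D + \<Delta>"
      using g by linarith+
    then have pos: "0 < d g1 g2" "d g1 g2 / 2 \<le> \<Delta>" "\<Delta> \<le> 4 * (d g1 g2 / 2)"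
      using False \<open>D > 0\<close> by linarith+
    then have "g1 \<noteq> g2"
      using gP by auto
    then show ?thesis
      using geometric_cover[of "1 + \<epsilon>" 4 "d g1 g2 / 2" \<Delta>] pos assms(3) g
      unfolding set_cost_candidates[OF CD] by auto
  qed
qed

end

section \<open>Number of candidates and cost of computing them\<close>

lemma steps_gonzalez_loop:
  "ps \<noteq> [] \<Longrightarrow> steps (gonzalez_loop d j ps C) \<le> (j + 1) * (3 * length ps + 2) \<and>
     length (fst (result (gonzalez_loop d j ps C))) = length C + j"
proof (induction j arbitrary: ps C)
  case 0
  then show ?case by (auto simp: case_prod_unfold)
next
  case (Suc j)
  define g where "g = snd (result (furthest (hd ps) (tl ps)))"
  define ps' where "ps' = map (\<lambda>(x, p). (min x (d p g), p)) ps"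
  have "steps (gonzalez_loop d (Suc j) ps C) = 3 * length ps + 2 + steps (gonzalez_loop d j ps' (g # C))"
    using Suc.prems by (cases ps) (simp_all add: ps'_def g_def case_prod_unfold sum_list_triv)
  moreover have "result (gonzalez_loop d (Suc j) ps C) = result (gonzalez_loop d j ps' (g # C))"
    by (simp add: ps'_def g_def case_prod_unfold)
  moreover have "steps (gonzalez_loop d j ps' (g # C)) \<le> (j + 1) * (3 * length ps + 2)"
    "length (fst (result (gonzalez_loop d j ps' (g # C)))) = length (g # C) + j"
    using Suc.IH[of ps' "g # C"] Suc.prems by (simp_all add: ps'_def)
  ultimately show ?case by simp
qed

lemma steps_gonzalez:
  assumes "xs \<noteq> []" "1 \<le> k"
  shows "steps (gonzalez d xs k) \<le> (k + 1) * (3 * length xs + 2)"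
    and "length (fst (result (gonzalez d xs k))) = k"
proof -
  define ps where "ps = map (\<lambda>p. (d p (hd xs), p)) xs"
  have "ps \<noteq> []" "length ps = length xs"
    using assms by (auto simp: ps_def)
  then have "steps (gonzalez_loop d (k - 1) ps [hd xs]) \<le> k * (3 * length xs + 2)"
    "length (fst (result (gonzalez_loop d (k - 1) ps [hd xs]))) = k"
    using steps_gonzalez_loop[of ps d "k - 1" "[hd xs]"] assms(2) by simp_all
  moreover have "steps (gonzalez d xs k) = 2 * length xs + 1 + steps (gonzalez_loop d (k - 1) ps [hd xs])"
    "result (gonzalez d xs k) = result (gonzalez_loop d (k - 1) ps [hd xs])"
    by (simp_all add: gonzalez_def ps_def sum_list_triv)
  ultimately show "steps (gonzalez d xs k) \<le> (k + 1) * (3 * length xs + 2)"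
    and "length (fst (result (gonzalez d xs k))) = k"
    by simp_all
qed

lemma length_concat_le: "(\<And>ys. ys \<in> set xss \<Longrightarrow> length ys \<le> b) \<Longrightarrow> length (concat xss) \<le> length xss * b"
  using sum_list_le_const[of xss length b] by (simp add: length_concat)

lemma steps_tconcat_le:
  "(\<And>ys. ys \<in> set xss \<Longrightarrow> length ys \<le> b) \<Longrightarrow> steps (tconcat xss) \<le> length xss * (b + 2) + 1"
  using sum_list_le_const[of xss "\<lambda>ys. length ys + 2" "b + 2"] by simp

text \<open>A candidate from a pair of centers is paid for three times, when it is generated and in
  two nested concatenations; hence \<open>3 * m2\<close>.\<close>

lemma cost_candidates_size:
  fixes \<epsilon> :: real
  assumes "xs \<noteq> []" "1 \<le> k"
  defines "m1 \<equiv> nat \<lceil>log (1 + \<epsilon>) 16\<rceil>" and "m2 \<equiv> nat \<lceil>log (1 + \<epsilon>) 4\<rceil>"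
  shows "length (result (cost_candidates d xs k \<epsilon>)) \<le> m1 + k * (k * m2)"
    and "steps (cost_candidates d xs k \<epsilon>) \<le>
           (k + 1) * (3 * length xs + 2) + 2 * m1 + k * (k * (3 * m2 + 5) + 5) + 4"
proof -
  obtain C D where CD: "result (gonzalez d xs k) = (C, D)"
    by fastforce
  then have k: "length C = k"
    using steps_gonzalez(2)[OF assms(1,2), of d] by simp
  define entry where "entry g g' = (if g = g' then ret [] else geometric (1 + \<epsilon>) m2 (d g g' / 2))" for g g'
  define row where "row g = tmap (\<lambda>g'. do {tick; entry g g'}) C" for g
  define Ls where "Ls = tmap (\<lambda>g. do {ls \<leftarrow> row g; tconcat ls}) C"
  have row_length: "length (result (row g)) = k" for g
    by (simp add: row_def k)
  have entry_length: "length ys \<le> m2" if "ys \<in> set (result (row g))" for ys g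
    using that by (auto simp: row_def entry_def)
  have "steps (do {tick; entry g g'}) \<le> m2 + 2" for g g'
    by (simp add: entry_def)
  then have row_steps: "steps (row g) \<le> k * (m2 + 2 + 1) + 1" for g
    unfolding row_def k[symmetric] by (rule steps_tmap_le)
  have line_steps: "steps (do {ls \<leftarrow> row g; tconcat ls}) \<le> (k * (m2 + 2 + 1) + 1) + (k * (m2 + 2) + 1)" for g
  proof -
    have "steps (tconcat (result (row g))) \<le> length (result (row g)) * (m2 + 2) + 1"
      using entry_length by (rule steps_tconcat_le)
    then show ?thesis
      unfolding steps_bind row_length using row_steps[of g] by linarith
  qed
  have Ls_length: "length (result Ls) = k"
    by (simp add: Ls_def k)
  have line_length: "length ys \<le> k * m2" if ys: "ys \<in> set (result Ls)" for ys
  proof -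
    obtain g where "ys = concat (result (row g))"
      using ys by (auto simp: Ls_def)
    moreover have "length (concat (result (row g))) \<le> length (result (row g)) * m2"
      using entry_length by (rule length_concat_le)
    ultimately show ?thesis
      by (simp only: row_length)
  qed
  have Ls_steps: "steps Ls \<le> k * ((k * (m2 + 2 + 1) + 1) + (k * (m2 + 2) + 1) + 1) + 1"
    unfolding Ls_def using steps_tmap_le[where xs = C, OF line_steps] unfolding k .
  have Ls_concat: "steps (tconcat (result Ls)) \<le> k * (k * m2 + 2) + 1"
    using steps_tconcat_le[of "result Ls" "k * m2", OF line_length] unfolding Ls_length .
  have eq: "cost_candidates d xs k \<epsilon> = do {
      (C, D) \<leftarrow> gonzalez d xs k;
      L \<leftarrow> geometric (1 + \<epsilon>) m1 (D / 2);
      Ls \<leftarrow> tmap (\<lambda>g. do {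
          ls \<leftarrow> tmap (\<lambda>g'. do {tick; entry g g'}) C;
          tconcat ls
        }) C;
      L' \<leftarrow> tconcat Ls;
      tappend L L'
    }"
    unfolding cost_candidates_def m1_def m2_def entry_def[abs_def] ..
  have "length (result (cost_candidates d xs k \<epsilon>)) = m1 + length (concat (result Ls))"
    unfolding eq Ls_def row_def result_bind CD prod.case by simp
  then show "length (result (cost_candidates d xs k \<epsilon>)) \<le> m1 + k * (k * m2)"
    using length_concat_le[of "result Ls" "k * m2", OF line_length] unfolding Ls_length by simp
  have "steps (cost_candidates d xs k \<epsilon>) = steps (gonzalez d xs k) + (m1 + 1) + steps Ls +
      steps (tconcat (result Ls)) + (m1 + 1)"
    unfolding eq Ls_def row_def result_bind steps_bind CD prod.case by simp
  then have "steps (cost_candidates d xs k \<epsilon>) \<le> (k + 1) * (3 * length xs + 2) + (m1 + 1) +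
      (k * ((k * (m2 + 2 + 1) + 1) + (k * (m2 + 2) + 1) + 1) + 1) + (k * (k * m2 + 2) + 1) + (m1 + 1)"
    using Ls_steps Ls_concat steps_gonzalez(1)[OF assms(1,2), of d] by linarith
  also have "\<dots> = (k + 1) * (3 * length xs + 2) + 2 * m1 + k * (k * (3 * m2 + 5) + 5) + 4"
    by (simp add: algebra_simps)
  finally show "steps (cost_candidates d xs k \<epsilon>) \<le>
           (k + 1) * (3 * length xs + 2) + 2 * m1 + k * (k * (3 * m2 + 5) + 5) + 4" .
qed

section \<open>Correctness\<close>

lemma length_radii_loop:
  "result (radii_loop d xs k ps C rs) = Some rs' \<Longrightarrow> length rs' = length rs + length ps"
proof (induction ps arbitrary: C rs)
  case (Cons xp ps)
  obtain x p where xp [simp]: "xp = (x, p)"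
    by fastforce
  show ?case
    using Cons.prems Cons.IH by (auto split: option.splits if_splits)
qed simp

text \<open>Gathers all randomness in one sample, with the rest a deterministic function of it. Both
  the success probability and the running time are read off from this form.\<close>

lemma approx_fair_center_eq:
  fixes d xs k \<alpha> \<epsilon> \<delta>
  defines "n \<equiv> real (length xs)" and "l \<equiv> log_factor (length xs) \<delta>"
  assumes "\<not> (real k > n / 6 \<or> (real k)\<^sup>2 / \<epsilon> > n\<^sup>2 * ln n)"
  shows "approx_fair_center d xs k \<alpha> \<epsilon> \<delta> =
    map_pmf
      (\<lambda>S. do {
        tlength xs;
        res \<leftarrow> do {
          rs' \<leftarrow> do {
            tlength xs;
            S' \<leftarrow> Timed S (36 * k * l);
            tmap (\<lambda>p. do {ds \<leftarrow> distances d p S'; r \<leftarrow> select (27 * l - 1) ds; ret (r, p)}) xs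
          };
          ps \<leftarrow> heap_sort rs';
          radii_loop d xs k ps [] []
        };
        case res of
          None \<Rightarrow> ret Fail
        | Some rs \<Rightarrow> do {
            L \<leftarrow> cost_candidates d xs k (\<epsilon> / 2);
            ps \<leftarrow> heap_sort rs;
            search_center d k \<alpha> ps L
          }
      })
      (replicate_pmf (36 * k * l) (pmf_of_set (set xs)))"
  using assms(3)
  by (simp add: approx_fair_center_def approx_fair_radii_def fair_sampling_def sample_points_def
      Let_def n_def l_def pmf.map_comp comp_def)

context enumerated_metric
begin

text \<open>Common end of both branches, which differ in radii and candidates. The list does not
  know the optimum, so it has to serve every \<open>Q\<close> and \<open>\<Delta>\<close> with the
  properties that \<open>optimum\<close> provides.\<close>

lemma search_center_approximation:
  assumes "sorted (map fst ps)" "snd ` set ps = P" "0 < \<alpha>" "1 \<le> k" "feasible P d \<alpha> k C\<^sub>0"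
    and "\<And>r p. (r, p) \<in> set ps \<Longrightarrow> fair_radius P d k p \<le> r \<and> r \<le> 5 * fair_radius P d k p"
    and "\<And>x. x \<in> set L \<Longrightarrow> 0 \<le> x"
    and L: "\<And>Q \<Delta> p\<^sub>0 c\<^sub>0. Q \<subseteq> P \<Longrightarrow> card Q \<le> k \<Longrightarrow> (\<And>p. p \<in> P \<Longrightarrow> \<exists>c\<in>Q. d p c \<le> \<Delta>) \<Longrightarrow>
      p\<^sub>0 \<in> P \<Longrightarrow> c\<^sub>0 \<in> Q \<Longrightarrow> \<Delta> = d p\<^sub>0 c\<^sub>0 \<Longrightarrow> \<exists>y\<in>set L. \<Delta> \<le> y \<and> 2 * y \<le> (2 + \<epsilon>) * \<Delta>"
  shows "\<exists>C. result (search_center d k \<alpha> ps L) = Centers C \<and> approximation P d \<alpha> k (2 + \<epsilon>) 10 (set C)"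
proof -
  obtain Q \<Delta> p\<^sub>0 c\<^sub>0 where Q: "Q \<subseteq> P" "card Q \<le> k" "opt_cost P d \<alpha> k = ereal \<Delta>"
    "\<And>p. p \<in> P \<Longrightarrow> \<exists>c\<in>Q. d p c \<le> \<alpha> * fair_radius P d k p \<and> d p c \<le> \<Delta>"
    "p\<^sub>0 \<in> P" "c\<^sub>0 \<in> Q" "\<Delta> = d p\<^sub>0 c\<^sub>0"
    by (rule optimum[OF assms(5)]) (rule that)
  obtain y where y: "y \<in> set L" "\<Delta> \<le> y" "2 * y \<le> (2 + \<epsilon>) * \<Delta>"
    using L[OF Q(1,2) _ Q(5-7)] Q(4) by blast
  obtain C where C: "result (search_center d k \<alpha> ps L) = Centers C" "card (set C) \<le> k"
    "cost P d (set C) \<le> ereal (2 * y)" "fair P d (2 * 5 * \<alpha>) k (set C)"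
    using result_search_center[OF assms(1-4) assms(6) Q(1,2,4) assms(7) y(1,2)] by blast
  have "cost P d (set C) \<le> ereal (2 + \<epsilon>) * opt_cost P d \<alpha> k"
    using C(3) y(3) order_trans by (fastforce simp: Q(3))
  then show ?thesis
    using C by (simp add: approximation_def)
qed

lemma result_approx_fair_center_2_2:
  assumes "0 < \<alpha>" "1 \<le> k" "0 < \<epsilon>" "feasible P d \<alpha> k C\<^sub>0"
  shows "\<exists>C. result (approx_fair_center_2_2 d xs k \<alpha>) = Centers C \<and>
           approximation P d \<alpha> k (2 + \<epsilon>) 10 (set C)"
proof -
  define rs where "rs = map (\<lambda>p. (result (exact_radius d xs k p), p)) xs"
  define L where "L = concat (map (\<lambda>p. map (d p) xs) xs)"
  have set_rs: "set rs = (\<lambda>p. (fair_radius P d k p, p)) ` P"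
    using assms(2) by (auto simp: rs_def set_xs result_exact_radius image_iff)
  have "\<exists>C. result (search_center d k \<alpha> (result (heap_sort rs)) L) = Centers C \<and>
           approximation P d \<alpha> k (2 + \<epsilon>) 10 (set C)"
  proof (rule search_center_approximation[OF sorted_heap_sort _ assms(1,2,4)])
    show "snd ` set (result (heap_sort rs)) = P"
      by (simp add: set_rs image_image)
    show "fair_radius P d k p \<le> r \<and> r \<le> 5 * fair_radius P d k p"
      if "(r, p) \<in> set (result (heap_sort rs))" for r p
      using that fair_radius_eq_nth(3)[OF _ assms(2)] by (auto simp: set_rs)
    show "0 \<le> x" if "x \<in> set L" for x
      using that by (auto simp: L_def)
    show "\<exists>y\<in>set L. \<Delta> \<le> y \<and> 2 * y \<le> (2 + \<epsilon>) * \<Delta>"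
      if "Q \<subseteq> P" "p\<^sub>0 \<in> P" "c\<^sub>0 \<in> Q" "\<Delta> = d p\<^sub>0 c\<^sub>0" for Q p\<^sub>0 c\<^sub>0 and \<Delta> :: real
    proof (intro bexI conjI)
      \<comment> \<open>The list contains all pairwise distances, so the optimal cost is itself a
        candidate.\<close>
      show "\<Delta> \<in> set L"
        using that set_xs by (auto simp: L_def)
      show "2 * \<Delta> \<le> (2 + \<epsilon>) * \<Delta>"
        using that(4) assms(3) by (intro mult_right_mono) auto
    qed simp
  qed
  then show ?thesis
    by (simp add: approx_fair_center_2_2_def rs_def L_def)
qed

lemma prob_approx_fair_center:
  assumes "0 < \<alpha>" "1 \<le> k" "0 < \<epsilon>" "0 < \<delta>" "\<delta> < 1" "feasible P d \<alpha> k C\<^sub>0"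
  shows "measure_pmf.prob (approx_fair_center d xs k \<alpha> \<epsilon> \<delta>)
    {run. \<exists>C. result run = Centers C \<and> approximation P d \<alpha> k (2 + \<epsilon>) 10 (set C)} \<ge> 1 - \<delta>"
    (is "measure_pmf.prob _ ?G \<ge> _")
proof (cases "real k > real (length xs) / 6 \<or> (real k)\<^sup>2 / \<epsilon> > (real (length xs))\<^sup>2 * ln (real (length xs))")
  case True
  then have "approx_fair_center d xs k \<alpha> \<epsilon> \<delta> =
      return_pmf (do {tlength xs; approx_fair_center_2_2 d xs k \<alpha>})"
    by (simp add: approx_fair_center_def Let_def)
  moreover have "(do {tlength xs; approx_fair_center_2_2 d xs k \<alpha>}) \<in> ?G"
    using result_approx_fair_center_2_2[OF assms(1-3,6)] by simp
  ultimately show ?thesis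
    using assms(4) by (simp add: measure_return_pmf indicator_def)
next
  case False
  define l where "l = log_factor (length xs) \<delta>"
  define s where "s = 36 * k * l"
  \<comment> \<open>Hides the run behind a function \<open>F\<close> of the sample, so that a good
    sample yields success and the probability transfers along the preimage.\<close>
  have "\<exists>F. approx_fair_center d xs k \<alpha> \<epsilon> \<delta> = map_pmf F (replicate_pmf s (pmf_of_set P)) \<and>
    (\<forall>S\<in>set_pmf (replicate_pmf s (pmf_of_set P)).
      (\<forall>p\<in>P. fair_radius P d (2 * k) p \<le> sample_radius d (27 * l) S p \<and>
             sample_radius d (27 * l) S p \<le> fair_radius P d k p) \<longrightarrow> F S \<in> ?G)"
  proof (rule exI, rule conjI, subst approx_fair_center_eq[OF False], unfold s_def l_def set_xs, rule refl,
      unfold l_def[symmetric], intro ballI impI)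
    fix S
    assume S: "S \<in> set_pmf (replicate_pmf (36 * k * l) (pmf_of_set P))"
      and good: "\<forall>p\<in>P. fair_radius P d (2 * k) p \<le> sample_radius d (27 * l) S p \<and>
             sample_radius d (27 * l) S p \<le> fair_radius P d k p"
    have "l \<ge> 1"
      using log_factor_props(2)[OF assms(4,5), of "card P"] card_P_pos by (simp add: l_def card_P Suc_le_eq)
    moreover have len: "length S = 36 * k * l"
      using S by (simp add: set_replicate_pmf)
    moreover have "27 * l \<le> 36 * k * l"
      using assms(2) by simp
    ultimately have t: "27 * l - 1 < length S"
      by linarith
    define rs' where "rs' = map (\<lambda>p. (sample_radius d (27 * l) S p, p)) xs"
    have rs': "result (tmap (\<lambda>p. do {ds \<leftarrow> distances d p S; r \<leftarrow> select (27 * l - 1) ds; ret (r, p)}) xs) = rs'"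
      using t by (simp add: rs'_def sample_radius_def result_select)
    have set_rs': "set rs' = (\<lambda>p. (sample_radius d (27 * l) S p, p)) ` P"
      by (simp add: rs'_def set_xs)
    have "\<exists>rs. result (radii_loop d xs k (result (heap_sort rs')) [] []) = Some rs \<and>
        snd ` set rs = snd ` set ([] :: (real \<times> 'a) list) \<union> snd ` set (result (heap_sort rs')) \<and>
        (\<forall>r p. (r, p) \<in> set rs \<longrightarrow> fair_radius P d k p \<le> r \<and> r \<le> 5 * fair_radius P d k p)"
    proof (rule result_radii_loop[OF assms(2) sorted_heap_sort])
      show "p \<in> P \<and> x = sample_radius d (27 * l) S p" if "(x, p) \<in> set (result (heap_sort rs'))" for x p
        using that by (auto simp: set_rs')
    qed (use good in simp_all)
    then obtain rs where rs: "result (radii_loop d xs k (result (heap_sort rs')) [] []) = Some rs"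
      "snd ` set rs = P"
      "\<And>r p. (r, p) \<in> set rs \<Longrightarrow> fair_radius P d k p \<le> r \<and> r \<le> 5 * fair_radius P d k p"
      by (auto simp: set_rs' image_image)
    define L where "L = result (cost_candidates d xs k (\<epsilon> / 2))"
    have kP: "k < card P" "0 < \<epsilon> / 2"
      using False assms(2,3) by (auto simp: card_P)
    have "\<exists>C. result (search_center d k \<alpha> (result (heap_sort rs)) L) = Centers C \<and>
             approximation P d \<alpha> k (2 + \<epsilon>) 10 (set C)"
    proof (rule search_center_approximation[OF sorted_heap_sort _ assms(1,2,6)])
      show "fair_radius P d k p \<le> r \<and> r \<le> 5 * fair_radius P d k p"
        if "(r, p) \<in> set (result (heap_sort rs))" for r p
        using that rs(3) by simp
      fix Q p\<^sub>0 c\<^sub>0 and \<Delta> :: real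
      assume Q: "Q \<subseteq> P" "card Q \<le> k" "\<And>p. p \<in> P \<Longrightarrow> \<exists>c\<in>Q. d p c \<le> \<Delta>"
        "p\<^sub>0 \<in> P" "c\<^sub>0 \<in> Q" "\<Delta> = d p\<^sub>0 c\<^sub>0"
      obtain y where "y \<in> set L" "\<Delta> \<le> y" "y \<le> (1 + \<epsilon> / 2) * \<Delta>"
        using cost_candidates_cover(1)[OF assms(2) kP Q] by (auto simp: L_def)
      then show "\<exists>y\<in>set L. \<Delta> \<le> y \<and> 2 * y \<le> (2 + \<epsilon>) * \<Delta>"
        by (intro bexI[of _ y]) (auto simp: algebra_simps)
    next
      obtain Q \<Delta> p\<^sub>0 c\<^sub>0 where Q: "Q \<subseteq> P" "card Q \<le> k"
        "\<And>p. p \<in> P \<Longrightarrow> \<exists>c\<in>Q. d p c \<le> \<alpha> * fair_radius P d k p \<and> d p c \<le> \<Delta>"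
        "p\<^sub>0 \<in> P" "c\<^sub>0 \<in> Q" "\<Delta> = d p\<^sub>0 c\<^sub>0"
        by (rule optimum[OF assms(6)]) (rule that)
      then show "0 \<le> x" if "x \<in> set L" for x
        using cost_candidates_cover(2)[OF assms(2) kP Q(1,2) _ Q(4-6), of x] that by (auto simp: L_def)
    qed (simp add: rs(2))
    then show "(do {
        tlength xs;
        res \<leftarrow> do {
          rs' \<leftarrow> do {
            tlength xs;
            S' \<leftarrow> Timed S (36 * k * l);
            tmap (\<lambda>p. do {ds \<leftarrow> distances d p S'; r \<leftarrow> select (27 * l - 1) ds; ret (r, p)}) xs
          };
          ps \<leftarrow> heap_sort rs';
          radii_loop d xs k ps [] []
        };
        case res of
          None \<Rightarrow> ret Fail
        | Some rs \<Rightarrow> do {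
            L \<leftarrow> cost_candidates d xs k (\<epsilon> / 2);
            ps \<leftarrow> heap_sort rs;
            search_center d k \<alpha> ps L
          }
      }) \<in> ?G"
      by (simp only: mem_Collect_eq result_bind timed.sel rs' rs(1) option.case L_def)
  qed
  then obtain F where F: "approx_fair_center d xs k \<alpha> \<epsilon> \<delta> = map_pmf F (replicate_pmf s (pmf_of_set P))"
    "\<And>S. S \<in> set_pmf (replicate_pmf s (pmf_of_set P)) \<Longrightarrow>
      (\<forall>p\<in>P. fair_radius P d (2 * k) p \<le> sample_radius d (27 * l) S p \<and>
             sample_radius d (27 * l) S p \<le> fair_radius P d k p) \<Longrightarrow> F S \<in> ?G"
    by blast
  let ?S = "replicate_pmf s (pmf_of_set P)"
  let ?good = "{S. \<forall>p\<in>P. fair_radius P d (2 * k) p \<le> sample_radius d (27 * l) S p \<and>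
             sample_radius d (27 * l) S p \<le> fair_radius P d k p}"
  have "1 - \<delta> \<le> measure_pmf.prob ?S ?good"
    using prob_sample_radius[OF assms(2,4,5)] by (simp add: s_def l_def card_P)
  also have "\<dots> = measure_pmf.prob ?S (?good \<inter> set_pmf ?S)"
    by (simp add: measure_Int_set_pmf)
  also have "\<dots> \<le> measure_pmf.prob ?S (F -` ?G)"
    using F(2) by (intro measure_pmf.finite_measure_mono) auto
  also have "\<dots> = measure_pmf.prob (approx_fair_center d xs k \<alpha> \<epsilon> \<delta>) ?G"
    by (simp add: F(1))
  finally show ?thesis .
qed

end

section \<open>Running time\<close>

text \<open>For the power \<open>2 ^ i\<close> just below \<open>n\<close>,
  \<open>ln 2 \<ge> 2 / 3\<close> gives \<open>i \<le> 3 / 2 * ln n\<close>; as \<open>n\<close> is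
  at least 2, also \<open>1 \<le> 3 / 2 * ln n\<close>, which pays for the step to
  \<open>i + 1\<close>.\<close>

lemma ex_power2_gt:
  assumes "2 \<le> n"
  shows "\<exists>j\<ge>1. n < 2 ^ j \<and> real j \<le> 3 * ln (real n)"
proof -
  obtain i where i: "2 ^ i \<le> n" "n < 2 ^ (i + 1)"
    using ex_power_ivl1[of 2 n] assms by auto
  have ln2: "2 / 3 \<le> ln (2 :: real)"
    using ln2_ge_two_thirds .
  have "real (2 ^ i) \<le> real n"
    using i(1) by (rule of_nat_mono)
  then have "ln (2 ^ i) \<le> ln (real n)"
    using assms by simp
  then have "real i * ln 2 \<le> ln (real n)"
    by (simp add: ln_realpow)
  moreover have "real i * (2 / 3) \<le> real i * ln 2"
    using ln2 by (intro mult_left_mono) auto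
  moreover have "ln 2 \<le> ln (real n)"
    using assms by simp
  ultimately have "real (i + 1) \<le> 3 * ln (real n)"
    using ln2 by simp
  then show ?thesis
    using i(2) by (intro exI[of _ "i + 1"]) auto
qed

lemma steps_exact_radius: "steps (exact_radius d xs k p) \<le> 403 * (length xs + 1)"
  using steps_select[of "nat \<lceil>real (length xs) / real k\<rceil> - 1" "map (d p) xs"]
  by (simp add: exact_radius_def)

text \<open>The \<open>n * n\<close> candidates lead to at most \<open>2 * j\<close> rounds. Since
  there are never more centers than points, a round is quadratic independently of
  \<open>k\<close>.\<close>

lemma steps_approx_fair_center_2_2:
  assumes "2 \<le> length xs" "length xs < 2 ^ j" "1 \<le> j"
  shows "steps (approx_fair_center_2_2 d xs k \<alpha>) \<le> 2500 * (length xs)\<^sup>2 * j"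
proof -
  define n where "n = length xs"
  define rs where "rs = map (\<lambda>p. (result (exact_radius d xs k p), p)) xs"
  define L where "L = concat (map (\<lambda>p. map (d p) xs) xs)"
  have len: "length rs = n" "length L = n * n"
    by (simp_all add: rs_def L_def n_def length_concat comp_def sum_list_triv)
  have pow: "n * n < 2 ^ (2 * j)"
    using assms(2) by (simp add: n_def mult_2 power_add mult_strict_mono)
  have "steps (do {r \<leftarrow> exact_radius d xs k p; ret (r, p)}) \<le> 403 * (n + 1)" for p
    using steps_exact_radius[of d xs k p] by (simp add: n_def)
  then have "steps (tmap (\<lambda>p. do {r \<leftarrow> exact_radius d xs k p; ret (r, p)}) xs) \<le> n * (403 * (n + 1) + 1) + 1"
    unfolding n_def by (rule steps_tmap_le)
  moreover have "steps (heap_sort rs) \<le> n * (3 * j + 6) + 3"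
    using steps_heap_sort[of rs j] len(1) assms(2) by (simp add: n_def)
  moreover have "steps (tmap (\<lambda>p. distances d p xs) xs) = n * (2 * n + 1) + n + 1"
    by (simp add: n_def sum_list_triv)
  moreover have "steps (tconcat (map (\<lambda>p. map (d p) xs) xs)) = n * (n + 2) + 1"
    by (simp add: n_def sum_list_triv comp_def)
  moreover have "steps (search_center d k \<alpha> (result (heap_sort rs)) L) \<le>
      1612 * (n * n) + (2 * j + 1) * ((n + 1) * (3 * n + 4)) + 2"
  proof -
    have "steps (search_center d k \<alpha> (result (heap_sort rs)) L) \<le>
        1612 * (n * n) + (2 * j + 1) * ((n + 1) * (3 * min (Suc k) n + 4)) + 2"
      using steps_search_center[of L "2 * j" "result (heap_sort rs)" n d k \<alpha>] len pow by simp
    also have "\<dots> \<le> 1612 * (n * n) + (2 * j + 1) * ((n + 1) * (3 * n + 4)) + 2"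
      by (intro add_mono mult_le_mono order_refl) simp
    finally show ?thesis .
  qed
  moreover have "steps (approx_fair_center_2_2 d xs k \<alpha>) =
      steps (tmap (\<lambda>p. do {r \<leftarrow> exact_radius d xs k p; ret (r, p)}) xs) + steps (heap_sort rs) +
      steps (tmap (\<lambda>p. distances d p xs) xs) + steps (tconcat (map (\<lambda>p. map (d p) xs) xs)) +
      steps (search_center d k \<alpha> (result (heap_sort rs)) L)"
    by (simp add: approx_fair_center_2_2_def rs_def L_def comp_def del: steps_tmap steps_tconcat)
  ultimately have "steps (approx_fair_center_2_2 d xs k \<alpha>) \<le>
      (n * (403 * (n + 1) + 1) + 1) + (n * (3 * j + 6) + 3) + (n * (2 * n + 1) + n + 1) +
      (n * (n + 2) + 1) + (1612 * (n * n) + (2 * j + 1) * ((n + 1) * (3 * n + 4)) + 2)"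
    by linarith
  also have "\<dots> = 2021 * (n * n) + 6 * (n * n * j) + 421 * n + 17 * (n * j) + 8 * j + 12"
    by (simp add: algebra_simps)
  also have "\<dots> \<le> 2500 * (n * n * j)"
  proof -
    have n: "2 \<le> n"
      using assms(1) by (simp add: n_def)
    note mult_le_mono2[OF n, of n] mult_le_mono[OF n n] mult_le_mono2[OF assms(3), of "n * n"]
      mult_le_mono2[OF n, of "n * j"] mult_le_mono1[OF n, of j]
    moreover have "n * j * n = n * n * j"
      by simp
    ultimately show ?thesis by linarith
  qed
  finally show ?thesis
    by (simp add: n_def power2_eq_square)
qed

text \<open>From \<open>ln y \<ge> 1 - 1 / y\<close> at \<open>y = 1 + \<epsilon> / 2\<close> one
  gets \<open>1 / ln y \<le> 1 + 2 / \<epsilon>\<close>. This is the source of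
  \<open>1 / \<epsilon>\<close> in the running time.\<close>

lemma log_ceiling_le:
  assumes "0 < \<epsilon>" "1 \<le> b" "ln b \<le> 3"
  shows "real (nat \<lceil>log (1 + \<epsilon> / 2) b\<rceil>) \<le> 4 + 6 / \<epsilon>"
proof -
  have pos: "0 < ln (1 + \<epsilon> / 2)"
    using assms(1) by simp
  have "1 - 1 / (1 + \<epsilon> / 2) \<le> ln (1 + \<epsilon> / 2)"
    using ln_le_minus_one[of "1 / (1 + \<epsilon> / 2)"] assms(1) by (simp add: ln_div)
  moreover have "1 - 1 / (1 + \<epsilon> / 2) = 1 / (1 + 2 / \<epsilon>)"
    using assms(1) by (simp add: field_simps)
  ultimately have "1 / ln (1 + \<epsilon> / 2) \<le> 1 + 2 / \<epsilon>"
    using pos assms(1) by (simp add: field_simps)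
  then have "ln b * (1 / ln (1 + \<epsilon> / 2)) \<le> 3 * (1 + 2 / \<epsilon>)"
    using assms pos by (intro mult_mono) auto
  then have "log (1 + \<epsilon> / 2) b \<le> 3 + 6 / \<epsilon>"
    by (simp add: log_def)
  moreover have "0 \<le> log (1 + \<epsilon> / 2) b"
    using assms(1,2) pos by (simp add: log_def)
  ultimately show ?thesis
    by linarith
qed

lemma ln_4_16_le: "ln (4 :: real) \<le> 3" "ln (16 :: real) \<le> 3"
  using ln_realpow[of 2 2] ln_realpow[of 2 4] ln2_le_25_over_36 by simp_all

lemma steps_sampled_run:
  fixes d :: "'a \<Rightarrow> 'a \<Rightarrow> real" and \<epsilon> :: real
  assumes "length S = s" "xs \<noteq> []" "1 \<le> k" "length xs < 2 ^ j"
    and "length (result (cost_candidates d xs k \<epsilon>)) < 2 ^ i"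
  defines "n \<equiv> length xs" and "m1 \<equiv> nat \<lceil>log (1 + \<epsilon>) 16\<rceil>" and "m2 \<equiv> nat \<lceil>log (1 + \<epsilon>) 4\<rceil>"
  shows "steps (do {
        tlength xs;
        res \<leftarrow> do {
          rs' \<leftarrow> do {
            tlength xs;
            S' \<leftarrow> Timed S s;
            tmap (\<lambda>p. do {ds \<leftarrow> distances d p S'; r \<leftarrow> select t ds; ret (r, p)}) xs
          };
          ps \<leftarrow> heap_sort rs';
          radii_loop d xs k ps [] []
        };
        case res of
          None \<Rightarrow> ret Fail
        | Some rs \<Rightarrow> do {
            L \<leftarrow> cost_candidates d xs k \<epsilon>;
            ps \<leftarrow> heap_sort rs;
            search_center d k \<alpha> ps L
          }
      }) \<le> 2 * (n + 1) + s + (n * (402 * s + 402) + 1) + 2 * (n * (3 * j + 6) + 3) +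
        (n * (3 * k + 2) + (3 * k + 1) * (403 * (n + 1) + 3 * k + 2) + 1) +
        ((k + 1) * (3 * n + 2) + 2 * m1 + k * (k * (3 * m2 + 5) + 5) + 4) +
        (1612 * (m1 + k * (k * m2)) + (i + 1) * ((n + 1) * (3 * k + 7)) + 2)"
    (is "_ \<le> ?bound")
proof -
  define sampling where
    "sampling = tmap (\<lambda>p. do {ds \<leftarrow> distances d p S; r \<leftarrow> select t ds; ret (r, p)}) xs"
  define rs' where "rs' = result sampling"
  define radii where "radii = radii_loop d xs k (result (heap_sort rs')) [] []"
  define rest where "rest = (case result radii of
      None \<Rightarrow> ret Fail
    | Some rs \<Rightarrow> do {
        L \<leftarrow> cost_candidates d xs k \<epsilon>;
        ps \<leftarrow> heap_sort rs;
        search_center d k \<alpha> ps L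
      })"
  have "steps (do {ds \<leftarrow> distances d p S; r \<leftarrow> select t ds; ret (r, p)}) \<le> 402 * s + 401" for p
    using steps_select[of t "map (d p) S"] assms(1) by simp
  then have sampling: "steps sampling \<le> n * (402 * s + 402) + 1"
    using steps_tmap_le[of xs "\<lambda>p. do {ds \<leftarrow> distances d p S; r \<leftarrow> select t ds; ret (r, p)}" "402 * s + 401"]
    by (simp add: sampling_def n_def add.commute del: steps_tmap)
  have len: "length rs' = n"
    by (simp add: rs'_def sampling_def n_def)
  then have sort1: "steps (heap_sort rs') \<le> n * (3 * j + 6) + 3"
    using steps_heap_sort[of rs' j] assms(4) by (simp add: n_def)
  have radii: "steps radii \<le> n * (3 * k + 2) + (3 * k + 1) * (403 * (n + 1) + 3 * k + 2) + 1"
    using steps_radii_loop[of d xs k "403 * (n + 1)" "[]" "result (heap_sort rs')" "[]"]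
      steps_exact_radius[of d xs k] by (simp add: radii_def len n_def)
  have rest: "steps rest \<le> ((k + 1) * (3 * n + 2) + 2 * m1 + k * (k * (3 * m2 + 5) + 5) + 4) +
      (n * (3 * j + 6) + 3) + (1612 * (m1 + k * (k * m2)) + (i + 1) * ((n + 1) * (3 * k + 7)) + 2)"
  proof (cases "result radii")
    case None
    then show ?thesis by (simp add: rest_def)
  next
    case (Some rs)
    define L where "L = result (cost_candidates d xs k \<epsilon>)"
    have rs: "length rs = n"
      using length_radii_loop[of d xs k "result (heap_sort rs')" "[]" "[]" rs] Some
      by (simp add: radii_def len)
    have "steps (heap_sort rs) \<le> n * (3 * j + 6) + 3"
      using steps_heap_sort[of rs j] assms(4) rs by (simp add: n_def)
    moreover have "steps (cost_candidates d xs k \<epsilon>) \<le>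
        (k + 1) * (3 * n + 2) + 2 * m1 + k * (k * (3 * m2 + 5) + 5) + 4"
      unfolding n_def m1_def m2_def by (rule cost_candidates_size(2)[OF assms(2,3)])
    moreover have "steps (search_center d k \<alpha> (result (heap_sort rs)) L) \<le>
        1612 * (m1 + k * (k * m2)) + (i + 1) * ((n + 1) * (3 * k + 7)) + 2"
    proof -
      have "length L \<le> m1 + k * (k * m2)"
        unfolding L_def m1_def m2_def by (rule cost_candidates_size(1)[OF assms(2,3)])
      then have "1612 * length L \<le> 1612 * (m1 + k * (k * m2))"
        by (rule mult_le_mono2)
      moreover have "(i + 1) * ((n + 1) * (3 * min (Suc k) n + 4)) \<le> (i + 1) * ((n + 1) * (3 * k + 7))"
        by (intro mult_le_mono order_refl) (simp add: min_def)
      moreover have "steps (search_center d k \<alpha> (result (heap_sort rs)) L) \<le>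
          1612 * length L + (i + 1) * ((n + 1) * (3 * min (Suc k) n + 4)) + 2"
        using assms(5) rs by (intro steps_search_center) (simp_all add: L_def)
      ultimately show ?thesis
        by (meson add_le_mono le_refl order_trans)
    qed
    moreover have "steps rest = steps (cost_candidates d xs k \<epsilon>) + steps (heap_sort rs) +
        steps (search_center d k \<alpha> (result (heap_sort rs)) L)"
      using Some by (simp add: rest_def L_def)
    ultimately show ?thesis by linarith
  qed
  have "(n + 1) + ((n + 1) + s + steps sampling + steps (heap_sort rs') + steps radii) + steps rest \<le> ?bound"
  proof -
    have add: "u + (u + s + a + b + c) + e \<le> 2 * u + s + a' + 2 * b' + c' + f + g"
      if "a \<le> a'" "b \<le> b'" "c \<le> c'" "e \<le> f + b' + g" for u a b c e a' b' c' f g :: nat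
      using that by linarith
    show ?thesis
      by (rule add[OF sampling sort1 radii rest])
  qed
  then show ?thesis
    unfolding steps_bind result_bind timed.sel rest_def radii_def rs'_def sampling_def steps_tlength n_def
    by (simp only: add.assoc)
qed

text \<open>After expansion every monomial is charged to \<open>X\<close> or, for the grid sizes
  \<open>m1\<close> and \<open>m2\<close>, to \<open>X\<close> and \<open>Y\<close>. The largest
  share of the constant is \<open>402 * 108\<close>, from selecting in the samples.\<close>

lemma sampled_run_bound:
  fixes n k s i j m1 m2 :: nat and \<Lambda> \<epsilon> :: real
  defines "X \<equiv> real k * real n * \<Lambda>" and "Y \<equiv> (real k)\<^sup>2 / \<epsilon>"
  assumes "0 < \<epsilon>" "1 \<le> k" "k \<le> n" "1 \<le> \<Lambda>"
    and "real s \<le> 108 * (real k * \<Lambda>)" "real j \<le> 3 * \<Lambda>" "real i \<le> 15 * \<Lambda>"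
    and m: "real m1 \<le> 4 + 6 / \<epsilon>" "real m2 \<le> 4 + 6 / \<epsilon>"
  shows "real (2 * (n + 1) + s + (n * (402 * s + 402) + 1) + 2 * (n * (3 * j + 6) + 3) +
        (n * (3 * k + 2) + (3 * k + 1) * (403 * (n + 1) + 3 * k + 2) + 1) +
        ((k + 1) * (3 * n + 2) + 2 * m1 + k * (k * (3 * m2 + 5) + 5) + 4) +
        (1612 * (m1 + k * (k * m2)) + (i + 1) * ((n + 1) * (3 * k + 7)) + 2)) \<le> 70000 * (X + Y)"
proof -
  define K where "K = real k"
  define N where "N = real n"
  have KN: "1 \<le> K" "1 \<le> N" "K \<le> N"
    using assms(4,5) by (simp_all add: K_def N_def)
  have mono: "a * b * c \<le> a' * b' * c'"
    if "0 \<le> a" "0 \<le> b" "0 \<le> c" "a \<le> a'" "b \<le> b'" "c \<le> c'" for a b c a' b' c' :: real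
    using that by (intro mult_mono) auto
  have X: "X = K * N * \<Lambda>"
    by (simp add: X_def K_def N_def)
  have pure: "1 \<le> X" "N \<le> X" "K \<le> X" "K * N \<le> X" "K * K \<le> X" "K * \<Lambda> \<le> X" "\<Lambda> \<le> X" "N * \<Lambda> \<le> X"
    unfolding X using mono[of 1 1 1 K N \<Lambda>] mono[of 1 N 1 K N \<Lambda>] mono[of K 1 1 K N \<Lambda>]
      mono[of K N 1 K N \<Lambda>] mono[of K K 1 K N \<Lambda>] mono[of K 1 \<Lambda> K N \<Lambda>] mono[of 1 1 \<Lambda> K N \<Lambda>]
      mono[of 1 N \<Lambda> K N \<Lambda>] KN assms(6) by simp_all
  have "N * real s \<le> N * (108 * (K * \<Lambda>))"
    using assms(7) KN by (intro mult_left_mono) (auto simp: K_def)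
  then have s: "real s \<le> 108 * X" "N * real s \<le> 108 * X"
    using assms(7) pure by (simp_all add: X K_def mult_ac)
  have j: "N * real j \<le> 3 * X"
  proof -
    have "N * real j \<le> N * (3 * \<Lambda>)"
      using assms(8) KN by (intro mult_left_mono) auto
    also have "\<dots> = 3 * (N * \<Lambda>)"
      by simp
    finally show ?thesis
      using pure by linarith
  qed
  have i: "real i \<le> 15 * X" "N * real i \<le> 15 * X" "K * real i \<le> 15 * X" "K * N * real i \<le> 15 * X"
  proof -
    have le: "c * real i \<le> 15 * X" if "0 \<le> c" "c * \<Lambda> \<le> X" for c
    proof -
      have "c * real i \<le> c * (15 * \<Lambda>)"
        using assms(9) that(1) by (rule mult_left_mono)
      then show ?thesis
        using that(2) by linarith
    qed
    show "real i \<le> 15 * X" "N * real i \<le> 15 * X" "K * real i \<le> 15 * X" "K * N * real i \<le> 15 * X"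
      using le[of 1] le[of N] le[of K] le[of "K * N"] pure KN by (simp_all add: X)
  qed
  have "K * K * (4 + 6 / \<epsilon>) = 4 * (K * K) + 6 * Y"
    by (simp add: Y_def K_def power2_eq_square distrib_left)
  then have Y: "K * K * (4 + 6 / \<epsilon>) \<le> 4 * X + 6 * Y" "0 \<le> Y"
    using pure assms(3) by (simp_all add: Y_def)
  have "1 * 1 \<le> K * K"
    using KN by (intro mult_mono) auto
  then have "1 * (4 + 6 / \<epsilon>) \<le> K * K * (4 + 6 / \<epsilon>)"
    using assms(3) by (intro mult_right_mono) auto
  then have m1: "real m1 \<le> 4 * X + 6 * Y"
    unfolding mult_1 using m(1) Y(1) by (meson order_trans)
  have "K * K * real m2 \<le> K * K * (4 + 6 / \<epsilon>)"
    using m(2) KN by (intro mult_left_mono) auto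
  then have m2: "K * K * real m2 \<le> 4 * X + 6 * Y"
    using Y(1) by (rule order_trans)
  have "real (2 * (n + 1) + s + (n * (402 * s + 402) + 1) + 2 * (n * (3 * j + 6) + 3) +
        (n * (3 * k + 2) + (3 * k + 1) * (403 * (n + 1) + 3 * k + 2) + 1) +
        ((k + 1) * (3 * n + 2) + 2 * m1 + k * (k * (3 * m2 + 5) + 5) + 4) +
        (1612 * (m1 + k * (k * m2)) + (i + 1) * ((n + 1) * (3 * k + 7)) + 2)) =
      831 * N + real s + 402 * (N * real s) + 6 * (N * real j) + 1218 * (K * N) + 14 * (K * K) +
      1228 * K + 1614 * real m1 + 1615 * (K * K * real m2) + 3 * (K * N * real i) +
      7 * (N * real i) + 3 * (K * real i) + 7 * real i + 430"
    by (simp add: K_def N_def algebra_simps)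
  also have "\<dots> \<le> 70000 * (X + Y)"
    using s j i m1 m2 pure Y(2) by argo
  finally show ?thesis .
qed

lemma steps_approx_fair_center:
  assumes "distinct xs" "2 \<le> length xs" "1 \<le> k" "0 < \<epsilon>" "0 < \<delta>" "\<delta> < 1"
    and run: "run \<in> set_pmf (approx_fair_center d xs k \<alpha> \<epsilon> \<delta>)"
  defines "n \<equiv> real (length xs)"
  shows "real (steps run) \<le> 70000 * (real k * n * ln (n / \<delta>) + (real k)\<^sup>2 / \<epsilon>)"
proof (cases "real k > n / 6 \<or> (real k)\<^sup>2 / \<epsilon> > n\<^sup>2 * ln n")
  case True
  have n: "2 \<le> n"
    using assms(2) by (simp add: n_def)
  obtain j where j: "1 \<le> j" "length xs < 2 ^ j" "real j \<le> 3 * ln n"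
    using ex_power2_gt[OF assms(2)] by (auto simp: n_def)
  have "run = do {tlength xs; approx_fair_center_2_2 d xs k \<alpha>}"
    using run True by (simp add: approx_fair_center_def Let_def n_def)
  then have "steps run = length xs + 1 + steps (approx_fair_center_2_2 d xs k \<alpha>)"
    by simp
  also have "\<dots> \<le> 1 * ((length xs)\<^sup>2 * j) + 2500 * ((length xs)\<^sup>2 * j)"
  proof (rule add_mono)
    have "length xs * 2 \<le> length xs * length xs"
      by (rule mult_le_mono2[OF assms(2)])
    moreover have "(length xs)\<^sup>2 * 1 \<le> (length xs)\<^sup>2 * j"
      by (rule mult_le_mono2[OF j(1)])
    ultimately show "length xs + 1 \<le> 1 * ((length xs)\<^sup>2 * j)"
      using assms(2) unfolding power2_eq_square by linarith
    show "steps (approx_fair_center_2_2 d xs k \<alpha>) \<le> 2500 * ((length xs)\<^sup>2 * j)"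
      using steps_approx_fair_center_2_2[OF assms(2) j(2,1)] by (simp only: mult.assoc)
  qed
  finally have "real (steps run) \<le> real (2501 * ((length xs)\<^sup>2 * j))"
    by (subst of_nat_le_iff) (simp add: algebra_simps)
  also have "\<dots> = 2501 * (n\<^sup>2 * real j)"
    by (simp add: n_def)
  also have "\<dots> \<le> 2501 * (n\<^sup>2 * (3 * ln n))"
    using j(3) by (intro mult_left_mono) auto
  finally have steps: "real (steps run) \<le> 7503 * (n\<^sup>2 * ln n)"
    by simp
  have ln: "0 \<le> ln n" "ln n \<le> ln (n / \<delta>)"
    using n assms(5,6) by (simp_all add: le_divide_eq)
  have X: "0 \<le> real k * n * ln (n / \<delta>)" and Y: "0 \<le> (real k)\<^sup>2 / \<epsilon>"
    using n order_trans[OF ln] assms(4) by simp_all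
  \<comment> \<open>Either \<open>n\<close> is below \<open>6 * k\<close>, which turns one factor
    \<open>n\<close> into \<open>6 * k\<close>, or the second condition directly bounds
    \<open>n\<^sup>2 * ln n\<close> by \<open>k\<^sup>2 / \<epsilon>\<close>.\<close>
  show ?thesis
  proof (cases "real k > n / 6")
    case True
    then have "n * n * ln n \<le> (6 * real k) * n * ln (n / \<delta>)"
      using n ln by (intro mult_mono) auto
    then show ?thesis
      using steps X Y by (simp add: power2_eq_square)
  next
    case False
    then have "n\<^sup>2 * ln n \<le> (real k)\<^sup>2 / \<epsilon>"
      using True by simp
    then show ?thesis
      using steps X Y by simp
  qed
next
  case False
  define l where "l = log_factor (length xs) \<delta>"
  define s where "s = 36 * k * l"
  define \<Lambda> where "\<Lambda> = ln (n / \<delta>)"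
  define m1 where "m1 = nat \<lceil>log (1 + \<epsilon> / 2) 16\<rceil>"
  define m2 where "m2 = nat \<lceil>log (1 + \<epsilon> / 2) 4\<rceil>"
  have k: "1 \<le> real k" "6 * real k \<le> n"
    using False assms(3) by auto
  then have n: "6 \<le> n"
    by linarith
  \<comment> \<open>With \<open>n \<ge> 6\<close> the logarithm is at least 1 and absorbs additive
    constants.\<close>
  have "exp 1 \<le> n"
    using n e_less_272 by linarith
  then have ln_n: "1 \<le> ln n"
    using n by (simp add: ln_ge_iff)
  have "ln n \<le> \<Lambda>"
    unfolding \<Lambda>_def using n assms(5,6) by (simp add: le_divide_eq)
  then have \<Lambda>: "1 \<le> \<Lambda>" "ln n \<le> \<Lambda>"
    using ln_n by auto
  have "real l \<le> ln (2 * n / \<delta>) + 1"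
    using log_factor_props(3)[OF assms(5,6), of "length xs"] assms(2) by (simp add: l_def n_def)
  also have "ln (2 * n / \<delta>) = ln 2 + \<Lambda>"
    using n assms(5) by (simp add: \<Lambda>_def ln_mult ln_div)
  \<comment> \<open>The bound is \<open>\<Lambda> + ln 2 + 1\<close>, and the constants are at most
    \<open>2 * \<Lambda>\<close>.\<close>
  finally have "real l \<le> 3 * \<Lambda>"
    using ln_2_less_1 \<Lambda>(1) by linarith
  then have "real (36 * k) * real l \<le> real (36 * k) * (3 * \<Lambda>)"
    by (rule mult_left_mono) simp
  then have s: "real s \<le> 108 * (real k * \<Lambda>)"
    by (simp add: s_def)
  obtain j where j: "length xs < 2 ^ j" "real j \<le> 3 * ln n"
    using ex_power2_gt[OF assms(2)] by (auto simp: n_def)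
  have m: "real m1 \<le> 4 + 6 / \<epsilon>" "real m2 \<le> 4 + 6 / \<epsilon>"
    unfolding m1_def m2_def using ln_4_16_le assms(4) by (intro log_ceiling_le; simp)+
  have xs: "xs \<noteq> []"
    using assms(2) by auto
  \<comment> \<open>As the branch condition fails, \<open>k\<^sup>2 / \<epsilon>\<close> is at most
    \<open>n\<^sup>2 * ln n\<close>. So the number of candidates is polynomial in \<open>n\<close>
    however small \<open>\<epsilon>\<close> is, and the search takes \<open>O(ln n)\<close>
    rounds.\<close>
  obtain i where i: "length (result (cost_candidates d xs k (\<epsilon> / 2))) < 2 ^ i" "real i \<le> 15 * ln n"
  proof -
    define len where "len = length (result (cost_candidates d xs k (\<epsilon> / 2)))"
    have "len \<le> m1 + k * (k * m2)"
      unfolding len_def m1_def m2_def by (rule cost_candidates_size(1)[OF xs assms(3)])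
    then have "real len \<le> real (m1 + k * (k * m2))"
      by (rule of_nat_mono)
    also have "\<dots> = real m1 + (real k)\<^sup>2 * real m2"
      by (simp add: power2_eq_square)
    also have "\<dots> \<le> (real k)\<^sup>2 * (4 + 6 / \<epsilon>) + (real k)\<^sup>2 * (4 + 6 / \<epsilon>)"
    proof (rule add_mono)
      have "1 * (4 + 6 / \<epsilon>) \<le> (real k)\<^sup>2 * (4 + 6 / \<epsilon>)"
        using k(1) assms(4) by (intro mult_right_mono) (auto simp: one_le_power)
      then show "real m1 \<le> (real k)\<^sup>2 * (4 + 6 / \<epsilon>)"
        using m(1) by simp
    qed (use m(2) in \<open>intro mult_left_mono, auto\<close>)
    also have "\<dots> = 8 * (real k)\<^sup>2 + 12 * ((real k)\<^sup>2 / \<epsilon>)"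
      by (simp add: distrib_left)
    also have "\<dots> \<le> 8 * n\<^sup>2 + 12 * (n\<^sup>2 * n)"
    proof (intro add_mono mult_left_mono)
      show "(real k)\<^sup>2 \<le> n\<^sup>2"
        using k n by (intro power_mono) auto
      have "(real k)\<^sup>2 / \<epsilon> \<le> n\<^sup>2 * ln n"
        using False by simp
      also have "\<dots> \<le> n\<^sup>2 * n"
        using n ln_le_minus_one[of n] by (intro mult_left_mono) auto
      finally show "(real k)\<^sup>2 / \<epsilon> \<le> n\<^sup>2 * n" .
    qed auto
    also have "\<dots> + 2 \<le> n ^ 5"
    proof -
      have "6 * 6 \<le> n * n"
        using n by (intro mult_mono) auto
      then have n3: "36 * n ^ 3 \<le> n ^ 5" "6 * n\<^sup>2 \<le> n ^ 3" "36 \<le> n\<^sup>2"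
        using mult_right_mono[of 36 "n * n" "n ^ 3"] mult_right_mono[of 6 n "n\<^sup>2"] n
        by (simp_all add: power_numeral_reduce mult_ac)
      have "n\<^sup>2 * n = n ^ 3"
        by (simp add: power_numeral_reduce)
      then show ?thesis
        using n3 by linarith
    qed
    finally have le: "real (len + 2) \<le> n ^ 5"
      by simp
    \<comment> \<open>Adding 2 meets the requirement of \<open>ex_power2_gt\<close> even if the list
      is empty.\<close>
    obtain i where i: "len + 2 < 2 ^ i" "real i \<le> 3 * ln (real (len + 2))"
      using ex_power2_gt[of "len + 2"] by auto
    have "ln (real (len + 2)) \<le> ln (n ^ 5)"
      using le n by (subst ln_le_cancel_iff) auto
    also have "\<dots> = 5 * ln n"
      using n by (simp add: ln_realpow)
    finally have "real i \<le> 15 * ln n"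
      using i(2) by simp
    then show ?thesis
      using i(1) by (intro that[of i]) (simp_all add: len_def)
  qed
  have neg: "\<not> (real k > real (length xs) / 6 \<or> (real k)\<^sup>2 / \<epsilon> > (real (length xs))\<^sup>2 * ln (real (length xs)))"
    using False unfolding n_def .
  from run obtain S where run: "run = do {
        tlength xs;
        res \<leftarrow> do {
          rs' \<leftarrow> do {
            tlength xs;
            S' \<leftarrow> Timed S s;
            tmap (\<lambda>p. do {ds \<leftarrow> distances d p S'; r \<leftarrow> select (27 * l - 1) ds; ret (r, p)}) xs
          };
          ps \<leftarrow> heap_sort rs';
          radii_loop d xs k ps [] []
        };
        case res of
          None \<Rightarrow> ret Fail
        | Some rs \<Rightarrow> do {
            L \<leftarrow> cost_candidates d xs k (\<epsilon> / 2);
            ps \<leftarrow> heap_sort rs;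
            search_center d k \<alpha> ps L
          }
      }"
    and S: "S \<in> set_pmf (replicate_pmf s (pmf_of_set (set xs)))"
    unfolding approx_fair_center_eq[OF neg] s_def l_def set_map_pmf by (rule imageE)
  have "length S = s"
    using S by (simp add: set_replicate_pmf)
  have "real (steps run) \<le> 70000 * (real k * real (length xs) * \<Lambda> + (real k)\<^sup>2 / \<epsilon>)"
    unfolding run
  proof (rule order_trans[OF of_nat_mono[OF steps_sampled_run[OF \<open>length S = s\<close> xs assms(3) j(1) i(1)]]],
      fold m1_def m2_def, rule sampled_run_bound)
    show "k \<le> length xs"
      using k by (simp add: n_def)
  qed (use assms(3,4) \<Lambda> s j(2) i(2) m in auto)
  then show ?thesis
    by (simp add: n_def \<Lambda>_def)
qed

text \<open>The time bound assumes two points: for a single one,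
  \<open>k * ln (1 / \<delta>) + k\<^sup>2 / \<epsilon>\<close> tends to 0 as
  \<open>\<delta>\<close> approaches 1 and \<open>\<epsilon>\<close> grows, while every run takes at
  least one step, so no constant would do.\<close>

theorem theorem2:
  shows
    "(\<forall>(P :: 'a set) (d :: 'a \<Rightarrow> 'a \<Rightarrow> real) (xs :: 'a list) (k :: nat) (\<alpha> :: real) (\<epsilon> :: real) (\<delta> :: real).
        Metric_space P d \<and> finite P \<and> P \<noteq> {} \<and> distinct_distances P d \<and>
        distinct xs \<and> set xs = P \<and> 1 \<le> k \<and> 0 < \<alpha> \<and> 0 < \<epsilon> \<and> 0 < \<delta> \<and> \<delta> < 1 \<and>
        (\<exists>C. feasible P d \<alpha> k C)
        \<longrightarrow> measure_pmf.prob (approx_fair_center d xs k \<alpha> \<epsilon> \<delta>)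
              {run. \<exists>C. result run = Centers C \<and> approximation P d \<alpha> k (2 + \<epsilon>) 10 (set C)} \<ge> 1 - \<delta>)
     \<and>
     (\<exists>c>0. \<forall>(P :: 'a set) (d :: 'a \<Rightarrow> 'a \<Rightarrow> real) (xs :: 'a list) (k :: nat) (\<alpha> :: real) (\<epsilon> :: real) (\<delta> :: real).
        Metric_space P d \<and> finite P \<and> 2 \<le> card P \<and> distinct_distances P d \<and>
        distinct xs \<and> set xs = P \<and> 1 \<le> k \<and> 0 < \<alpha> \<and> 0 < \<epsilon> \<and> 0 < \<delta> \<and> \<delta> < 1
        \<longrightarrow> (\<forall>run\<in>set_pmf (approx_fair_center d xs k \<alpha> \<epsilon> \<delta>).
              real (steps run) \<le>
                c * (real k * real (card P) * ln (real (card P) / \<delta>) + (real k)\<^sup>2 / \<epsilon>)))"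
proof (intro conjI allI impI)
  fix P :: "'a set" and d :: "'a \<Rightarrow> 'a \<Rightarrow> real" and xs :: "'a list" and k :: nat and \<alpha> \<epsilon> \<delta> :: real
  assume A: "Metric_space P d \<and> finite P \<and> P \<noteq> {} \<and> distinct_distances P d \<and>
        distinct xs \<and> set xs = P \<and> 1 \<le> k \<and> 0 < \<alpha> \<and> 0 < \<epsilon> \<and> 0 < \<delta> \<and> \<delta> < 1 \<and>
        (\<exists>C. feasible P d \<alpha> k C)"
  then interpret enumerated_metric P d xs
    by (simp add: enumerated_metric_def enumerated_metric_axioms_def)
  show "measure_pmf.prob (approx_fair_center d xs k \<alpha> \<epsilon> \<delta>)
      {run. \<exists>C. result run = Centers C \<and> approximation P d \<alpha> k (2 + \<epsilon>) 10 (set C)} \<ge> 1 - \<delta>"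
    using A prob_approx_fair_center by blast
next
  show "\<exists>c>0. \<forall>(P :: 'a set) (d :: 'a \<Rightarrow> 'a \<Rightarrow> real) (xs :: 'a list) (k :: nat) (\<alpha> :: real) (\<epsilon> :: real) (\<delta> :: real).
        Metric_space P d \<and> finite P \<and> 2 \<le> card P \<and> distinct_distances P d \<and>
        distinct xs \<and> set xs = P \<and> 1 \<le> k \<and> 0 < \<alpha> \<and> 0 < \<epsilon> \<and> 0 < \<delta> \<and> \<delta> < 1
        \<longrightarrow> (\<forall>run\<in>set_pmf (approx_fair_center d xs k \<alpha> \<epsilon> \<delta>).
              real (steps run) \<le>
                c * (real k * real (card P) * ln (real (card P) / \<delta>) + (real k)\<^sup>2 / \<epsilon>))"
    using steps_approx_fair_center by (intro exI[of _ 70000]) (auto simp: distinct_card)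
qed

end
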